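(* Let $M$ be a compact complex surface with a Hermitian metric $h$, and let $(N,g)$ be a Riemannian manifold with non-positive complex sectional curvature. Let $f:(M,h)\to(N,g)$ be a Hermitian harmonic map. If $M$ admits a Hermitian metric $h_0$ with uniformly RC-positive curvature, then $f$ is a constant map.
   Context: Manifolds are connected and maps are smooth. A complex surface is a complex manifold of complex dimension $2$. Hermitian harmonic: a smooth map $f:(M,h)\to(N,g)$ is Hermitian harmonic if, in local holomorphic coordinates $\{z^\alpha\}$ on $M$ and local coordinates $\{y^i\}$ on $N$, with $\Gamma^i_{jk}$ the Christoffel symbols of $g$ evaluated along $f$ and $e_i=f^*(\partial/\partial y^i)$, $$h^{\alpha\bar\beta}\left(\frac{\partial^2 f^i}{\partial z^\alpha\partial\bar z^\beta}+\Gamma^i_{jk}\frac{\partial f^j}{\partial\bar z^\beta}\frac{\partial f^k}{\partial z^\alpha}\right)\otimes e_i=0.$$ Uniform RC-positivity: for a Hermitian metric $h_0$ on $M$, let $R_{\alpha\bar\beta\gamma\bar\delta}=-\frac{\partial^2 (h_0)_{\gamma\bar\delta}}{\partial z^\alpha\partial\bar z^\beta}+h_0^{\mu\bar\nu}\frac{\partial (h_0)_{\gamma\bar\nu}}{\partial z^\alpha}\frac{\partial (h_0)_{\mu\bar\delta}}{\partial\bar z^\beta}$ be the Chern curvature tensor of $(T^{1,0}M,h_0)$ and $R(u,\bar u,v,\bar v)=R_{\alpha\bar\beta\gamma\bar\delta}u^\alpha\bar u^\beta v^\gamma\bar v^\delta$. $h_0$ has uniformly RC-positive curvature if at every point $q\in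 M$ there exists $u\in T^{1,0}_qM$ such that $R(u,\bar u,v,\bar v)>0$ for every nonzero $v\in T^{1,0}_qM$. Non-positive complex sectional curvature: for $(N,g)$ with Levi-Civita connection $\nabla$, put $R(X,Y)Z=\nabla_X\nabla_YZ-\nabla_Y\nabla_XZ-\nabla_{[X,Y]}Z$ and $R(X,Y,Z,W)=g(R(X,Y)Z,W)$, extended $\mathbb{C}$-multilinearly to $T_{\mathbb{C}}N=TN\otimes\mathbb{C}$. $(N,g)$ has non-positive complex sectional curvature if $R(Z,\bar W,W,\bar Z)\le 0$ for all $Z,W\in T_{\mathbb{C}}N$ (at the same point). *)

theory Defs
  imports "HOL-Analysis.Analysis"
begin

section \<open>Calculus in coordinates\<close>

text \<open>Intended for open \<open>S\<close> and finite-dimensional domains, where all iterated directional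
  derivatives being continuous is the usual notion of class \<open>C^k\<close>.\<close>

fun Ck_on :: "nat \<Rightarrow> 'e::real_normed_vector set \<Rightarrow> ('e \<Rightarrow> 'f::real_normed_vector) \<Rightarrow> bool" where
  "Ck_on 0 S F \<longleftrightarrow> continuous_on S F"
| "Ck_on (Suc k) S F \<longleftrightarrow>
     (\<forall>x\<in>S. F differentiable (at x)) \<and>
     (\<forall>v. Ck_on k S (\<lambda>x. frechet_derivative F (at x) v))"

definition smooth_on :: "'e::real_normed_vector set \<Rightarrow> ('e \<Rightarrow> 'f::real_normed_vector) \<Rightarrow> bool" where
  "smooth_on S F \<longleftrightarrow> (\<forall>k. Ck_on k S F)"

definition holomorphic_map_on :: "(complex^'m) set \<Rightarrow> (complex^'m \<Rightarrow> complex^'k) \<Rightarrow> bool" where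
  "holomorphic_map_on S F \<longleftrightarrow>
     (\<forall>z\<in>S. \<exists>F'. (F has_derivative F') (at z) \<and> (\<forall>a v. F' (a *s v) = a *s F' v))"

definition dreal :: "'n \<Rightarrow> (real^'n \<Rightarrow> real) \<Rightarrow> real^'n \<Rightarrow> real" where
  "dreal i F y = frechet_derivative F (at y) (axis i 1)"

text \<open>Wirtinger derivatives, with \<open>z\<^sup>\<alpha> = x\<^sup>\<alpha> + \<i> y\<^sup>\<alpha>\<close>: the vectors
  \<open>axis \<alpha> 1\<close> and \<open>axis \<alpha> \<i>\<close> are the real coordinate directions of
  \<open>x\<^sup>\<alpha>\<close> and \<open>y\<^sup>\<alpha>\<close>.\<close>

definition dz :: "'m \<Rightarrow> (complex^'m \<Rightarrow> complex) \<Rightarrow> complex^'m \<Rightarrow> complex" where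
  "dz \<alpha> F z = (frechet_derivative F (at z) (axis \<alpha> 1)
               - \<i> * frechet_derivative F (at z) (axis \<alpha> \<i>)) / 2"

definition dzbar :: "'m \<Rightarrow> (complex^'m \<Rightarrow> complex) \<Rightarrow> complex^'m \<Rightarrow> complex" where
  "dzbar \<alpha> F z = (frechet_derivative F (at z) (axis \<alpha> 1)
                  + \<i> * frechet_derivative F (at z) (axis \<alpha> \<i>)) / 2"


section \<open>Manifolds\<close>

text \<open>A chart consists of its domain and its coordinate map; the values of the coordinate map
  outside the domain are irrelevant.\<close>

type_synonym ('a, 'e) chart = "'a set \<times> ('a \<Rightarrow> 'e)"

abbreviation cdom :: "('a, 'e) chart \<Rightarrow> 'a set" where
  "cdom c \<equiv> fst c"

abbreviation coord :: "('a, 'e) chart \<Rightarrow> 'a \<Rightarrow> 'e" where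
  "coord c \<equiv> snd c"

definition param :: "('a, 'e) chart \<Rightarrow> 'e \<Rightarrow> 'a" where
  "param c = inv_into (cdom c) (coord c)"

definition transition :: "('a, 'e) chart \<Rightarrow> ('a, 'e) chart \<Rightarrow> 'e \<Rightarrow> 'e" where
  "transition c c' = (\<lambda>x. coord c' (param c x))"

definition connected_topological_manifold ::
  "'a topology \<Rightarrow> ('a, 'e::real_normed_vector) chart set \<Rightarrow> bool" where
  "connected_topological_manifold X A \<longleftrightarrow>
     Hausdorff_space X \<and> second_countable X \<and> connected_space X \<and>
     (\<Union>c\<in>A. cdom c) = topspace X \<and>
     (\<forall>c\<in>A. openin X (cdom c) \<and> open (coord c ` cdom c) \<and>
            homeomorphic_map (subtopology X (cdom c)) (top_of_set (coord c ` cdom c)) (coord c))"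

text \<open>The atlases below need not be maximal: all notions defined from them are invariant under
  passing to a larger compatible atlas.\<close>

definition smooth_manifold :: "'b topology \<Rightarrow> ('b, real^'n) chart set \<Rightarrow> bool" where
  "smooth_manifold Y B \<longleftrightarrow>
     connected_topological_manifold Y B \<and>
     (\<forall>d\<in>B. \<forall>d'\<in>B. smooth_on (coord d ` (cdom d \<inter> cdom d')) (transition d d'))"

definition complex_manifold :: "'a topology \<Rightarrow> ('a, complex^'m) chart set \<Rightarrow> bool" where
  "complex_manifold X A \<longleftrightarrow>
     connected_topological_manifold X A \<and>
     (\<forall>c\<in>A. \<forall>c'\<in>A. holomorphic_map_on (coord c ` (cdom c \<inter> cdom c')) (transition c c'))"

definition complex_surface :: "'a topology \<Rightarrow> ('a, complex^2) chart set \<Rightarrow> bool" where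
  "complex_surface X A \<longleftrightarrow> complex_manifold X A"

definition local_rep ::
  "('a, 'e) chart \<Rightarrow> ('b, 'f) chart \<Rightarrow> ('a \<Rightarrow> 'b) \<Rightarrow> 'e \<Rightarrow> 'f" where
  "local_rep c d f = (\<lambda>x. coord d (f (param c x)))"

definition smooth_map ::
  "'a topology \<Rightarrow> ('a, 'e::real_normed_vector) chart set \<Rightarrow>
   'b topology \<Rightarrow> ('b, 'f::real_normed_vector) chart set \<Rightarrow> ('a \<Rightarrow> 'b) \<Rightarrow> bool" where
  "smooth_map X A Y B f \<longleftrightarrow>
     continuous_map X Y f \<and>
     (\<forall>c\<in>A. \<forall>d\<in>B. smooth_on (coord c ` {p \<in> cdom c. f p \<in> cdom d}) (local_rep c d f))"


section \<open>Metrics\<close>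

text \<open>Tensor fields are given by their components in the charts: \<open>g d q $ i $ j\<close> is
  \<open>g\<^sub>i\<^sub>j\<close> at the point \<open>q\<close> in the chart \<open>d\<close>, and
  \<open>h c p $ \<alpha> $ \<beta>\<close> is the component of \<open>h\<close> on
  \<open>\<partial>/\<partial>z\<^sup>\<alpha>\<close> and the conjugate of \<open>\<partial>/\<partial>z\<^sup>\<beta>\<close>.  The transformation
  laws make the components in different charts represent the same tensor field.\<close>

type_synonym ('b, 'n) rmetric = "('b, real^'n) chart \<Rightarrow> 'b \<Rightarrow> real^'n^'n"

type_synonym ('a, 'm) hmetric = "('a, complex^'m) chart \<Rightarrow> 'a \<Rightarrow> complex^'m^'m"

definition in_chart :: "(('a, 'e) chart \<Rightarrow> 'a \<Rightarrow> 't) \<Rightarrow> ('a, 'e) chart \<Rightarrow> 'e \<Rightarrow> 't" where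
  "in_chart g c = (\<lambda>x. g c (param c x))"

definition riemannian_metric :: "('b, real^'n) chart set \<Rightarrow> ('b, 'n) rmetric \<Rightarrow> bool" where
  "riemannian_metric B g \<longleftrightarrow>
     (\<forall>d\<in>B.
        smooth_on (coord d ` cdom d) (in_chart g d) \<and>
        (\<forall>q\<in>cdom d.
           (\<forall>i j. g d q $ i $ j = g d q $ j $ i) \<and>
           (\<forall>v. v \<noteq> 0 \<longrightarrow> 0 < (\<Sum>i\<in>UNIV. \<Sum>j\<in>UNIV. g d q $ i $ j * v $ i * v $ j)))) \<and>
     (\<forall>d\<in>B. \<forall>d'\<in>B. \<forall>q \<in> cdom d \<inter> cdom d'. \<forall>i j.
        g d q $ i $ j =
          (\<Sum>k\<in>UNIV. \<Sum>l\<in>UNIV. g d' q $ k $ l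
             * dreal i (\<lambda>y. transition d d' y $ k) (coord d q)
             * dreal j (\<lambda>y. transition d d' y $ l) (coord d q)))"

text \<open>In the positivity clause the sum is real by Hermitian symmetry.\<close>

definition hermitian_metric :: "('a, complex^'m) chart set \<Rightarrow> ('a, 'm) hmetric \<Rightarrow> bool" where
  "hermitian_metric A h \<longleftrightarrow>
     (\<forall>c\<in>A.
        smooth_on (coord c ` cdom c) (in_chart h c) \<and>
        (\<forall>p\<in>cdom c.
           (\<forall>\<alpha> \<beta>. h c p $ \<alpha> $ \<beta> = cnj (h c p $ \<beta> $ \<alpha>)) \<and>
           (\<forall>v. v \<noteq> 0 \<longrightarrow>
              0 < Re (\<Sum>\<alpha>\<in>UNIV. \<Sum>\<beta>\<in>UNIV. h c p $ \<alpha> $ \<beta> * v $ \<alpha> * cnj (v $ \<beta>))))) \<and>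
     (\<forall>c\<in>A. \<forall>c'\<in>A. \<forall>p \<in> cdom c \<inter> cdom c'. \<forall>\<alpha> \<beta>.
        h c p $ \<alpha> $ \<beta> =
          (\<Sum>\<mu>\<in>UNIV. \<Sum>\<nu>\<in>UNIV. h c' p $ \<mu> $ \<nu>
             * dz \<alpha> (\<lambda>z. transition c c' z $ \<mu>) (coord c p)
             * cnj (dz \<beta> (\<lambda>z. transition c c' z $ \<nu>) (coord c p))))"


section \<open>Levi-Civita connection and complex sectional curvature\<close>

text \<open>In this section \<open>G\<close> is the matrix of a Riemannian metric as a function of the
  coordinates, and vector fields are likewise written in coordinates.\<close>

definition christoffel ::
  "(real^'n \<Rightarrow> real^'n^'n) \<Rightarrow> 'n \<Rightarrow> 'n \<Rightarrow> 'n \<Rightarrow> real^'n \<Rightarrow> real" where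
  "christoffel G i j k y =
     (\<Sum>l\<in>UNIV. matrix_inv (G y) $ i $ l *
        (dreal j (\<lambda>x. G x $ k $ l) y + dreal k (\<lambda>x. G x $ j $ l) y - dreal l (\<lambda>x. G x $ j $ k) y)) / 2"

definition levi_civita ::
  "(real^'n \<Rightarrow> real^'n^'n) \<Rightarrow> (real^'n \<Rightarrow> real^'n) \<Rightarrow> (real^'n \<Rightarrow> real^'n) \<Rightarrow> real^'n \<Rightarrow> real^'n" where
  "levi_civita G X Z y =
     frechet_derivative Z (at y) (X y)
     + (\<chi> i. \<Sum>j\<in>UNIV. \<Sum>k\<in>UNIV. christoffel G i j k y * X y $ j * Z y $ k)"

definition lie_bracket ::
  "(real^'n \<Rightarrow> real^'n) \<Rightarrow> (real^'n \<Rightarrow> real^'n) \<Rightarrow> real^'n \<Rightarrow> real^'n" where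
  "lie_bracket X Y y = frechet_derivative Y (at y) (X y) - frechet_derivative X (at y) (Y y)"

definition riemann_op ::
  "(real^'n \<Rightarrow> real^'n^'n) \<Rightarrow> (real^'n \<Rightarrow> real^'n) \<Rightarrow> (real^'n \<Rightarrow> real^'n) \<Rightarrow> (real^'n \<Rightarrow> real^'n)
   \<Rightarrow> real^'n \<Rightarrow> real^'n" where
  "riemann_op G X Y Z y =
     levi_civita G X (levi_civita G Y Z) y - levi_civita G Y (levi_civita G X Z) y
     - levi_civita G (lie_bracket X Y) Z y"

definition riemann ::
  "(real^'n \<Rightarrow> real^'n^'n) \<Rightarrow> (real^'n \<Rightarrow> real^'n) \<Rightarrow> (real^'n \<Rightarrow> real^'n) \<Rightarrow> (real^'n \<Rightarrow> real^'n)
   \<Rightarrow> (real^'n \<Rightarrow> real^'n) \<Rightarrow> real^'n \<Rightarrow> real" where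
  "riemann G X Y Z W y =
     (\<Sum>a\<in>UNIV. \<Sum>b\<in>UNIV. G y $ a $ b * riemann_op G X Y Z y $ a * W y $ b)"

text \<open>The complex multilinear extension, determined by the values on the coordinate vector
  fields, which are the constant fields \<open>axis i 1\<close>.\<close>

definition riemann_complex ::
  "(real^'n \<Rightarrow> real^'n^'n) \<Rightarrow> real^'n \<Rightarrow> complex^'n \<Rightarrow> complex^'n \<Rightarrow> complex^'n \<Rightarrow> complex^'n
   \<Rightarrow> complex" where
  "riemann_complex G y Z1 Z2 Z3 Z4 =
     (\<Sum>i\<in>UNIV. \<Sum>j\<in>UNIV. \<Sum>k\<in>UNIV. \<Sum>l\<in>UNIV.
        of_real (riemann G (\<lambda>_. axis i 1) (\<lambda>_. axis j 1) (\<lambda>_. axis k 1) (\<lambda>_. axis l 1) y)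
        * Z1 $ i * Z2 $ j * Z3 $ k * Z4 $ l)"

definition vcnj :: "complex^'n \<Rightarrow> complex^'n" where
  "vcnj v = (\<chi> i. cnj (v $ i))"

text \<open>The value whose real part is taken is real, by the symmetries of the curvature tensor.\<close>

definition nonpositive_complex_sectional_curvature ::
  "('b, real^'n) chart set \<Rightarrow> ('b, 'n) rmetric \<Rightarrow> bool" where
  "nonpositive_complex_sectional_curvature B g \<longleftrightarrow>
     (\<forall>d\<in>B. \<forall>q\<in>cdom d. \<forall>Z W.
        Re (riemann_complex (in_chart g d) (coord d q) Z (vcnj W) W (vcnj Z)) \<le> 0)"


section \<open>Chern curvature and uniform RC-positivity\<close>

text \<open>In this section \<open>H\<close> is the matrix of a Hermitian metric as a function of the
  coordinates.  The inverse \<open>h\<^sup>\<mu>\<^sup>\<nu>\<close> is normalised by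
  \<open>\<Sum>\<^sub>\<nu> h\<^sup>\<mu>\<^sup>\<nu> h\<^sub>\<gamma>\<^sub>\<nu> = \<delta>\<^sup>\<mu>\<^sub>\<gamma>\<close>, the barred index being the second one in
  both factors; hence the transpose.\<close>

definition hinv :: "complex^'m^'m \<Rightarrow> complex^'m^'m" where
  "hinv H = transpose (matrix_inv H)"

definition chern ::
  "(complex^'m \<Rightarrow> complex^'m^'m) \<Rightarrow> 'm \<Rightarrow> 'm \<Rightarrow> 'm \<Rightarrow> 'm \<Rightarrow> complex^'m \<Rightarrow> complex" where
  "chern H \<alpha> \<beta> \<gamma> \<delta> z =
     - dz \<alpha> (dzbar \<beta> (\<lambda>w. H w $ \<gamma> $ \<delta>)) z
     + (\<Sum>\<mu>\<in>UNIV. \<Sum>\<nu>\<in>UNIV. hinv (H z) $ \<mu> $ \<nu>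
          * dz \<alpha> (\<lambda>w. H w $ \<gamma> $ \<nu>) z * dzbar \<beta> (\<lambda>w. H w $ \<mu> $ \<delta>) z)"

text \<open>\<open>chern_form H z u v\<close> is \<open>R\<close> evaluated on \<open>u\<close>, conjugate of \<open>u\<close>,
  \<open>v\<close>, conjugate of \<open>v\<close>; it is real by Hermitian symmetry.\<close>

definition chern_form ::
  "(complex^'m \<Rightarrow> complex^'m^'m) \<Rightarrow> complex^'m \<Rightarrow> complex^'m \<Rightarrow> complex^'m \<Rightarrow> complex" where
  "chern_form H z u v =
     (\<Sum>\<alpha>\<in>UNIV. \<Sum>\<beta>\<in>UNIV. \<Sum>\<gamma>\<in>UNIV. \<Sum>\<delta>\<in>UNIV.
        chern H \<alpha> \<beta> \<gamma> \<delta> z * u $ \<alpha> * cnj (u $ \<beta>) * v $ \<gamma> * cnj (v $ \<delta>))"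

definition uniformly_RC_positive ::
  "('a, complex^'m) chart set \<Rightarrow> ('a, 'm) hmetric \<Rightarrow> bool" where
  "uniformly_RC_positive A h \<longleftrightarrow>
     (\<forall>c\<in>A. \<forall>q\<in>cdom c. \<exists>u. \<forall>v. v \<noteq> 0 \<longrightarrow>
        0 < Re (chern_form (in_chart h c) (coord c q) u v))"


section \<open>Hermitian harmonic maps\<close>

definition hermitian_harmonic ::
  "'a topology \<Rightarrow> ('a, complex^'m) chart set \<Rightarrow> ('a, 'm) hmetric \<Rightarrow>
   'b topology \<Rightarrow> ('b, real^'n) chart set \<Rightarrow> ('b, 'n) rmetric \<Rightarrow> ('a \<Rightarrow> 'b) \<Rightarrow> bool" where
  "hermitian_harmonic X A h Y B g f \<longleftrightarrow>
     smooth_map X A Y B f \<and>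
     (\<forall>c\<in>A. \<forall>d\<in>B. \<forall>p\<in>cdom c. f p \<in> cdom d \<longrightarrow>
        (let z = coord c p; F = (\<lambda>i w. complex_of_real (local_rep c d f w $ i)) in
         \<forall>i. (\<Sum>\<alpha>\<in>UNIV. \<Sum>\<beta>\<in>UNIV. hinv (h c p) $ \<alpha> $ \<beta> *
                (dz \<alpha> (dzbar \<beta> (F i)) z
                 + (\<Sum>j\<in>UNIV. \<Sum>k\<in>UNIV.
                      of_real (christoffel (in_chart g d) i j k (coord d (f p)))
                      * dzbar \<beta> (F j) z * dz \<alpha> (F k) z))) = 0))"

end

theory Submission
  imports Defs "HOL-Complex_Analysis.Cauchy_Integral_Formula"
begin

text \<open>Let \<open>\<eta>\<close> be the \<open>(1,1)\<close>-form \<open>g\<^sub>i\<^sub>j \<partial>f\<^sup>i \<and> \<close> conjugate of \<open>\<partial>f\<^sup>j\<close>.  On a surface the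
  \<open>\<partial>\<close>\<open>\<partial>\<close>-bar of \<open>\<eta>\<close> is a top-degree form.  Commuting covariant derivatives along \<open>f\<close> writes it as minus the
  determinant of the \<open>(1,1)\<close>-Hessian of \<open>f\<close>, which is nonnegative because the \<open>h\<close>-trace of the Hessian vanishes, plus
  a curvature term, which is nonnegative by hypothesis.  By Stokes' theorem its integral is zero, so \<open>f\<close> is
  pluriharmonic.

  Now let \<open>\<kappa>\<close> be the maximum of \<open>\<eta>(v, v) / h0(v, v)\<close> over all tangent vectors.  At a maximum, extend \<open>v\<close>
  to a holomorphic field that is parallel in the RC-positive direction \<open>a\<close>.  The second derivative of
  \<open>\<kappa> h0(v, v) - \<eta>(v, v)\<close> along \<open>a\<close> is nonnegative, while it is at most \<open>- \<kappa> R(a, a, v, v)\<close>;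
  hence \<open>\<kappa> \<le> 0\<close> and \<open>f\<close> has zero derivative.\<close>

section \<open>Functions of class \<open>C^k\<close>\<close>

text \<open>The metric \<open>h\<close> need not be Kaehler, so an integrated Bochner formula for
  the energy would carry torsion terms. The form \<eta> does not involve \<open>h\<close>: its
  \<partial>\<partial>-bar is computed from the target metric alone, and \<open>h\<close> acts only
  pointwise, as the weight in the trace equation. In complex dimension two a vanishing weighted
  trace fixes the sign of the determinant of a Hermitian matrix, and \<partial>\<partial>-bar of a
  (1,1)-form can be integrated without the help of a power of a Kaehler form. No differential forms
  are built: Stokes' theorem becomes an integration by parts in charts that moves
  \<partial>\<partial>-bar onto the cut-offs of a partition of unity, whose sum is constant.

  Pluriharmonicity serves the maximum principle twice. For a holomorphic field v it makes
  \<partial>f(v) parallel in antiholomorphic directions, so the second derivative of \<eta>(v, v)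
  consists of a square and one curvature term. For X and W in the image of the (1,0) directions it
  makes R(X, W) vanish on the conjugate of X; without this the curvature term is not of the shape
  whose sign is assumed.\<close>

lemma frechet_derivative_worksI:
  "F differentiable (at x) \<Longrightarrow> (F has_derivative frechet_derivative F (at x)) (at x)"
  by (simp add: frechet_derivative_works[symmetric])

lemma frechet_derivative_cong_open:
  assumes "open S" "x \<in> S" "\<And>y. y \<in> S \<Longrightarrow> F y = G y"
  shows "frechet_derivative F (at x) = frechet_derivative G (at x)"
proof -
  have "(F has_derivative D) (at x) \<longleftrightarrow> (G has_derivative D) (at x)" for D
    using has_derivative_transform_within_open[of F D x UNIV S G]
      has_derivative_transform_within_open[of G D x UNIV S F] assms by auto
  then show ?thesis by (simp add: frechet_derivative_def)
qed

lemma differentiable_cong_open: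
  assumes "open S" "x \<in> S" "\<And>y. y \<in> S \<Longrightarrow> F y = G y"
  shows "F differentiable (at x) \<longleftrightarrow> G differentiable (at x)"
proof -
  have "(F has_derivative D) (at x) \<longleftrightarrow> (G has_derivative D) (at x)" for D
    using has_derivative_transform_within_open[of F D x UNIV S G]
      has_derivative_transform_within_open[of G D x UNIV S F] assms by auto
  then show ?thesis by (simp add: differentiable_def)
qed

lemma Ck_on_cong:
  assumes "open S" "\<And>y. y \<in> S \<Longrightarrow> F y = G y"
  shows "Ck_on k S F \<longleftrightarrow> Ck_on k S G"
  using assms(2)
proof (induction k arbitrary: F G)
  case 0
  then show ?case by (auto intro: continuous_on_cong)
next
  case (Suc k)
  have "Ck_on k S (\<lambda>x. frechet_derivative F (at x) v) \<longleftrightarrow> Ck_on k S (\<lambda>x. frechet_derivative G (at x) v)" for v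
    using frechet_derivative_cong_open[OF assms(1) _ Suc.prems] by (intro Suc.IH) auto
  then show ?case using differentiable_cong_open[OF assms(1) _ Suc.prems] by simp
qed

lemma Ck_on_imp_continuous: "Ck_on k S F \<Longrightarrow> continuous_on S F"
  by (cases k) (auto intro!: differentiable_imp_continuous_on differentiable_at_imp_differentiable_on)

lemma Ck_on_Suc_imp: "Ck_on (Suc k) S F \<Longrightarrow> Ck_on k S F"
proof (induction k arbitrary: F)
  case 0
  then show ?case using Ck_on_imp_continuous by fastforce
next
  case (Suc k)
  then show ?case by (metis Ck_on.simps(2))
qed

lemma Ck_on_le: "Ck_on m S F \<Longrightarrow> k \<le> m \<Longrightarrow> Ck_on k S F"
  by (induction m) (auto simp: le_Suc_eq simp del: Ck_on.simps dest: Ck_on_Suc_imp)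

lemma Ck_on_subset: "Ck_on k S F \<Longrightarrow> T \<subseteq> S \<Longrightarrow> Ck_on k T F"
  by (induction k arbitrary: F) (auto intro: continuous_on_subset)

lemma Ck_on_local:
  assumes "\<And>x. x \<in> S \<Longrightarrow> \<exists>T. open T \<and> x \<in> T \<and> Ck_on k T F"
  shows "Ck_on k S F"
  using assms
proof (induction k arbitrary: F)
  case 0
  have "isCont F x" if "x \<in> S" for x
    using 0[OF that] by (auto simp: continuous_on_eq_continuous_at)
  then show ?case by (simp add: continuous_at_imp_continuous_on)
next
  case (Suc k)
  have "F differentiable (at x)" if "x \<in> S" for x using Suc.prems[OF that] by auto
  moreover have "Ck_on k S (\<lambda>x. frechet_derivative F (at x) v)" for v
    by (rule Suc.IH) (use Suc.prems in fastforce)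
  ultimately show ?case by simp
qed

lemma Ck_on_const [simp]: "Ck_on k S (\<lambda>_. c)"
proof (induction k arbitrary: c)
  case (Suc k)
  have "frechet_derivative (\<lambda>_. c) (at x) v = 0" for x v
    by (metis frechet_derivative_const)
  with Suc show ?case by simp
qed simp

lemma Ck_on_linear_comp:
  assumes "open S" "bounded_linear L" "Ck_on k S F"
  shows "Ck_on k S (\<lambda>x. L (F x))"
  using assms(3)
proof (induction k arbitrary: F)
  case 0
  then show ?case using assms(2) by (auto intro: bounded_linear.continuous_on)
next
  case (Suc k)
  have d: "((\<lambda>x. L (F x)) has_derivative (\<lambda>v. L (frechet_derivative F (at x) v))) (at x)" if "x \<in> S" for x
    using Suc.prems that by (intro bounded_linear.has_derivative[OF assms(2)]) (simp add: frechet_derivative_worksI)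
  have fd: "frechet_derivative (\<lambda>x. L (F x)) (at x) v = L (frechet_derivative F (at x) v)" if "x \<in> S" for x v
    using frechet_derivative_at[OF d[OF that]] by metis
  have "Ck_on k S (\<lambda>x. frechet_derivative (\<lambda>x. L (F x)) (at x) v)" for v
    using Suc fd Ck_on_cong[OF assms(1), of "\<lambda>x. frechet_derivative (\<lambda>x. L (F x)) (at x) v"
        "\<lambda>x. L (frechet_derivative F (at x) v)"] by simp
  then show ?case using d by (auto simp: differentiable_def)
qed

lemma Ck_on_linear:
  assumes "bounded_linear L" shows "Ck_on k S L"
proof (cases k)
  case 0
  then show ?thesis using linear_continuous_on[OF assms] by simp
next
  case (Suc m)
  have "frechet_derivative L (at x) = L" for x
    using frechet_derivative_at[OF bounded_linear_imp_has_derivative[OF assms]] by metis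
  then show ?thesis using Suc assms bounded_linear_imp_differentiable by auto
qed

lemma Ck_on_id: "Ck_on k S (\<lambda>x. x)"
  by (rule Ck_on_linear) (rule bounded_linear_ident)

lemma Ck_on_add:
  assumes "open S" "Ck_on k S F" "Ck_on k S G"
  shows "Ck_on k S (\<lambda>x. F x + G x)"
  using assms(2,3)
proof (induction k arbitrary: F G)
  case 0
  then show ?case by (auto intro: continuous_on_add)
next
  case (Suc k)
  have d: "((\<lambda>x. F x + G x) has_derivative (\<lambda>v. frechet_derivative F (at x) v + frechet_derivative G (at x) v)) (at x)"
    if "x \<in> S" for x
    using Suc.prems that by (intro has_derivative_add) (simp_all add: frechet_derivative_worksI)
  have fd: "frechet_derivative (\<lambda>x. F x + G x) (at x) v = frechet_derivative F (at x) v + frechet_derivative G (at x) v"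
    if "x \<in> S" for x v
    using frechet_derivative_at[OF d[OF that]] by metis
  have "Ck_on k S (\<lambda>x. frechet_derivative (\<lambda>x. F x + G x) (at x) v)" for v
    using Suc fd Ck_on_cong[OF assms(1), of "\<lambda>x. frechet_derivative (\<lambda>x. F x + G x) (at x) v"
        "\<lambda>x. frechet_derivative F (at x) v + frechet_derivative G (at x) v"] by simp
  then show ?case using d by (auto simp: differentiable_def)
qed

lemma Ck_on_sum:
  assumes "open S" "\<And>i. i \<in> I \<Longrightarrow> Ck_on k S (F i)"
  shows "Ck_on k S (\<lambda>x. \<Sum>i\<in>I. F i x)"
  using assms(2)
  by (induction I rule: infinite_finite_induct) (auto intro!: Ck_on_add assms(1))

text \<open>One induction with the Leibniz rule; multiplication, scaling and the inner product are
  instances.\<close>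

lemma Ck_on_bilinear:
  assumes "open S" "bounded_bilinear L" "Ck_on k S F" "Ck_on k S G"
  shows "Ck_on k S (\<lambda>x. L (F x) (G x))"
  using assms(3,4)
proof (induction k arbitrary: F G)
  case 0
  then show ?case using bounded_bilinear.continuous_on[OF assms(2)] by auto
next
  case (Suc k)
  have d: "((\<lambda>x. L (F x) (G x)) has_derivative
      (\<lambda>v. L (F x) (frechet_derivative G (at x) v) + L (frechet_derivative F (at x) v) (G x))) (at x)"
    if "x \<in> S" for x
    using Suc.prems that
    by (intro bounded_bilinear.FDERIV[OF assms(2)]) (simp_all add: frechet_derivative_worksI)
  have fd: "frechet_derivative (\<lambda>x. L (F x) (G x)) (at x) v
      = L (F x) (frechet_derivative G (at x) v) + L (frechet_derivative F (at x) v) (G x)"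
    if "x \<in> S" for x v
    using frechet_derivative_at[OF d[OF that]] by metis
  have "Ck_on k S (\<lambda>x. L (F x) (frechet_derivative G (at x) v) + L (frechet_derivative F (at x) v) (G x))" for v
    using Suc.IH[of F "\<lambda>x. frechet_derivative G (at x) v"] Suc.IH[of "\<lambda>x. frechet_derivative F (at x) v" G]
      Suc.prems Ck_on_Suc_imp[OF Suc.prems(1)] Ck_on_Suc_imp[OF Suc.prems(2)]
    by (intro Ck_on_add assms(1)) auto
  then have "Ck_on k S (\<lambda>x. frechet_derivative (\<lambda>x. L (F x) (G x)) (at x) v)" for v
    using fd Ck_on_cong[OF assms(1), of "\<lambda>x. frechet_derivative (\<lambda>x. L (F x) (G x)) (at x) v"
        "\<lambda>x. L (F x) (frechet_derivative G (at x) v) + L (frechet_derivative F (at x) v) (G x)"] by simp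
  then show ?case using d by (auto simp: differentiable_def)
qed

lemmas Ck_on_mult = Ck_on_bilinear[OF _ bounded_bilinear_mult]
lemmas Ck_on_scaleR = Ck_on_bilinear[OF _ bounded_bilinear_scaleR]

lemma Ck_on_minus: "open S \<Longrightarrow> Ck_on k S F \<Longrightarrow> Ck_on k S (\<lambda>x. - F x)"
  by (rule Ck_on_linear_comp) (auto intro: bounded_linear_minus bounded_linear_ident)

lemma Ck_on_diff:
  assumes "open S" "Ck_on k S F" "Ck_on k S G" shows "Ck_on k S (\<lambda>x. F x - G x)"
  using Ck_on_add[OF assms(1,2) Ck_on_minus[OF assms(1,3)]] by simp

lemma Ck_on_prod:
  fixes F :: "'i \<Rightarrow> 'e::real_normed_vector \<Rightarrow> 'b::{real_normed_field}"
  assumes "open S" "\<And>i. i \<in> I \<Longrightarrow> Ck_on k S (F i)"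
  shows "Ck_on k S (\<lambda>x. \<Prod>i\<in>I. F i x)"
  using assms(2)
  by (induction I rule: infinite_finite_induct) (auto intro!: Ck_on_mult assms(1))

text \<open>The derivative is a polynomial in the derivative of \<open>F\<close> and the inverse
  itself, needed with one order less, so the induction on \<open>k\<close> closes.\<close>

lemma Ck_on_inverse:
  fixes F :: "'e::real_normed_vector \<Rightarrow> 'b::{real_normed_field}"
  assumes "open S" "Ck_on k S F" "\<And>x. x \<in> S \<Longrightarrow> F x \<noteq> 0"
  shows "Ck_on k S (\<lambda>x. inverse (F x))"
  using assms(2)
proof (induction k)
  case 0
  then show ?case using assms(3) by (auto intro: continuous_on_inverse)
next
  case (Suc k)
  have d: "((\<lambda>x. inverse (F x)) has_derivative
      (\<lambda>v. - (inverse (F x) * frechet_derivative F (at x) v * inverse (F x)))) (at x)"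
    if "x \<in> S" for x
    using Suc.prems that assms(3) by (intro Deriv.has_derivative_inverse) (simp_all add: frechet_derivative_worksI)
  have fd: "frechet_derivative (\<lambda>x. inverse (F x)) (at x) v =
      - (inverse (F x) * frechet_derivative F (at x) v * inverse (F x))" if "x \<in> S" for x v
    using frechet_derivative_at[OF d[OF that]] by metis
  have "Ck_on k S (\<lambda>x. - (inverse (F x) * frechet_derivative F (at x) v * inverse (F x)))" for v
    using Suc.prems Suc.IH[OF Ck_on_Suc_imp[OF Suc.prems]]
    by (intro Ck_on_minus Ck_on_mult assms(1)) auto
  then have "Ck_on k S (\<lambda>x. frechet_derivative (\<lambda>x. inverse (F x)) (at x) v)" for v
    using fd Ck_on_cong[OF assms(1), of "\<lambda>x. frechet_derivative (\<lambda>x. inverse (F x)) (at x) v"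
        "\<lambda>x. - (inverse (F x) * frechet_derivative F (at x) v * inverse (F x))"] by simp
  then show ?case using d by (auto simp: differentiable_def)
qed

lemma Ck_on_divide:
  fixes F :: "'e::real_normed_vector \<Rightarrow> 'b::{real_normed_field}"
  assumes "open S" "Ck_on k S F" "Ck_on k S G" "\<And>x. x \<in> S \<Longrightarrow> G x \<noteq> 0"
  shows "Ck_on k S (\<lambda>x. F x / G x)"
  using Ck_on_mult[OF assms(1,2) Ck_on_inverse[OF assms(1,3,4)]] by (simp add: divide_inverse)

text \<open>In the chain rule the derivative of \<open>G\<close> is applied to a direction that
  varies with \<open>x\<close>, while \<open>Ck_on\<close> controls fixed directions only. Expanding
  the direction over \<open>Basis\<close> turns it into scalar coefficients; for this the
  intermediate space is Euclidean.\<close>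

lemma Ck_on_compose:
  fixes F :: "'e::real_normed_vector \<Rightarrow> 'u::euclidean_space" and G :: "'u \<Rightarrow> 'f::real_normed_vector"
  assumes "open S" "open T" "F ` S \<subseteq> T" "Ck_on k S F" "Ck_on k T G"
  shows "Ck_on k S (\<lambda>x. G (F x))"
  using assms(4,5)
proof (induction k arbitrary: G)
  case 0
  then show ?case using continuous_on_compose2[of T G S F] assms(3) by simp
next
  case (Suc k)
  have d: "((\<lambda>x. G (F x)) has_derivative
      (\<lambda>v. frechet_derivative G (at (F x)) (frechet_derivative F (at x) v))) (at x)"
    if "x \<in> S" for x
    using Suc.prems that assms(3) has_derivative_compose[of F "frechet_derivative F (at x)" x UNIV G]
    by (auto simp: frechet_derivative_worksI image_subset_iff)
  have fd: "frechet_derivative (\<lambda>x. G (F x)) (at x) v =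
      (\<Sum>b\<in>Basis. (frechet_derivative F (at x) v \<bullet> b) *\<^sub>R frechet_derivative G (at (F x)) b)" if "x \<in> S" for x v
  proof -
    have lin: "linear (frechet_derivative G (at (F x)))"
      using Suc.prems(2) assms(3) that by (auto intro!: linear_frechet_derivative)
    have "frechet_derivative (\<lambda>x. G (F x)) (at x) v
        = frechet_derivative G (at (F x)) (\<Sum>b\<in>Basis. (frechet_derivative F (at x) v \<bullet> b) *\<^sub>R b)"
      using frechet_derivative_at[OF d[OF that]] by (metis euclidean_representation)
    then show ?thesis using lin by (simp add: linear_sum linear_scale)
  qed
  have "Ck_on k S (\<lambda>x. \<Sum>b\<in>Basis. (frechet_derivative F (at x) v \<bullet> b) *\<^sub>R frechet_derivative G (at (F x)) b)" for v
    using Suc.prems Ck_on_Suc_imp[OF Suc.prems(1)]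
    by (intro Ck_on_sum Ck_on_scaleR Suc.IH assms(1) Ck_on_linear_comp[OF _ bounded_linear_inner_left]) auto
  then have "Ck_on k S (\<lambda>x. frechet_derivative (\<lambda>x. G (F x)) (at x) v)" for v
    using fd Ck_on_cong[OF assms(1), of "\<lambda>x. frechet_derivative (\<lambda>x. G (F x)) (at x) v"
        "\<lambda>x. \<Sum>b\<in>Basis. (frechet_derivative F (at x) v \<bullet> b) *\<^sub>R frechet_derivative G (at (F x)) b"] by simp
  then show ?case using d by (auto simp: differentiable_def)
qed

lemma Ck_on_componentwise:
  fixes F :: "'e::real_normed_vector \<Rightarrow> ('b::euclidean_space)^'n"
  assumes "open S"
  shows "Ck_on k S F \<longleftrightarrow> (\<forall>i. Ck_on k S (\<lambda>x. F x $ i))"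
proof
  assume "Ck_on k S F"
  then show "\<forall>i. Ck_on k S (\<lambda>x. F x $ i)"
    using Ck_on_linear_comp[OF assms bounded_linear_vec_nth] by blast
next
  assume *: "\<forall>i. Ck_on k S (\<lambda>x. F x $ i)"
  have bl: "bounded_linear (\<lambda>b::'b. axis i b :: 'b^'n)" for i
    by (intro linear_conv_bounded_linear[THEN iffD1] linearI) (auto simp: axis_def vec_eq_iff)
  have "Ck_on k S (\<lambda>x. \<Sum>i\<in>UNIV. axis i (F x $ i))"
    using * by (intro Ck_on_sum assms Ck_on_linear_comp[OF assms bl]) auto
  moreover have "(\<Sum>i\<in>UNIV. axis i (F x $ i)) = F x" for x
    by (simp add: vec_eq_iff axis_def)
  ultimately show "Ck_on k S F" by simp
qed

lemma Ck_on_frechet_derivative: "Ck_on (Suc k) S F \<Longrightarrow> Ck_on k S (\<lambda>x. frechet_derivative F (at x) v)"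
  by simp

lemma frechet_derivative_along_line:
  assumes "F differentiable (at (x + t *\<^sub>R a))"
  shows "((\<lambda>t. F (x + t *\<^sub>R a)) has_vector_derivative frechet_derivative F (at (x + t *\<^sub>R a)) a) (at t)"
proof -
  have "((\<lambda>t. x + t *\<^sub>R a) has_derivative (\<lambda>s. s *\<^sub>R a)) (at t)"
    by (auto intro!: derivative_eq_intros)
  from has_derivative_compose[OF this frechet_derivative_worksI[OF assms]] show ?thesis
    by (simp add: has_vector_derivative_def linear_frechet_derivative[OF assms] linear_scale)
qed

text \<open>Schwarz: differentiate \<open>F (p + t b) - F p = \<integral>\<^sub>0\<^sup>t (\<partial>\<^sub>b F) (p + \<tau> b) d\<tau>\<close> in direction \<open>a\<close> and then in \<open>t\<close> at
  \<open>t = 0\<close>.\<close>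

lemma second_derivative_symmetric:
  fixes F :: "'e::real_normed_vector \<Rightarrow> 'f::euclidean_space"
  assumes S: "open S" "x \<in> S" and F: "Ck_on 2 S F"
  shows "frechet_derivative (\<lambda>y. frechet_derivative F (at y) a) (at x) b
       = frechet_derivative (\<lambda>y. frechet_derivative F (at y) b) (at x) a"
proof -
  let ?D = "\<lambda>v y. frechet_derivative F (at y) v"
  have F1: "Ck_on 1 S (?D v)" for v using F by (simp add: numeral_2_eq_2)
  have dF: "F differentiable (at y)" if "y \<in> S" for y using F that by (simp add: numeral_2_eq_2)
  have dD: "?D v differentiable (at y)" if "y \<in> S" for y v using F1[of v] that by simp
  obtain \<epsilon> where \<epsilon>: "\<epsilon> > 0" "\<And>s t. \<bar>s\<bar> \<le> \<epsilon> \<Longrightarrow> \<bar>t\<bar> \<le> \<epsilon> \<Longrightarrow> x + s *\<^sub>R a + t *\<^sub>R b \<in> S"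
  proof -
    obtain r where r: "r > 0" "ball x r \<subseteq> S" using S openE by blast
    define \<epsilon> where "\<epsilon> = r / (2 * (norm a + norm b + 1))"
    have e: "\<epsilon> > 0" using r by (auto simp: \<epsilon>_def intro!: divide_pos_pos add_nonneg_pos)
    have "x + s *\<^sub>R a + t *\<^sub>R b \<in> S" if "\<bar>s\<bar> \<le> \<epsilon>" "\<bar>t\<bar> \<le> \<epsilon>" for s t
    proof -
      have "norm (s *\<^sub>R a + t *\<^sub>R b) \<le> \<bar>s\<bar> * norm a + \<bar>t\<bar> * norm b"
        using norm_triangle_ineq[of "s *\<^sub>R a" "t *\<^sub>R b"] by simp
      also have "\<dots> \<le> \<epsilon> * norm a + \<epsilon> * norm b" using that by (intro add_mono mult_right_mono) auto
      also have "\<dots> < \<epsilon> * (2 * (norm a + norm b + 1))"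
        using e by (simp add: algebra_simps) (intro add_nonneg_pos; simp)
      also have "\<dots> = r" by (simp add: \<epsilon>_def add_nonneg_eq_0_iff add.commute)
      finally have "x + (s *\<^sub>R a + t *\<^sub>R b) \<in> ball x r"
        using norm_minus_cancel[of "s *\<^sub>R a + t *\<^sub>R b"] by (simp add: dist_norm)
      then show ?thesis using r by (auto simp: add.assoc)
    qed
    with e that show thesis by blast
  qed
  let ?p = "\<lambda>s t. x + s *\<^sub>R a + t *\<^sub>R b"
  define g where "g s t = frechet_derivative (?D b) (at (?p s t)) a" for s t
  have contg: "continuous_on ({-\<epsilon>..\<epsilon>} \<times> cbox 0 \<epsilon>) (\<lambda>(s, t). g s t)"
  proof -
    have c: "continuous_on S (\<lambda>y. frechet_derivative (?D b) (at y) a)"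
      using F1[of b] by simp
    have "continuous_on ({-\<epsilon>..\<epsilon>} \<times> cbox 0 \<epsilon>) (\<lambda>p. frechet_derivative (?D b) (at (?p (fst p) (snd p))) a)"
      by (rule continuous_on_compose2[OF c]) (auto intro!: continuous_intros \<epsilon>)
    then show ?thesis by (simp add: g_def case_prod_unfold)
  qed
  have FTC: "integral (cbox 0 t) (\<lambda>\<tau>. ?D b (?p s \<tau>)) = F (?p s t) - F (?p s 0)"
    if "\<bar>s\<bar> \<le> \<epsilon>" "0 \<le> t" "t \<le> \<epsilon>" for s t
  proof -
    have "((\<lambda>\<tau>. ?D b (?p s \<tau>)) has_integral F (?p s t) - F (?p s 0)) {0..t}"
      using that
      by (intro fundamental_theorem_of_calculus)
        (auto intro!: has_vector_derivative_at_within frechet_derivative_along_line dF \<epsilon>)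
    then show ?thesis by (simp add: integral_unique)
  qed
  have deriv: "((\<lambda>s. integral (cbox 0 t) (\<lambda>\<tau>. ?D b (?p s \<tau>))) has_vector_derivative
      integral (cbox 0 t) (g 0)) (at 0 within {-\<epsilon>..\<epsilon>})" if "0 \<le> t" "t \<le> \<epsilon>" for t
  proof (rule leibniz_rule_vector_derivative)
    fix s \<tau> assume st: "s \<in> {-\<epsilon>..\<epsilon>}" "\<tau> \<in> cbox 0 t"
    have "((\<lambda>s. ?D b ((x + \<tau> *\<^sub>R b) + s *\<^sub>R a)) has_vector_derivative
        frechet_derivative (?D b) (at ((x + \<tau> *\<^sub>R b) + s *\<^sub>R a)) a) (at s)"
      using st that \<epsilon>(2)[of s \<tau>] by (intro frechet_derivative_along_line dD) (auto simp: algebra_simps)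
    then show "((\<lambda>s. ?D b (?p s \<tau>)) has_vector_derivative g s \<tau>) (at s within {-\<epsilon>..\<epsilon>})"
      by (auto simp: g_def algebra_simps intro: has_vector_derivative_at_within)
  next
    fix s assume s: "s \<in> {-\<epsilon>..\<epsilon>}"
    have "continuous_on S (?D b)" using F1[of b] Ck_on_imp_continuous by blast
    then have "continuous_on (cbox 0 t) (\<lambda>\<tau>. ?D b (?p s \<tau>))"
      using s that by (auto intro!: continuous_on_compose2[of S "?D b"] continuous_intros \<epsilon>)
    then show "(\<lambda>\<tau>. ?D b (?p s \<tau>)) integrable_on cbox 0 t"
      using integrable_continuous by blast
  next
    show "continuous_on ({- \<epsilon>..\<epsilon>} \<times> cbox 0 t) (\<lambda>(s, t). g s t)"
      using that by (auto intro: continuous_on_subset[OF contg])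
  qed (use \<epsilon>(1) in auto)
  \<comment> \<open>Both sides are the derivative at \<open>s = 0\<close> of the identity
    \<open>FTC\<close>. Since it is available for \<open>0 \<le> t\<close> only, the remaining
    differentiation at \<open>t = 0\<close> is one-sided.\<close>
  have eq: "?D a (x + t *\<^sub>R b) - ?D a x = integral (cbox 0 t) (g 0)" if "0 \<le> t" "t \<le> \<epsilon>" for t
  proof -
    have "((\<lambda>s. F ((x + t *\<^sub>R b) + s *\<^sub>R a) - F (x + s *\<^sub>R a)) has_vector_derivative
        ?D a ((x + t *\<^sub>R b) + 0 *\<^sub>R a) - ?D a (x + 0 *\<^sub>R a)) (at 0)"
      using \<epsilon>(2)[of 0 t] that \<epsilon>(1) S
      by (intro has_vector_derivative_diff frechet_derivative_along_line dF) auto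
    then have "((\<lambda>s. F (?p s t) - F (?p s 0)) has_vector_derivative
        ?D a (x + t *\<^sub>R b) - ?D a x) (at 0 within {-\<epsilon>..\<epsilon>})"
      by (auto simp: algebra_simps intro: has_vector_derivative_at_within)
    moreover have "((\<lambda>s. F (?p s t) - F (?p s 0)) has_vector_derivative
        integral (cbox 0 t) (g 0)) (at 0 within {-\<epsilon>..\<epsilon>})"
      by (rule has_vector_derivative_transform[OF _ _ deriv[OF that]]) (use \<epsilon>(1) FTC that in auto)
    moreover have "at (0::real) within {-\<epsilon>..\<epsilon>} \<noteq> bot"
      using \<epsilon>(1) by (simp add: trivial_limit_within islimpt_Icc)
    ultimately show ?thesis using vector_derivative_unique_within by blast
  qed
  have "((\<lambda>t. ?D a (x + t *\<^sub>R b)) has_vector_derivative frechet_derivative (?D a) (at (x + 0 *\<^sub>R b)) b) (at 0)"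
    using S by (intro frechet_derivative_along_line dD) auto
  then have 1: "((\<lambda>t. ?D a (x + t *\<^sub>R b)) has_vector_derivative frechet_derivative (?D a) (at x) b) (at 0 within {0..\<epsilon>})"
    by (auto intro: has_vector_derivative_at_within)
  have cg0: "continuous_on {0..\<epsilon>} (g 0)"
    using \<epsilon>(1) by (intro continuous_on_compose2[OF contg, of "{0..\<epsilon>}" "\<lambda>t. (0, t)", simplified]) (auto intro!: continuous_intros)
  have "((\<lambda>t. integral {0..t} (g 0)) has_vector_derivative g 0 0) (at 0 within {0..\<epsilon>})"
    using integral_has_vector_derivative[OF cg0] \<epsilon>(1) by simp
  then have "((\<lambda>t. ?D a x + integral {0..t} (g 0)) has_vector_derivative g 0 0) (at 0 within {0..\<epsilon>})"
    by (auto intro: derivative_eq_intros)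
  then have 2: "((\<lambda>t. ?D a (x + t *\<^sub>R b)) has_vector_derivative g 0 0) (at 0 within {0..\<epsilon>})"
    by (rule has_vector_derivative_transform[rotated 2]) (use \<epsilon>(1) eq in \<open>auto simp: algebra_simps\<close>)
  have "at (0::real) within {0..\<epsilon>} \<noteq> bot"
    using \<epsilon>(1) by (simp add: trivial_limit_within islimpt_Icc)
  from vector_derivative_unique_within[OF this 1 2] show ?thesis by (simp add: g_def)
qed

section \<open>Derivatives in complex directions\<close>

text \<open>A pair \<open>(a, b)\<close> of real vectors stands for the complexified direction \<open>a + \<i> b\<close>; this way
  Wirtinger derivatives are handled uniformly.\<close>

definition cderiv :: "'e \<times> 'e \<Rightarrow> ('e::real_normed_vector \<Rightarrow> complex) \<Rightarrow> 'e \<Rightarrow> complex" where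
  "cderiv p F z = frechet_derivative F (at z) (fst p) + \<i> * frechet_derivative F (at z) (snd p)"

definition vcderiv :: "'e \<times> 'e \<Rightarrow> ('e::real_normed_vector \<Rightarrow> complex^'n) \<Rightarrow> 'e \<Rightarrow> complex^'n" where
  "vcderiv p \<xi> z = (\<chi> i. cderiv p (\<lambda>w. \<xi> w $ i) z)"

text \<open>Derivatives of a real map \<open>u\<close> become complexified tangent vectors:
  \<open>vcderiv p (\<lambda>w. cvec (u w)) z\<close> is the image of the complex direction
  \<open>p\<close> under the differential of \<open>u\<close>.\<close>

definition cvec :: "real^'n \<Rightarrow> complex^'n" where
  "cvec x = (\<chi> i. of_real (x $ i))"

lemma cvec_nth [simp]: "cvec x $ i = of_real (x $ i)" by (simp add: cvec_def)

lemma vcderiv_nth [simp]: "vcderiv p \<xi> z $ i = cderiv p (\<lambda>w. \<xi> w $ i) z" by (simp add: vcderiv_def)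

lemma cderiv_cong:
  assumes "open S" "z \<in> S" "\<And>w. w \<in> S \<Longrightarrow> F w = G w"
  shows "cderiv p F z = cderiv p G z"
  by (simp add: cderiv_def frechet_derivative_cong_open[OF assms])

lemma vcderiv_cong:
  assumes "open S" "z \<in> S" "\<And>w. w \<in> S \<Longrightarrow> F w = G w"
  shows "vcderiv p F z = vcderiv p G z"
  unfolding vcderiv_def by (intro vec_eq_iff[THEN iffD2] allI) (use assms in \<open>auto intro!: cderiv_cong\<close>)

lemma cderiv_eqI: "(F has_derivative F') (at z) \<Longrightarrow> cderiv p F z = F' (fst p) + \<i> * F' (snd p)"
  using frechet_derivative_at[of F F' z] by (simp add: cderiv_def)

lemma cderiv_const [simp]: "cderiv p (\<lambda>_. c) z = 0"
  by (subst cderiv_eqI[OF has_derivative_const]) simp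

lemma cderiv_add:
  assumes "F differentiable (at z)" "G differentiable (at z)"
  shows "cderiv p (\<lambda>w. F w + G w) z = cderiv p F z + cderiv p G z"
  by (subst cderiv_eqI[OF has_derivative_add[OF assms[THEN frechet_derivative_worksI]]])
    (simp add: cderiv_def algebra_simps)

lemma cderiv_diff:
  assumes "F differentiable (at z)" "G differentiable (at z)"
  shows "cderiv p (\<lambda>w. F w - G w) z = cderiv p F z - cderiv p G z"
  by (subst cderiv_eqI[OF has_derivative_diff[OF assms[THEN frechet_derivative_worksI]]])
    (simp add: cderiv_def algebra_simps)

lemma cderiv_mult:
  assumes "F differentiable (at z)" "G differentiable (at z)"
  shows "cderiv p (\<lambda>w. F w * G w) z = cderiv p F z * G z + F z * cderiv p G z"
  by (subst cderiv_eqI[OF has_derivative_mult[OF assms[THEN frechet_derivative_worksI]]])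
    (simp add: cderiv_def algebra_simps)

lemma cderiv_sum:
  assumes "\<And>i. i \<in> I \<Longrightarrow> F i differentiable (at z)"
  shows "cderiv p (\<lambda>w. \<Sum>i\<in>I. F i w) z = (\<Sum>i\<in>I. cderiv p (F i) z)"
  by (subst cderiv_eqI[OF has_derivative_sum[OF assms[THEN frechet_derivative_worksI]]])
    (simp_all add: cderiv_def sum.distrib sum_distrib_left)

lemma cderiv_cmult:
  assumes "F differentiable (at z)"
  shows "cderiv p (\<lambda>w. c * F w) z = c * cderiv p F z"
  using cderiv_mult[OF differentiable_const assms, of p c] by simp

lemma cderiv_cnj:
  assumes "F differentiable (at z)"
  shows "cderiv p (\<lambda>w. cnj (F w)) z = cnj (cderiv (fst p, - snd p) F z)"
proof -
  have l: "linear (frechet_derivative F (at z))" by (rule linear_frechet_derivative[OF assms])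
  show ?thesis
    by (subst cderiv_eqI[OF has_derivative_cnj[OF assms[THEN frechet_derivative_worksI]]])
      (simp add: cderiv_def linear_neg[OF l])
qed

lemma linear_real_coordinates:
  fixes L :: "real^'n \<Rightarrow> 'b::real_vector"
  assumes "linear L" shows "L v = (\<Sum>k\<in>UNIV. v $ k *\<^sub>R L (axis k 1))"
proof -
  have "v = (\<Sum>k\<in>UNIV. v $ k *\<^sub>R axis k 1)" by (simp add: vec_eq_iff axis_def if_distrib cong: if_cong)
  then have "L v = L (\<Sum>k\<in>UNIV. v $ k *\<^sub>R axis k 1)" by simp
  then show ?thesis using assms by (simp add: linear_sum linear_scale)
qed

lemma differentiable_vec_nth [intro]:
  fixes u :: "'e::real_normed_vector \<Rightarrow> ('b::real_normed_vector)^'n"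
  assumes "u differentiable (at z)" shows "(\<lambda>w. u w $ k) differentiable (at z)"
  using bounded_linear.has_derivative[OF bounded_linear_vec_nth frechet_derivative_worksI[OF assms]]
  by (auto simp: differentiable_def)

lemma frechet_derivative_vec_nth:
  fixes u :: "'e::real_normed_vector \<Rightarrow> ('b::real_normed_vector)^'n"
  assumes "u differentiable (at z)"
  shows "frechet_derivative (\<lambda>w. u w $ k) (at z) v = frechet_derivative u (at z) v $ k"
  using frechet_derivative_at[OF bounded_linear.has_derivative[OF bounded_linear_vec_nth frechet_derivative_worksI[OF assms], of k]]
  by metis

lemma cderiv_of_real:
  assumes "\<phi> differentiable (at z)"
  shows "cderiv p (\<lambda>w. of_real (\<phi> w)) z
    = of_real (frechet_derivative \<phi> (at z) (fst p)) + \<i> * of_real (frechet_derivative \<phi> (at z) (snd p))"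
  by (subst cderiv_eqI[OF has_derivative_of_real[OF assms[THEN frechet_derivative_worksI]]]) simp

lemma cderiv_compose_real:
  fixes u :: "'e::real_normed_vector \<Rightarrow> real^'n" and \<phi> :: "real^'n \<Rightarrow> real"
  assumes u: "u differentiable (at z)" and \<phi>: "\<phi> differentiable (at (u z))"
  shows "cderiv p (\<lambda>w. of_real (\<phi> (u w))) z
       = (\<Sum>k\<in>UNIV. vcderiv p (\<lambda>w. cvec (u w)) z $ k * of_real (dreal k \<phi> (u z)))"
proof -
  have d: "((\<lambda>w. \<phi> (u w)) has_derivative (\<lambda>v. frechet_derivative \<phi> (at (u z)) (frechet_derivative u (at z) v))) (at z)"
    using has_derivative_compose[OF frechet_derivative_worksI[OF u] frechet_derivative_worksI[OF \<phi>]] .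
  have l: "frechet_derivative \<phi> (at (u z)) x = (\<Sum>k\<in>UNIV. x $ k * dreal k \<phi> (u z))" for x
    using linear_real_coordinates[OF linear_frechet_derivative[OF \<phi>], of x] by (simp add: dreal_def)
  have c: "cderiv p (\<lambda>w. of_real (u w $ k)) z
     = of_real (frechet_derivative u (at z) (fst p) $ k) + \<i> * of_real (frechet_derivative u (at z) (snd p) $ k)" for k
    using cderiv_of_real[OF differentiable_vec_nth[OF u]] frechet_derivative_vec_nth[OF u] by simp
  show ?thesis
    by (subst cderiv_eqI[OF has_derivative_of_real[OF d]])
      (simp add: l c sum.distrib sum_distrib_left algebra_simps)
qed

lemma Ck_on_cderiv: "open S \<Longrightarrow> Ck_on (Suc k) S F \<Longrightarrow> Ck_on k S (cderiv p F)"
  unfolding cderiv_def[abs_def]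
  by (intro Ck_on_add Ck_on_mult Ck_on_const Ck_on_frechet_derivative) auto

lemma Ck_on_vcderiv:
  assumes "open S" "Ck_on (Suc k) S \<xi>" shows "Ck_on k S (vcderiv p \<xi>)"
proof -
  have "Ck_on (Suc k) S (\<lambda>w. \<xi> w $ i)" for i
    using assms Ck_on_componentwise by blast
  then have "Ck_on k S (cderiv p (\<lambda>w. \<xi> w $ i))" for i by (rule Ck_on_cderiv[OF assms(1)])
  then show ?thesis by (subst Ck_on_componentwise[OF assms(1)]) simp
qed

lemma bounded_linear_cvec: "bounded_linear (cvec :: real^'n \<Rightarrow> complex^'n)"
  by (intro linear_conv_bounded_linear[THEN iffD1] linearI) (simp_all add: cvec_def vec_eq_iff scaleR_conv_of_real[where 'a=complex])

lemma Ck_on_cvec: "open S \<Longrightarrow> Ck_on k S u \<Longrightarrow> Ck_on k S (\<lambda>w. cvec (u w))"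
  by (rule Ck_on_linear_comp[OF _ bounded_linear_cvec])

lemma Ck_on_of_real: "open S \<Longrightarrow> Ck_on k S \<phi> \<Longrightarrow> Ck_on k S (\<lambda>w. complex_of_real (\<phi> w))"
  by (rule Ck_on_linear_comp[OF _ bounded_linear_of_real])

lemma Ck_on_cnj: "open S \<Longrightarrow> Ck_on k S F \<Longrightarrow> Ck_on k S (\<lambda>w. cnj (F w))"
  by (rule Ck_on_linear_comp[OF _ bounded_linear_cnj])

text \<open>The complex bilinear extension of \<open>second_derivative_symmetric\<close>; constant
  directions have no Lie bracket.\<close>

lemma cderiv_commute:
  assumes "open S" "z \<in> S" "Ck_on 2 S F"
  shows "cderiv p (cderiv q F) z = cderiv q (cderiv p F) z"
proof -
  let ?D = "\<lambda>v y. frechet_derivative F (at y) v"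
  have d: "?D v differentiable (at z)" for v
    using assms by (simp add: numeral_2_eq_2)
  have *: "frechet_derivative (cderiv q F) (at z) v
     = frechet_derivative (?D (fst q)) (at z) v + \<i> * frechet_derivative (?D (snd q)) (at z) v" for q v
  proof -
    have "(cderiv q F has_derivative (\<lambda>v. frechet_derivative (?D (fst q)) (at z) v
        + \<i> * frechet_derivative (?D (snd q)) (at z) v)) (at z)"
      unfolding cderiv_def[abs_def]
      by (rule has_derivative_add[OF frechet_derivative_worksI[OF d]
            has_derivative_mult_right[OF frechet_derivative_worksI[OF d]]])
    from frechet_derivative_at[OF this, symmetric] show ?thesis by simp
  qed
  have s: "frechet_derivative (?D a) (at z) b = frechet_derivative (?D b) (at z) a" for a b
    by (rule second_derivative_symmetric[OF assms])
  show ?thesis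
    unfolding cderiv_def[of p] cderiv_def[of q "cderiv p F"] *
    using s[of "fst q" "fst p"] s[of "snd q" "fst p"] s[of "fst q" "snd p"] s[of "snd q" "snd p"]
    by (simp add: algebra_simps)
qed

lemma vcderiv_commute:
  assumes "open S" "z \<in> S" "Ck_on 2 S \<xi>"
  shows "vcderiv p (vcderiv q \<xi>) z = vcderiv q (vcderiv p \<xi>) z"
proof -
  have "Ck_on 2 S (\<lambda>w. \<xi> w $ i)" for i using assms Ck_on_componentwise by blast
  then show ?thesis by (simp add: vec_eq_iff cderiv_commute[OF assms(1,2)])
qed

text \<open>Bilinear and not sesquilinear: real tensors are extended complex linearly in every slot,
  and conjugates are inserted explicitly by \<open>vcnj\<close>.\<close>

definition bil :: "('n \<Rightarrow> 'n \<Rightarrow> complex) \<Rightarrow> complex^'n \<Rightarrow> complex^'n \<Rightarrow> complex" where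
  "bil c X Y = (\<Sum>i\<in>UNIV. \<Sum>j\<in>UNIV. c i j * X $ i * Y $ j)"

lemma bil_simps:
  "bil c (X + X') Y = bil c X Y + bil c X' Y"
  "bil c X (Y + Y') = bil c X Y + bil c X Y'"
  "bil c (X - X') Y = bil c X Y - bil c X' Y"
  "bil c X (Y - Y') = bil c X Y - bil c X Y'"
  "bil c (- X) Y = - bil c X Y"
  "bil c X (- Y) = - bil c X Y"
  "bil c 0 Y = 0"
  "bil c X 0 = 0"
  "bil c (a *s X) Y = a * bil c X Y"
  "bil c X (a *s Y) = a * bil c X Y"
  "bil (\<lambda>i j. c i j + c' i j) X Y = bil c X Y + bil c' X Y"
  by (simp_all add: bil_def sum.distrib sum_subtractf sum_negf sum_distrib_left distrib_left distrib_right
      left_diff_distrib right_diff_distrib mult_ac)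

lemma bil_sum:
  "bil c (\<Sum>k\<in>I. X k) Y = (\<Sum>k\<in>I. bil c (X k) Y)"
  "bil c Y (\<Sum>k\<in>I. X k) = (\<Sum>k\<in>I. bil c Y (X k))"
  by (induction I rule: infinite_finite_induct) (simp_all add: bil_simps)

lemma bil_swap: "bil c X Y = bil (\<lambda>i j. c j i) Y X"
  unfolding bil_def by (subst sum.swap) (simp add: algebra_simps)

text \<open>The coefficients are functions on the target pulled back along \<open>u\<close>. The
  rule is applied to the metric, giving \<open>metric_compat\<close>, and to the Christoffel
  symbols, giving \<open>vcderiv_Gam\<close>.\<close>

lemma cderiv_bil:
  fixes u :: "'e::real_normed_vector \<Rightarrow> real^'n"
  assumes u: "u differentiable (at z)" and c: "\<And>i j. c i j differentiable (at (u z))"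
    and \<xi>: "\<xi> differentiable (at z)" and \<zeta>: "\<zeta> differentiable (at z)"
  shows "cderiv p (\<lambda>w. bil (\<lambda>i j. of_real (c i j (u w))) (\<xi> w) (\<zeta> w)) z
    = bil (\<lambda>i j. \<Sum>k\<in>UNIV. vcderiv p (\<lambda>w. cvec (u w)) z $ k * of_real (dreal k (c i j) (u z))) (\<xi> z) (\<zeta> z)
    + bil (\<lambda>i j. of_real (c i j (u z))) (vcderiv p \<xi> z) (\<zeta> z)
    + bil (\<lambda>i j. of_real (c i j (u z))) (\<xi> z) (vcderiv p \<zeta> z)"
proof -
  have cu: "(\<lambda>w. complex_of_real (c i j (u w))) differentiable (at z)" for i j
    using has_derivative_of_real[OF has_derivative_compose[OF frechet_derivative_worksI[OF u] frechet_derivative_worksI[OF c]]]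
    by (auto simp: differentiable_def)
  note d = cu differentiable_vec_nth[OF \<xi>] differentiable_vec_nth[OF \<zeta>]
  have "cderiv p (\<lambda>w. bil (\<lambda>i j. of_real (c i j (u w))) (\<xi> w) (\<zeta> w)) z
     = (\<Sum>i\<in>UNIV. \<Sum>j\<in>UNIV. cderiv p (\<lambda>w. of_real (c i j (u w)) * \<xi> w $ i * \<zeta> w $ j) z)"
    unfolding bil_def by (simp add: cderiv_sum d differentiable_mult differentiable_sum)
  also have "\<dots> = (\<Sum>i\<in>UNIV. \<Sum>j\<in>UNIV.
       (\<Sum>k\<in>UNIV. vcderiv p (\<lambda>w. cvec (u w)) z $ k * of_real (dreal k (c i j) (u z))) * \<xi> z $ i * \<zeta> z $ j
       + of_real (c i j (u z)) * vcderiv p \<xi> z $ i * \<zeta> z $ j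
       + of_real (c i j (u z)) * \<xi> z $ i * vcderiv p \<zeta> z $ j)"
    by (simp add: cderiv_mult d differentiable_mult cderiv_compose_real[OF u c] algebra_simps)
  finally show ?thesis by (simp add: bil_def sum.distrib)
qed

lemma Ck_on_bil:
  fixes u :: "'e::real_normed_vector \<Rightarrow> real^'n"
  assumes "open U" "open V" "u ` U \<subseteq> V" "Ck_on k U u" "\<And>i j. Ck_on k V (c i j)" "Ck_on k U \<xi>" "Ck_on k U \<zeta>"
  shows "Ck_on k U (\<lambda>w. bil (\<lambda>i j. of_real (c i j (u w))) (\<xi> w) (\<zeta> w))"
  unfolding bil_def
proof (intro Ck_on_sum Ck_on_mult Ck_on_of_real assms(1))
  show "Ck_on k U (\<lambda>w. c i j (u w))" for i j by (rule Ck_on_compose[OF assms(1-4) assms(5)])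
  show "Ck_on k U (\<lambda>w. \<xi> w $ i)" for i
    using assms(6) Ck_on_componentwise[OF assms(1), of k \<xi>] by blast
  show "Ck_on k U (\<lambda>w. \<zeta> w $ i)" for i
    using assms(7) Ck_on_componentwise[OF assms(1), of k \<zeta>] by blast
qed

lemma matrix_inv_right:
  fixes A :: "'a::semiring_1^'n^'m"
  assumes "invertible A" shows "A ** matrix_inv A = mat 1"
  using someI_ex[OF assms[unfolded invertible_def]] by (simp add: matrix_inv_def)

section \<open>Riemannian geometry along a map\<close>

locale riem =
  fixes G :: "real^'n \<Rightarrow> real^'n^'n" and V :: "(real^'n) set"
  assumes open_V: "open V" and smooth: "smooth_on V G"
    and sym: "y \<in> V \<Longrightarrow> G y $ i $ j = G y $ j $ i"
    and pos: "y \<in> V \<Longrightarrow> v \<noteq> 0 \<Longrightarrow> 0 < (\<Sum>i\<in>UNIV. \<Sum>j\<in>UNIV. G y $ i $ j * v $ i * v $ j)"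
begin

definition CG :: "real^'n \<Rightarrow> complex^'n \<Rightarrow> complex^'n \<Rightarrow> complex" where
  "CG y X Y = bil (\<lambda>i j. of_real (G y $ i $ j)) X Y"

definition Gam :: "real^'n \<Rightarrow> complex^'n \<Rightarrow> complex^'n \<Rightarrow> complex^'n" where
  "Gam y X Y = (\<chi> i. bil (\<lambda>j k. of_real (christoffel G i j k y)) X Y)"

definition dGam :: "real^'n \<Rightarrow> complex^'n \<Rightarrow> complex^'n \<Rightarrow> complex^'n \<Rightarrow> complex^'n" where
  "dGam y W X Y = (\<chi> i. bil (\<lambda>j k. \<Sum>l\<in>UNIV. W $ l * of_real (dreal l (christoffel G i j k) y)) X Y)"

text \<open>The curvature operator on fields with constant components, for which the bracket term is
  absent, extended complex linearly; \<open>riemann_complex_eq\<close> identifies it with the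
  curvature tensor of the hypotheses.\<close>

definition Rm :: "real^'n \<Rightarrow> complex^'n \<Rightarrow> complex^'n \<Rightarrow> complex^'n \<Rightarrow> complex^'n" where
  "Rm y X Y Z = dGam y X Y Z - dGam y Y X Z + Gam y X (Gam y Y Z) - Gam y Y (Gam y X Z)"

text \<open>The Levi-Civita connection pulled back along \<open>u\<close> to the complexified
  tangent bundle of the target, in a constant complex direction \<open>p\<close> of the
  source.\<close>

definition nab :: "'e \<times> 'e \<Rightarrow> ('e::real_normed_vector \<Rightarrow> real^'n) \<Rightarrow> ('e \<Rightarrow> complex^'n) \<Rightarrow> 'e \<Rightarrow> complex^'n" where
  "nab p u \<xi> z = vcderiv p \<xi> z + Gam (u z) (vcderiv p (\<lambda>w. cvec (u w)) z) (\<xi> z)"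

lemma Ck_G: "Ck_on k V (\<lambda>y. G y $ i $ j)"
proof -
  have "Ck_on k V G" using smooth by (simp add: smooth_on_def)
  then have "Ck_on k V (\<lambda>y. G y $ i)"
    using Ck_on_linear_comp[OF open_V bounded_linear_vec_nth] by blast
  then show ?thesis using Ck_on_linear_comp[OF open_V bounded_linear_vec_nth] by blast
qed

lemma invertible_G: assumes "y \<in> V" shows "invertible (G y)"
proof -
  have "v = 0" if "G y *v v = 0" for v
  proof (rule ccontr)
    assume "v \<noteq> 0"
    have "(\<Sum>i\<in>UNIV. \<Sum>j\<in>UNIV. G y $ i $ j * v $ i * v $ j) = (\<Sum>i\<in>UNIV. v $ i * (G y *v v) $ i)"
      by (simp add: matrix_vector_mult_def sum_distrib_left algebra_simps)
    then show False using pos[OF assms \<open>v \<noteq> 0\<close>] that by simp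
  qed
  then show ?thesis
    using matrix_left_invertible_ker invertible_left_inverse by blast
qed

text \<open>By Cramer's rule the entries of the inverse are quotients of polynomials in the entries
  of \<open>G\<close>.\<close>

lemma Ck_matrix_inv: "Ck_on k V (\<lambda>y. matrix_inv (G y) $ i $ l)"
proof -
  have eq: "matrix_inv (G y) $ i $ l
     = det (\<chi> r s. if s = i then axis l 1 $ r else G y $ r $ s) / det (G y)" if "y \<in> V" for y
  proof -
    have inv: "invertible (G y)" by (rule invertible_G[OF that])
    then have d: "det (G y) \<noteq> 0" by (simp add: invertible_det_nz)
    have "G y *v (matrix_inv (G y) *v axis l 1) = axis l 1"
      using matrix_inv_right[OF inv] by (simp add: matrix_vector_mul_assoc)
    then have "matrix_inv (G y) *v axis l 1 = (\<chi> k. det (\<chi> r s. if s = k then axis l 1 $ r else G y $ r $ s) / det (G y))"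
      using cramer[OF d] by blast
    moreover have "(matrix_inv (G y) *v axis l 1) $ i = matrix_inv (G y) $ i $ l"
      by (simp add: matrix_vector_mult_basis column_def)
    ultimately show ?thesis by simp
  qed
  have "Ck_on k V (\<lambda>y. det (\<chi> r s. if s = i then axis l 1 $ r else G y $ r $ s) / det (G y))"
  proof (rule Ck_on_divide[OF open_V])
    show "det (G y) \<noteq> 0" if "y \<in> V" for y using invertible_G[OF that] by (simp add: invertible_det_nz)
    show "Ck_on k V (\<lambda>y. det (G y))"
      unfolding det_def by (intro Ck_on_sum Ck_on_mult Ck_on_prod open_V Ck_on_const Ck_G)
    have "Ck_on k V (\<lambda>y. if b then a else G y $ r $ s)" for a b r s
      by (cases b) (auto intro: Ck_G)
    then show "Ck_on k V (\<lambda>y. det (\<chi> r s. if s = i then axis l 1 $ r else G y $ r $ s))"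
      unfolding det_def by (intro Ck_on_sum Ck_on_mult Ck_on_prod open_V Ck_on_const) simp
  qed
  then show ?thesis using Ck_on_cong[OF open_V, of "\<lambda>y. matrix_inv (G y) $ i $ l"] eq by simp
qed

lemma Ck_dG: "Ck_on k V (dreal l (\<lambda>y. G y $ i $ j))"
  unfolding dreal_def[abs_def] by (rule Ck_on_frechet_derivative[OF Ck_G])

lemma Ck_christoffel: "Ck_on k V (christoffel G i j m)"
  unfolding christoffel_def[abs_def]
  by (intro Ck_on_divide Ck_on_sum Ck_on_mult Ck_on_add Ck_on_diff open_V Ck_matrix_inv Ck_on_const Ck_dG) simp

lemma sym_dG: assumes "y \<in> V" shows "dreal l (\<lambda>x. G x $ i $ j) y = dreal l (\<lambda>x. G x $ j $ i) y"
  unfolding dreal_def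
  using frechet_derivative_cong_open[OF open_V assms, of "\<lambda>x. G x $ i $ j" "\<lambda>x. G x $ j $ i"] sym by auto

lemma christoffel_sym: assumes "y \<in> V" shows "christoffel G i j k y = christoffel G i k j y"
  unfolding christoffel_def using sym_dG[OF assms, of _ j k] by (simp add: algebra_simps)

text \<open>Contracting with the metric cancels the inverse in the definition and leaves the
  Christoffel symbols of the first kind, which are linear in the derivatives of
  \<open>G\<close>.\<close>

lemma christoffel_lower:
  assumes "y \<in> V"
  shows "(\<Sum>i\<in>UNIV. G y $ b $ i * christoffel G i j k y) =
    (dreal j (\<lambda>x. G x $ k $ b) y + dreal k (\<lambda>x. G x $ j $ b) y - dreal b (\<lambda>x. G x $ j $ k) y) / 2"
proof -
  define T where "T l = dreal j (\<lambda>x. G x $ k $ l) y + dreal k (\<lambda>x. G x $ j $ l) y - dreal l (\<lambda>x. G x $ j $ k) y" for l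
  have id: "(\<Sum>i\<in>UNIV. G y $ b $ i * matrix_inv (G y) $ i $ l) = (if b = l then 1 else 0)" for l
    using matrix_inv_right[OF invertible_G[OF assms]]
    by (auto simp: matrix_matrix_mult_def mat_def vec_eq_iff)
  have "(\<Sum>i\<in>UNIV. G y $ b $ i * christoffel G i j k y)
      = (\<Sum>i\<in>UNIV. \<Sum>l\<in>UNIV. (G y $ b $ i * matrix_inv (G y) $ i $ l) * (T l / 2))"
    unfolding christoffel_def T_def[symmetric]
    by (simp add: sum_distrib_left sum_divide_distrib algebra_simps)
  also have "\<dots> = (\<Sum>l\<in>UNIV. (\<Sum>i\<in>UNIV. G y $ b $ i * matrix_inv (G y) $ i $ l) * (T l / 2))"
    unfolding sum_distrib_right by (rule sum.swap)
  also have "\<dots> = (\<Sum>l\<in>UNIV. if l = b then T l / 2 else 0)" by (intro sum.cong) (auto simp: id)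
  also have "\<dots> = T b / 2" by simp
  finally show ?thesis by (simp add: T_def)
qed

lemma CG_sym: "y \<in> V \<Longrightarrow> CG y X Y = CG y Y X"
  unfolding CG_def by (subst bil_swap) (simp add: sym)

lemmas CG_simps = bil_simps(1-10)[of "\<lambda>i j. of_real (G y $ i $ j)" for y, folded CG_def]

lemma Gam_simps:
  "Gam y (X + X') Y = Gam y X Y + Gam y X' Y"
  "Gam y X (Y + Y') = Gam y X Y + Gam y X Y'"
  "Gam y (X - X') Y = Gam y X Y - Gam y X' Y"
  "Gam y X (Y - Y') = Gam y X Y - Gam y X Y'"
  "Gam y 0 Y = 0" "Gam y X 0 = 0"
  "Gam y (a *s X) Y = a *s Gam y X Y"
  "Gam y X (a *s Y) = a *s Gam y X Y"
  by (simp_all add: Gam_def vec_eq_iff bil_simps)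

lemma Gam_sym: "y \<in> V \<Longrightarrow> Gam y X Y = Gam y Y X"
  unfolding Gam_def by (subst bil_swap) (simp add: christoffel_sym)

lemma dGam_sym: "y \<in> V \<Longrightarrow> dGam y W X Y = dGam y W Y X"
proof -
  assume y: "y \<in> V"
  have "dreal l (christoffel G i j k) y = dreal l (christoffel G i k j) y" for l i j k
    unfolding dreal_def
    using frechet_derivative_cong_open[OF open_V y, of "christoffel G i j k" "christoffel G i k j"] christoffel_sym by auto
  then show ?thesis unfolding dGam_def by (subst bil_swap) simp
qed

text \<open>The connection has no torsion: \<open>Gam\<close> and \<open>dGam\<close> are symmetric
  in their last two arguments, and the twelve terms of the cyclic sum cancel in pairs.\<close>

lemma Bianchi: "y \<in> V \<Longrightarrow> Rm y X Y Z + Rm y Y Z X + Rm y Z X Y = 0"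
  unfolding Rm_def by (simp add: dGam_sym[of y X Y Z] dGam_sym[of y Y Z X] dGam_sym[of y Z X Y]
    Gam_sym[of y X Y] Gam_sym[of y Y Z] Gam_sym[of y X Z])

lemma Rm_antisym: "Rm y X Y Z = - Rm y Y X Z"
  by (simp add: Rm_def)

text \<open>Lowering the index turns both terms on the right into Christoffel symbols of the first
  kind; in their sum everything except the derivative along \<open>W\<close> cancels by symmetry of
  the metric. This is metric compatibility in coordinates, for complex arguments.\<close>

lemma metric_derivative:
  assumes y: "y \<in> V"
  shows "bil (\<lambda>i j. \<Sum>k\<in>UNIV. W $ k * of_real (dreal k (\<lambda>x. G x $ i $ j) y)) X Y
       = CG y (Gam y W X) Y + CG y X (Gam y W Y)"
proof -
  define d where "d l i j = dreal l (\<lambda>x. G x $ i $ j) y" for l i j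
  have ds: "d l i j = d l j i" for l i j using sym_dG[OF y] by (simp add: d_def)
  have *: "CG y X (Gam y W Y) = (\<Sum>b\<in>UNIV. \<Sum>j\<in>UNIV. \<Sum>k\<in>UNIV.
      of_real ((d j k b + d k j b - d b j k) / 2) * (X $ b * W $ j * Y $ k))" for X Y
  proof -
    have "CG y X (Gam y W Y) = (\<Sum>b\<in>UNIV. \<Sum>i\<in>UNIV. \<Sum>j\<in>UNIV. \<Sum>k\<in>UNIV.
        of_real (G y $ b $ i * christoffel G i j k y) * (X $ b * W $ j * Y $ k))"
      unfolding CG_def Gam_def bil_def by (simp add: sum_distrib_left algebra_simps)
    also have "\<dots> = (\<Sum>b\<in>UNIV. \<Sum>j\<in>UNIV. \<Sum>k\<in>UNIV. \<Sum>i\<in>UNIV.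
        of_real (G y $ b $ i * christoffel G i j k y) * (X $ b * W $ j * Y $ k))"
      by (rule sum.cong[OF refl], rule trans[OF sum.swap], rule sum.cong[OF refl], rule sum.swap)
    also have "\<dots> = (\<Sum>b\<in>UNIV. \<Sum>j\<in>UNIV. \<Sum>k\<in>UNIV.
        of_real (\<Sum>i\<in>UNIV. G y $ b $ i * christoffel G i j k y) * (X $ b * W $ j * Y $ k))"
      by (simp add: sum_distrib_right)
    finally show ?thesis by (simp only: christoffel_lower[OF y] d_def)
  qed
  have pt: "of_real ((d j k b + d k j b - d b j k) / 2) * (X $ b * W $ j * Y $ k)
      + of_real ((d j b k + d b j k - d k j b) / 2) * (Y $ k * W $ j * X $ b)
      = of_real (d j k b) * (X $ b * W $ j * Y $ k)" for j k b
  proof -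
    have "(d j k b + d k j b - d b j k) / 2 + (d j b k + d b j k - d k j b) / 2 = d j k b"
      using ds[of j b k] by (simp add: field_simps)
    then have "of_real ((d j k b + d k j b - d b j k) / 2) + of_real ((d j b k + d b j k - d k j b) / 2)
       = complex_of_real (d j k b)" by (metis of_real_add)
    moreover have "Y $ k * W $ j * X $ b = X $ b * W $ j * Y $ k" by (simp add: mult_ac)
    ultimately show ?thesis by (metis distrib_right)
  qed
  have "CG y X (Gam y W Y) + CG y Y (Gam y W X) = (\<Sum>b\<in>UNIV. \<Sum>j\<in>UNIV. \<Sum>k\<in>UNIV.
      of_real ((d j k b + d k j b - d b j k) / 2) * (X $ b * W $ j * Y $ k))
     + (\<Sum>k\<in>UNIV. \<Sum>j\<in>UNIV. \<Sum>b\<in>UNIV.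
      of_real ((d j b k + d b j k - d k j b) / 2) * (Y $ k * W $ j * X $ b))"
    by (simp add: *)
  also have "(\<Sum>k\<in>UNIV. \<Sum>j\<in>UNIV. \<Sum>b\<in>UNIV.
      of_real ((d j b k + d b j k - d k j b) / 2) * (Y $ k * W $ j * X $ b))
    = (\<Sum>b\<in>UNIV. \<Sum>j\<in>UNIV. \<Sum>k\<in>UNIV.
      of_real ((d j b k + d b j k - d k j b) / 2) * (Y $ k * W $ j * X $ b))" (is "?a = ?b")
  proof -
    have "?a = (\<Sum>j\<in>UNIV. \<Sum>k\<in>UNIV. \<Sum>b\<in>UNIV.
      of_real ((d j b k + d b j k - d k j b) / 2) * (Y $ k * W $ j * X $ b))" by (rule sum.swap)
    also have "\<dots> = (\<Sum>j\<in>UNIV. \<Sum>b\<in>UNIV. \<Sum>k\<in>UNIV.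
      of_real ((d j b k + d b j k - d k j b) / 2) * (Y $ k * W $ j * X $ b))"
      by (rule sum.cong[OF refl], rule sum.swap)
    also have "\<dots> = ?b" by (rule sum.swap)
    finally show ?thesis .
  qed
  finally have "CG y X (Gam y W Y) + CG y Y (Gam y W X) = (\<Sum>b\<in>UNIV. \<Sum>j\<in>UNIV. \<Sum>k\<in>UNIV.
      of_real (d j k b) * (X $ b * W $ j * Y $ k))"
    by (simp only: sum.distrib[symmetric] pt)
  also have "\<dots> = bil (\<lambda>i j. \<Sum>k\<in>UNIV. W $ k * of_real (d k i j)) X Y"
  proof -
    have "(\<Sum>j\<in>UNIV. \<Sum>k\<in>UNIV. of_real (d j k b) * (X $ b * W $ j * Y $ k))
      = (\<Sum>k\<in>UNIV. \<Sum>j\<in>UNIV. of_real (d j b k) * (X $ b * W $ j * Y $ k))" for b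
      by (subst sum.swap) (simp add: ds[of _ b])
    then show ?thesis
      unfolding bil_def by (simp add: sum_distrib_left sum_distrib_right algebra_simps)
  qed
  finally show ?thesis using CG_sym[OF y, of Y "Gam y W X"] by (simp add: d_def algebra_simps)
qed

end

declare Ck_on.simps(2) [simp del]

lemma Ck_on_differentiable: "Ck_on k S F \<Longrightarrow> x \<in> S \<Longrightarrow> 0 < k \<Longrightarrow> F differentiable (at x)"
  by (cases k) (auto simp: Ck_on.simps(2))

lemma C1_differentiable: "Ck_on 1 S F \<Longrightarrow> x \<in> S \<Longrightarrow> F differentiable (at x)"
  by (rule Ck_on_differentiable) auto

lemma Ck_on_vcderiv_le: "open S \<Longrightarrow> Ck_on m S \<xi> \<Longrightarrow> k < m \<Longrightarrow> Ck_on k S (vcderiv p \<xi>)"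
  by (rule Ck_on_vcderiv) (auto intro: Ck_on_le)

lemma sum_axis: "(\<Sum>j\<in>UNIV. c j * axis a (1::'b::semiring_1) $ j) = c a"
proof -
  have "c j * axis a 1 $ j = (if j = a then c a else 0)" for j by (simp add: axis_def)
  then show ?thesis by simp
qed

lemma sum_axis_left:
  "(\<Sum>j\<in>UNIV. \<Sum>k\<in>UNIV. c j k * axis a (1::'b::comm_semiring_1) $ j * d k) = (\<Sum>k\<in>UNIV. c a k * d k)"
proof -
  have "(\<Sum>j\<in>UNIV. \<Sum>k\<in>UNIV. c j k * axis a 1 $ j * d k) = (\<Sum>j\<in>UNIV. (\<Sum>k\<in>UNIV. c j k * d k) * axis a 1 $ j)"
    unfolding sum_distrib_right by (simp add: mult_ac)
  then show ?thesis by (simp only: sum_axis)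
qed

text \<open>Packs three indices into one, so that a five-fold sum can be reordered by swapping
  single sums.\<close>

lemma sum_triple:
  fixes F :: "'i::finite \<Rightarrow> 'j::finite \<Rightarrow> 'k::finite \<Rightarrow> 'b::comm_monoid_add"
  shows "(\<Sum>i\<in>UNIV. \<Sum>j\<in>UNIV. \<Sum>k\<in>UNIV. F i j k) = (\<Sum>p\<in>UNIV. F (fst p) (fst (snd p)) (snd (snd p)))"
  by (simp add: sum.cartesian_product case_prod_unfold flip: UNIV_Times_UNIV)

section \<open>Metric compatibility, symmetry and curvature of the pulled-back connection\<close>

context riem
begin

lemma differentiable_christoffel: "y \<in> V \<Longrightarrow> christoffel G i j k differentiable (at y)"
  by (rule Ck_on_differentiable[OF Ck_christoffel[of 1]]) auto

lemma differentiable_G: "y \<in> V \<Longrightarrow> (\<lambda>x. G x $ i $ j) differentiable (at y)"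
  by (rule Ck_on_differentiable[OF Ck_G[of 1]]) auto

lemma metric_compat:
  assumes "u differentiable (at z)" "u z \<in> V" "\<xi> differentiable (at z)" "\<zeta> differentiable (at z)"
  shows "cderiv p (\<lambda>w. CG (u w) (\<xi> w) (\<zeta> w)) z
       = CG (u z) (nab p u \<xi> z) (\<zeta> z) + CG (u z) (\<xi> z) (nab p u \<zeta> z)"
  using cderiv_bil[where c="\<lambda>i j x. G x $ i $ j", OF assms(1) differentiable_G[OF assms(2)] assms(3,4), of p]
  unfolding metric_derivative[OF assms(2)]
  by (simp only: CG_def[symmetric] nab_def CG_simps) (simp add: algebra_simps)

text \<open>Absence of torsion along the map: second derivatives of \<open>u\<close> commute and
  \<open>Gam\<close> is symmetric. It makes the Hessian of the map symmetric in its two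
  directions.\<close>

lemma nab_sym:
  assumes "open U" "z \<in> U" "u ` U \<subseteq> V" "Ck_on 2 U u"
  shows "nab p u (vcderiv q (\<lambda>w. cvec (u w))) z = nab q u (vcderiv p (\<lambda>w. cvec (u w))) z"
  using vcderiv_commute[OF assms(1,2) Ck_on_cvec[OF assms(1,4)], of p q] assms(2,3)
    Gam_sym[of "u z" "vcderiv p (\<lambda>w. cvec (u w)) z"]
  by (simp add: nab_def image_subset_iff)

lemma vcderiv_Gam:
  assumes "u differentiable (at z)" "u z \<in> V" "\<xi> differentiable (at z)" "\<zeta> differentiable (at z)"
  shows "vcderiv p (\<lambda>w. Gam (u w) (\<xi> w) (\<zeta> w)) z = dGam (u z) (vcderiv p (\<lambda>w. cvec (u w)) z) (\<xi> z) (\<zeta> z)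
       + Gam (u z) (vcderiv p \<xi> z) (\<zeta> z) + Gam (u z) (\<xi> z) (vcderiv p \<zeta> z)"
  using cderiv_bil[OF assms(1) differentiable_christoffel[OF assms(2)] assms(3,4), of p]
  by (simp add: vec_eq_iff Gam_def dGam_def)

lemma Ck_Gam:
  assumes "open U" "u ` U \<subseteq> V" "Ck_on k U u" "Ck_on k U \<xi>" "Ck_on k U \<zeta>"
  shows "Ck_on k U (\<lambda>w. Gam (u w) (\<xi> w) (\<zeta> w))"
  unfolding Gam_def
  by (subst Ck_on_componentwise[OF assms(1)])
    (use Ck_on_bil[OF assms(1) open_V assms(2,3) Ck_christoffel assms(4,5)] in simp)

lemma Ck_CG:
  assumes "open U" "u ` U \<subseteq> V" "Ck_on k U u" "Ck_on k U \<xi>" "Ck_on k U \<zeta>"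
  shows "Ck_on k U (\<lambda>w. CG (u w) (\<xi> w) (\<zeta> w))"
  unfolding CG_def by (rule Ck_on_bil[OF assms(1) open_V assms(2,3) Ck_G assms(4,5)])

lemma Ck_nab:
  assumes "open U" "u ` U \<subseteq> V" "Ck_on (Suc k) U u" "Ck_on (Suc k) U \<xi>"
  shows "Ck_on k U (nab p u \<xi>)"
  unfolding nab_def[abs_def]
  by (intro Ck_on_add Ck_Gam Ck_on_vcderiv Ck_on_cvec assms Ck_on_Suc_imp)

lemma Ck_nab_le:
  assumes "open U" "u ` U \<subseteq> V" "Ck_on m U u" "Ck_on m U \<xi>" "k < m"
  shows "Ck_on k U (nab p u \<xi>)"
  by (rule Ck_nab) (use assms in \<open>auto intro: Ck_on_le\<close>)

lemma vcderiv_add: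
  assumes "\<xi> differentiable (at z)" "\<zeta> differentiable (at z)"
  shows "vcderiv p (\<lambda>w. \<xi> w + \<zeta> w) z = vcderiv p \<xi> z + vcderiv p \<zeta> z"
  by (simp add: vec_eq_iff cderiv_add differentiable_vec_nth assms)

text \<open>The directions \<open>p\<close> and \<open>q\<close> are constant, so there is no
  bracket term. Terms with derivatives of \<xi> and with second derivatives of \<open>u\<close>
  cancel in the commutator, and the rest is the coordinate expression \<open>Rm\<close>.\<close>

lemma nab_curvature:
  assumes U: "open U" "z \<in> U" "u ` U \<subseteq> V" and u: "Ck_on 2 U u" and \<xi>: "Ck_on 2 U \<xi>"
  shows "nab p u (nab q u \<xi>) z - nab q u (nab p u \<xi>) z
    = Rm (u z) (vcderiv p (\<lambda>w. cvec (u w)) z) (vcderiv q (\<lambda>w. cvec (u w)) z) (\<xi> z)"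
proof -
  let ?c = "\<lambda>w. cvec (u w)"
  have uz: "u z \<in> V" using U by auto
  have c2: "Ck_on 2 U ?c" by (rule Ck_on_cvec[OF U(1) u])
  have 1: "Ck_on 1 U (vcderiv q ?c)" "Ck_on 1 U (vcderiv q \<xi>)" for q
    using Ck_on_vcderiv_le[OF U(1), of 2 _ 1] c2 \<xi> by simp_all
  have u1: "Ck_on 1 U u" and \<xi>1: "Ck_on 1 U \<xi>" using Ck_on_le[OF u] Ck_on_le[OF \<xi>] by simp_all
  have d: "u differentiable (at z)" "\<xi> differentiable (at z)" "vcderiv q ?c differentiable (at z)"
      "vcderiv q \<xi> differentiable (at z)" for q
    using 1 u1 \<xi>1 U(2) by (blast intro: C1_differentiable)+
  have dG: "(\<lambda>w. Gam (u w) (vcderiv q ?c w) (\<xi> w)) differentiable (at z)" for q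
    using Ck_Gam[OF U(1,3) u1 1(1) \<xi>1] U(2) by (blast intro: C1_differentiable)+
  have e: "vcderiv p (nab q u \<xi>) z = vcderiv p (vcderiv q \<xi>) z + (dGam (u z) (vcderiv p ?c z) (vcderiv q ?c z) (\<xi> z)
       + Gam (u z) (vcderiv p (vcderiv q ?c) z) (\<xi> z) + Gam (u z) (vcderiv q ?c z) (vcderiv p \<xi> z))" for p q
    unfolding nab_def[abs_def] by (simp add: vcderiv_add d dG vcderiv_Gam uz)
  show ?thesis
    unfolding nab_def[of p u "nab q u \<xi>"] nab_def[of q u "nab p u \<xi>"] e
    using vcderiv_commute[OF U(1,2) c2, of p q] vcderiv_commute[OF U(1,2) \<xi>, of p q]
    by (simp add: nab_def Rm_def Gam_simps)
qed

lemma nab_cong: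
  assumes "open S" "z \<in> S" "\<And>w. w \<in> S \<Longrightarrow> \<xi> w = \<zeta> w"
  shows "nab p u \<xi> z = nab p u \<zeta> z"
  by (simp add: nab_def vcderiv_cong[OF assms] assms)

text \<open>Apply the commutator of covariant derivatives along the identity map to constant fields:
  the metric coefficient has symmetric second derivatives.\<close>

lemma Rm_metric_antisym:
  assumes y: "y \<in> V"
  shows "CG y (Rm y X Y Z) W = - CG y (Rm y X Y W) Z"
proof -
  \<comment> \<open>The real and imaginary parts of \<open>X\<close> and \<open>Y\<close> are used
    as directions, so that the differential of the identity map returns \<open>X\<close> and
    \<open>Y\<close> themselves.\<close>
  define p where "p = ((\<chi> i. Re (X $ i)) :: real^'n, (\<chi> i. Im (X $ i)) :: real^'n)"
  define q where "q = ((\<chi> i. Re (Y $ i)) :: real^'n, (\<chi> i. Im (Y $ i)) :: real^'n)"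
  let ?u = "\<lambda>y::real^'n. y"
  have vX: "vcderiv (a, b) (\<lambda>w::real^'n. cvec w) y = (\<chi> i. Complex (a $ i) (b $ i))" for a b y
    using frechet_derivative_vec_nth[of "\<lambda>w::real^'n. w" y] frechet_derivative_at[OF has_derivative_ident, of y, symmetric]
    by (simp add: vec_eq_iff cderiv_of_real differentiable_vec_nth complex_eq_iff)
  have pX: "vcderiv p (\<lambda>w. cvec w) y = X" and qY: "vcderiv q (\<lambda>w. cvec w) y = Y"
    by (simp_all add: p_def q_def vX vec_eq_iff)
  let ?Z = "\<lambda>_::real^'n. Z" and ?W = "\<lambda>_::real^'n. W"
  have I: "?u ` V \<subseteq> V" by simp
  have Ci: "Ck_on k V ?u" for k by (rule Ck_on_id)
  have n: "Ck_on k V (nab p ?u ?Z)" "Ck_on k V (nab p ?u ?W)" for k p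
    by (rule Ck_nab[OF open_V I Ci]; simp)+
  have first: "cderiv p (\<lambda>w. CG w Z W) w = CG w (nab p ?u ?Z w) W + CG w Z (nab p ?u ?W w)" if "w \<in> V" for w p
    using metric_compat[of ?u w ?Z ?W p] that by simp
  have d: "(\<lambda>w. CG w (nab p ?u ?Z w) W) differentiable (at y)" "(\<lambda>w. CG w Z (nab p ?u ?W w)) differentiable (at y)" for p
    using Ck_CG[OF open_V I Ci n(1) Ck_on_const, of 1] Ck_CG[OF open_V I Ci Ck_on_const n(2), of 1] y
    by (blast intro: C1_differentiable)+
  have dn: "nab p ?u ?Z differentiable (at y)" "nab p ?u ?W differentiable (at y)" for p
    using n[of 1] y by (blast intro: C1_differentiable)+
  have second: "cderiv p (cderiv q (\<lambda>w. CG w Z W)) y = CG y (nab p ?u (nab q ?u ?Z) y) W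
      + CG y (nab q ?u ?Z y) (nab p ?u ?W y) + CG y (nab p ?u ?Z y) (nab q ?u ?W y) + CG y Z (nab p ?u (nab q ?u ?W) y)" for p q
  proof -
    have "cderiv p (cderiv q (\<lambda>w. CG w Z W)) y = cderiv p (\<lambda>w. CG w (nab q ?u ?Z w) W + CG w Z (nab q ?u ?W w)) y"
      by (rule cderiv_cong[OF open_V y first])
    then show ?thesis
      using metric_compat[of ?u y "nab q ?u ?Z" ?W p] metric_compat[of ?u y ?Z "nab q ?u ?W" p] y
      by (simp add: cderiv_add d dn)
  qed
  have "Ck_on 2 V (\<lambda>w. CG w Z W)" by (rule Ck_CG[OF open_V I Ci]) simp_all
  then have "cderiv p (cderiv q (\<lambda>w. CG w Z W)) y = cderiv q (cderiv p (\<lambda>w. CG w Z W)) y"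
    by (rule cderiv_commute[OF open_V y])
  then have "CG y (nab p ?u (nab q ?u ?Z) y - nab q ?u (nab p ?u ?Z) y) W
      + CG y Z (nab p ?u (nab q ?u ?W) y - nab q ?u (nab p ?u ?W) y) = 0"
    unfolding second by (simp add: CG_simps algebra_simps)
  then have "CG y (Rm y X Y Z) W + CG y Z (Rm y X Y W) = 0"
    by (simp add: nab_curvature[OF open_V y I Ci Ck_on_const] pX qY)
  then show ?thesis using CG_sym[OF y] by (simp add: eq_neg_iff_add_eq_0)
qed

lemma levi_civita_const:
  "levi_civita G (\<lambda>_. axis j 1) (\<lambda>_. axis k 1) = (\<lambda>y. \<chi> a. christoffel G a j k y)"
  by (rule ext) (simp add: levi_civita_def frechet_derivative_const vec_eq_iff sum_axis)

lemma riemann_op_const: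
  assumes y: "y \<in> V"
  shows "riemann_op G (\<lambda>_. axis i 1) (\<lambda>_. axis j 1) (\<lambda>_. axis k 1) y $ a =
     dreal i (christoffel G a j k) y - dreal j (christoffel G a i k) y
     + (\<Sum>m\<in>UNIV. christoffel G a i m y * christoffel G m j k y)
     - (\<Sum>m\<in>UNIV. christoffel G a j m y * christoffel G m i k y)"
proof -
  have "Ck_on 1 V (\<lambda>y. \<chi> a. christoffel G a j k y)" for j k
    by (subst Ck_on_componentwise[OF open_V]) (use Ck_christoffel[of 1] in simp)
  then have d: "(\<lambda>y. \<chi> a. christoffel G a j k y) differentiable (at y)" for j k
    using y by (blast intro: C1_differentiable)+
  have lc: "levi_civita G (\<lambda>_. axis i 1) (\<lambda>y. \<chi> a. christoffel G a j k y) y $ a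
      = dreal i (christoffel G a j k) y + (\<Sum>m\<in>UNIV. christoffel G a i m y * christoffel G m j k y)" for i j
    using frechet_derivative_vec_nth[OF d, of j k a "axis i 1"]
    by (simp add: levi_civita_def dreal_def sum_axis_left)
  have lb: "lie_bracket (\<lambda>_. axis i 1) (\<lambda>_. axis j 1) = (\<lambda>_::real^'n. 0)"
    by (rule ext) (simp add: lie_bracket_def frechet_derivative_const)
  show ?thesis
    unfolding riemann_op_def levi_civita_const lb
    by (simp add: lc) (simp add: levi_civita_def frechet_derivative_const)
qed

text \<open>On coordinate fields the operator of the definition has the components
  \<open>R a i j k\<close>, by \<open>riemann_op_const\<close>. The same components come from
  expanding \<open>Rm\<close>, so only a reordering of finite sums is left.\<close>

lemma riemann_complex_eq:
  assumes y: "y \<in> V"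
  shows "riemann_complex G y Z1 Z2 Z3 Z4 = CG y (Rm y Z1 Z2 Z3) Z4"
proof -
  define D where "D a i j k = dreal i (christoffel G a j k) y" for a i j k
  define Q where "Q a i j k = (\<Sum>m\<in>UNIV. christoffel G a i m y * christoffel G m j k y)" for a i j k
  define R where "R a i j k = D a i j k - D a j i k + Q a i j k - Q a j i k" for a i j k
  have dG: "dGam y X Y Z $ a = (\<Sum>i\<in>UNIV. \<Sum>j\<in>UNIV. \<Sum>k\<in>UNIV. of_real (D a i j k) * (X $ i * Y $ j * Z $ k))" for X Y Z a
  proof -
    have "dGam y X Y Z $ a = (\<Sum>j\<in>UNIV. \<Sum>k\<in>UNIV. \<Sum>i\<in>UNIV. of_real (D a i j k) * (X $ i * Y $ j * Z $ k))"
      by (simp add: dGam_def bil_def D_def sum_distrib_left sum_distrib_right mult_ac)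
    also have "\<dots> = (\<Sum>j\<in>UNIV. \<Sum>i\<in>UNIV. \<Sum>k\<in>UNIV. of_real (D a i j k) * (X $ i * Y $ j * Z $ k))"
      by (rule sum.cong[OF refl], rule sum.swap)
    finally show ?thesis by (rule trans[OF _ sum.swap])
  qed
  have GG: "Gam y X (Gam y Y Z) $ a = (\<Sum>i\<in>UNIV. \<Sum>j\<in>UNIV. \<Sum>k\<in>UNIV. of_real (Q a i j k) * (X $ i * Y $ j * Z $ k))" for X Y Z a
  proof -
    have "Gam y X (Gam y Y Z) $ a = (\<Sum>i\<in>UNIV. \<Sum>m\<in>UNIV. \<Sum>j\<in>UNIV. \<Sum>k\<in>UNIV.
        of_real (christoffel G a i m y * christoffel G m j k y) * (X $ i * Y $ j * Z $ k))"
      by (simp add: Gam_def bil_def sum_distrib_left sum_distrib_right mult_ac)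
    also have "\<dots> = (\<Sum>i\<in>UNIV. \<Sum>j\<in>UNIV. \<Sum>k\<in>UNIV. \<Sum>m\<in>UNIV.
        of_real (christoffel G a i m y * christoffel G m j k y) * (X $ i * Y $ j * Z $ k))"
      by (rule sum.cong[OF refl], rule trans[OF sum.swap], rule sum.cong[OF refl], rule sum.swap)
    finally show ?thesis by (simp add: Q_def sum_distrib_right)
  qed
  have swap3: "(\<Sum>i\<in>UNIV. \<Sum>j\<in>UNIV. \<Sum>k\<in>UNIV. c j i k * (Z2 $ i * Z1 $ j * Z3 $ k))
      = (\<Sum>i\<in>UNIV. \<Sum>j\<in>UNIV. \<Sum>k\<in>UNIV. c i j k * (Z1 $ i * Z2 $ j * Z3 $ k))" for c :: "'n \<Rightarrow> 'n \<Rightarrow> 'n \<Rightarrow> complex"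
    by (rule trans[OF sum.swap]) (simp add: mult_ac)
  have Rm: "Rm y Z1 Z2 Z3 $ a = (\<Sum>i\<in>UNIV. \<Sum>j\<in>UNIV. \<Sum>k\<in>UNIV. of_real (R a i j k) * (Z1 $ i * Z2 $ j * Z3 $ k))" for a
    using swap3[of "\<lambda>i j k. of_real (D a j i k)"] swap3[of "\<lambda>i j k. of_real (Q a j i k)"]
    by (simp add: Rm_def dG GG R_def sum.distrib sum_subtractf ring_distribs)
  have rc: "riemann G (\<lambda>_. axis i 1) (\<lambda>_. axis j 1) (\<lambda>_. axis k 1) (\<lambda>_. axis l 1) y
      = (\<Sum>a\<in>UNIV. G y $ a $ l * R a i j k)" for i j k l
    unfolding riemann_def riemann_op_const[OF y] D_def[symmetric] Q_def[symmetric] R_def[symmetric]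
    by (simp add: sum_axis)
  have "riemann_complex G y Z1 Z2 Z3 Z4 = (\<Sum>i\<in>UNIV. \<Sum>j\<in>UNIV. \<Sum>k\<in>UNIV. \<Sum>l\<in>UNIV. \<Sum>a\<in>UNIV.
      of_real (G y $ a $ l) * (of_real (R a i j k) * (Z1 $ i * Z2 $ j * Z3 $ k)) * Z4 $ l)"
    unfolding riemann_complex_def rc by (simp add: sum_distrib_left sum_distrib_right mult_ac)
  also have "\<dots> = (\<Sum>p\<in>UNIV. \<Sum>l\<in>UNIV. \<Sum>a\<in>UNIV. of_real (G y $ a $ l) * (of_real (R a (fst p) (fst (snd p)) (snd (snd p)))
        * (Z1 $ fst p * Z2 $ fst (snd p) * Z3 $ snd (snd p))) * Z4 $ l)"
    by (rule sum_triple)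
  also have "\<dots> = (\<Sum>l\<in>UNIV. \<Sum>p\<in>UNIV. \<Sum>a\<in>UNIV. of_real (G y $ a $ l) * (of_real (R a (fst p) (fst (snd p)) (snd (snd p)))
        * (Z1 $ fst p * Z2 $ fst (snd p) * Z3 $ snd (snd p))) * Z4 $ l)"
    by (rule sum.swap)
  also have "\<dots> = (\<Sum>l\<in>UNIV. \<Sum>a\<in>UNIV. \<Sum>p\<in>UNIV. of_real (G y $ a $ l) * (of_real (R a (fst p) (fst (snd p)) (snd (snd p)))
        * (Z1 $ fst p * Z2 $ fst (snd p) * Z3 $ snd (snd p))) * Z4 $ l)"
    by (rule sum.cong[OF refl], rule sum.swap)
  also have "\<dots> = (\<Sum>a\<in>UNIV. \<Sum>l\<in>UNIV. \<Sum>p\<in>UNIV. of_real (G y $ a $ l) * (of_real (R a (fst p) (fst (snd p)) (snd (snd p)))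
        * (Z1 $ fst p * Z2 $ fst (snd p) * Z3 $ snd (snd p))) * Z4 $ l)"
    by (rule sum.swap)
  also have "\<dots> = (\<Sum>a\<in>UNIV. \<Sum>l\<in>UNIV. of_real (G y $ a $ l) * Rm y Z1 Z2 Z3 $ a * Z4 $ l)"
    unfolding Rm sum_triple[of "\<lambda>i j k. of_real (R a i j k) * (Z1 $ i * Z2 $ j * Z3 $ k)" for a]
    by (simp only: sum_distrib_left sum_distrib_right)
  finally show ?thesis by (simp add: CG_def bil_def)
qed

text \<open>With conjugate directions as \<open>q1\<close> and \<open>q2\<close>, the left side is
  the coefficient of \<partial>\<partial>-bar \<eta>. Metric compatibility gives four terms for each
  second derivative. The products of the Hessian in \<open>p1\<close>, \<open>p2\<close> with that
  in \<open>q1\<close>, \<open>q2\<close> cancel, and so do the third derivatives up to commutators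
  of \<open>p1\<close> and \<open>p2\<close>. The two curvature terms left over agree by
  \<open>Rm_metric_antisym\<close>, which accounts for the last factor 2.\<close>

lemma theta_formula:
  assumes U: "open U" "z \<in> U" "u ` U \<subseteq> V" and u: "Ck_on 3 U u"
  defines "c \<equiv> \<lambda>w. cvec (u w)"
  defines "\<eta> \<equiv> \<lambda>p q w. CG (u w) (vcderiv p c w) (vcderiv q c w)"
  defines "A \<equiv> \<lambda>q p. nab q u (vcderiv p c) z"
  shows "cderiv p1 (cderiv q1 (\<eta> p2 q2)) z + cderiv p2 (cderiv q2 (\<eta> p1 q1)) z
       - cderiv p1 (cderiv q2 (\<eta> p2 q1)) z - cderiv p2 (cderiv q1 (\<eta> p1 q2)) z
     = 2 * (CG (u z) (A q1 p2) (A q2 p1) - CG (u z) (A q1 p1) (A q2 p2))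
     + 2 * CG (u z) (Rm (u z) (vcderiv p1 c z) (vcderiv p2 c z) (vcderiv q1 c z)) (vcderiv q2 c z)"
proof -
  have uz: "u z \<in> V" using U by auto
  have c3: "Ck_on 3 U c" unfolding c_def by (rule Ck_on_cvec[OF U(1) u])
  have u2: "Ck_on 2 U u" and u1: "Ck_on 1 U u" using Ck_on_le[OF u] by auto
  have v2: "Ck_on 2 U (vcderiv p c)" for p
    using Ck_on_vcderiv_le[OF U(1) c3] by simp
  have v1: "Ck_on 1 U (vcderiv p c)" for p using Ck_on_le[OF v2] by simp
  have n1: "Ck_on 1 U (nab q u (vcderiv p c))" for p q
    using Ck_nab_le[OF U(1,3) u2 v2] by simp
  have sym: "nab q u (vcderiv p c) w = nab p u (vcderiv q c) w" if "w \<in> U" for p q w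
    using nab_sym[OF U(1) that U(3) u2] by (simp add: c_def)
  have du: "u differentiable (at w)" and dv: "vcderiv p c differentiable (at w)"
      and dn: "nab q u (vcderiv p c) differentiable (at w)" if "w \<in> U" for w p q
    using that u1 v1 n1 by (blast intro: C1_differentiable)+
  have first: "cderiv q (\<eta> p p') w = CG (u w) (nab q u (vcderiv p c) w) (vcderiv p' c w) + CG (u w) (vcderiv p c w) (nab q u (vcderiv p' c) w)"
    if "w \<in> U" for q p p' w
    unfolding \<eta>_def using that U(3) by (intro metric_compat du dv) auto
  have d: "(\<lambda>w. CG (u w) (nab q u (vcderiv p c) w) (vcderiv p' c w)) differentiable (at z)"
      "(\<lambda>w. CG (u w) (vcderiv p c w) (nab q u (vcderiv p' c) w)) differentiable (at z)" for q p p'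
    using Ck_CG[OF U(1,3) u1 n1 v1] Ck_CG[OF U(1,3) u1 v1 n1] U(2) by (blast intro: C1_differentiable)+
  have second: "cderiv r (cderiv q (\<eta> p p')) z =
      CG (u z) (nab r u (nab q u (vcderiv p c)) z) (vcderiv p' c z) + CG (u z) (A q p) (A r p')
      + (CG (u z) (A r p) (A q p') + CG (u z) (vcderiv p c z) (nab r u (nab q u (vcderiv p' c)) z))" for r q p p'
  proof -
    have "cderiv r (cderiv q (\<eta> p p')) z = cderiv r (\<lambda>w. CG (u w) (nab q u (vcderiv p c) w) (vcderiv p' c w)
        + CG (u w) (vcderiv p c w) (nab q u (vcderiv p' c) w)) z"
      by (rule cderiv_cong[OF U(1,2) first])
    then show ?thesis using U(2) uz by (simp add: cderiv_add d metric_compat du dv dn A_def)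
  qed
  have ncong: "nab r u (nab q u (vcderiv p c)) z = nab r u (nab p u (vcderiv q c)) z" for r p q
    by (rule nab_cong[OF U(1,2) sym])
  have curv: "nab p1 u (nab p2 u (vcderiv q c)) z = nab p2 u (nab p1 u (vcderiv q c)) z
     + Rm (u z) (vcderiv p1 c z) (vcderiv p2 c z) (vcderiv q c z)" for q
    using nab_curvature[OF U u2 v2, of p1 p2 q] by (simp add: c_def[symmetric] algebra_simps)
  \<comment> \<open>Normal form for third derivatives: \<open>p2\<close> outermost,
    \<open>p1\<close> next, and the remaining direction innermost. Only the two expressions in which
    \<open>p1\<close> stands outside pick up curvature.\<close>
  have e: "nab p1 u (nab q1 u (vcderiv p2 c)) z = nab p2 u (nab p1 u (vcderiv q1 c)) z
     + Rm (u z) (vcderiv p1 c z) (vcderiv p2 c z) (vcderiv q1 c z)"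
    "nab p1 u (nab q2 u (vcderiv p2 c)) z = nab p2 u (nab p1 u (vcderiv q2 c)) z
     + Rm (u z) (vcderiv p1 c z) (vcderiv p2 c z) (vcderiv q2 c z)"
    "nab p2 u (nab q1 u (vcderiv p1 c)) z = nab p2 u (nab p1 u (vcderiv q1 c)) z"
    "nab p2 u (nab q2 u (vcderiv p1 c)) z = nab p2 u (nab p1 u (vcderiv q2 c)) z"
    using ncong[of p1 q1 p2] ncong[of p1 q2 p2] ncong[of p2 q1 p1] ncong[of p2 q2 p1] curv by simp_all
  have Asym: "A q p = A p q" for p q unfolding A_def by (rule sym[OF U(2)])
  show ?thesis
    unfolding second e ncong[of p1 q2 q1] ncong[of p2 q2 q1] CG_simps
    using Rm_metric_antisym[OF uz, of "vcderiv p1 c z" "vcderiv p2 c z" "vcderiv q1 c z" "vcderiv q2 c z"]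
      CG_sym[OF uz, of "A q1 p2" "A q2 p1"] CG_sym[OF uz, of "A q2 p2" "A q1 p1"] Asym[of p2 p1] 
      CG_sym[OF uz, of "A q1 q2"] Asym[of q2 q1]
      Asym[of p1 q2] Asym[of p2 q1] Asym[of p1 q1] Asym[of p2 q2]
    by (simp add: algebra_simps)
qed

text \<open>The assumed parallelism removes two of the four terms, and since \<zeta> is parallel
  along \<open>p\<close>, its mixed second derivative is a pure commutator. It is meant for \<xi>
  the image of a holomorphic field, \<zeta> its conjugate, and conjugate directions \<open>p\<close>
  and \<open>q\<close>.\<close>

lemma energy_hessian:
  assumes U: "open U" "z \<in> U" "u ` U \<subseteq> V" and u: "Ck_on 2 U u"
    and \<xi>: "Ck_on 2 U \<xi>" and \<zeta>: "Ck_on 2 U \<zeta>"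
    and q\<xi>: "\<And>w. w \<in> U \<Longrightarrow> nab q u \<xi> w = 0" and p\<zeta>: "\<And>w. w \<in> U \<Longrightarrow> nab p u \<zeta> w = 0"
  defines "c \<equiv> \<lambda>w. cvec (u w)"
  shows "cderiv p (cderiv q (\<lambda>w. CG (u w) (\<xi> w) (\<zeta> w))) z
     = CG (u z) (nab p u \<xi> z) (nab q u \<zeta> z)
     + CG (u z) (\<xi> z) (Rm (u z) (vcderiv p c z) (vcderiv q c z) (\<zeta> z))"
proof -
  have uz: "u z \<in> V" using U by auto
  have 1: "Ck_on 1 U u" "Ck_on 1 U \<xi>" "Ck_on 1 U \<zeta>" using Ck_on_le[OF u] Ck_on_le[OF \<xi>] Ck_on_le[OF \<zeta>] by auto
  have n1: "Ck_on 1 U (nab q u \<zeta>)" using Ck_nab_le[OF U(1,3) u \<zeta>] by simp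
  have first: "cderiv q (\<lambda>w. CG (u w) (\<xi> w) (\<zeta> w)) w = CG (u w) (\<xi> w) (nab q u \<zeta> w)" if "w \<in> U" for w
    using metric_compat[of u w \<xi> \<zeta> q] that U(3) q\<xi>[OF that]
      C1_differentiable[OF 1(1) that] C1_differentiable[OF 1(2) that] C1_differentiable[OF 1(3) that]
    by (simp add: CG_simps image_subset_iff)
  have "cderiv p (cderiv q (\<lambda>w. CG (u w) (\<xi> w) (\<zeta> w))) z = cderiv p (\<lambda>w. CG (u w) (\<xi> w) (nab q u \<zeta> w)) z"
    by (rule cderiv_cong[OF U(1,2) first])
  also have "\<dots> = CG (u z) (nab p u \<xi> z) (nab q u \<zeta> z) + CG (u z) (\<xi> z) (nab p u (nab q u \<zeta>) z)"
    using 1 n1 U(2) uz by (intro metric_compat) (blast intro: C1_differentiable)+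
  also have "nab q u (nab p u \<zeta>) z = 0"
    using nab_cong[OF U(1,2), of "nab p u \<zeta>" "\<lambda>_. 0"] p\<zeta> by (simp add: nab_def Gam_simps vec_eq_iff)
  then have "nab p u (nab q u \<zeta>) z = Rm (u z) (vcderiv p c z) (vcderiv q c z) (\<zeta> z)"
    using nab_curvature[OF U u \<zeta>, of p q] by (simp add: c_def)
  finally show ?thesis .
qed

end

section \<open>Complex conjugation, positivity and the sign of the curvature terms\<close>

definition bar :: "'e \<times> 'e::uminus \<Rightarrow> 'e \<times> 'e" where
  "bar p = (fst p, - snd p)"

lemma bar_bar [simp]: "bar (bar p) = (p :: 'e \<times> 'e::group_add)"
  by (simp add: bar_def)

lemma cderiv_cnj_bar: "F differentiable (at z) \<Longrightarrow> cderiv p (\<lambda>w. cnj (F w)) z = cnj (cderiv (bar p) F z)"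
  by (simp add: cderiv_cnj bar_def)

lemma vcnj_nth [simp]: "vcnj X $ i = cnj (X $ i)" by (simp add: vcnj_def)

lemma vcnj_vcnj [simp]: "vcnj (vcnj X) = X" by (simp add: vec_eq_iff)

lemma vcnj_simps [simp]:
  "vcnj (X + Y) = vcnj X + vcnj Y" "vcnj (X - Y) = vcnj X - vcnj Y" "vcnj (a *s X) = cnj a *s vcnj X"
  "vcnj 0 = 0" "vcnj (cvec x) = cvec x"
  by (simp_all add: vec_eq_iff)

lemma vcderiv_vcnj: "\<xi> differentiable (at z) \<Longrightarrow> vcderiv p (\<lambda>w. vcnj (\<xi> w)) z = vcnj (vcderiv (bar p) \<xi> z)"
  by (simp add: vec_eq_iff cderiv_cnj_bar differentiable_vec_nth)

lemma bounded_linear_vcnj: "bounded_linear (vcnj :: complex^'n \<Rightarrow> complex^'n)"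
  by (intro linear_conv_bounded_linear[THEN iffD1] linearI) (simp_all add: vec_eq_iff)

lemma Ck_on_vcnj: "open S \<Longrightarrow> Ck_on k S \<xi> \<Longrightarrow> Ck_on k S (\<lambda>w. vcnj (\<xi> w))"
  by (rule Ck_on_linear_comp[OF _ bounded_linear_vcnj])

lemma cnj_bil: "cnj (bil c X Y) = bil (\<lambda>i j. cnj (c i j)) (vcnj X) (vcnj Y)"
  by (simp add: bil_def)

context riem
begin

lemma Gam_cnj: "vcnj (Gam y X Y) = Gam y (vcnj X) (vcnj Y)"
  by (simp add: Gam_def vec_eq_iff cnj_bil)

lemma dGam_cnj: "vcnj (dGam y W X Y) = dGam y (vcnj W) (vcnj X) (vcnj Y)"
  by (simp add: dGam_def vec_eq_iff cnj_bil)

lemma Rm_cnj: "vcnj (Rm y X Y Z) = Rm y (vcnj X) (vcnj Y) (vcnj Z)"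
  by (simp add: Rm_def Gam_cnj dGam_cnj)

lemma Re_CG_vcnj:
  "Re (CG y X (vcnj X)) = (\<Sum>i\<in>UNIV. \<Sum>j\<in>UNIV. G y $ i $ j * (\<chi> i. Re (X $ i)) $ i * (\<chi> i. Re (X $ i)) $ j)
    + (\<Sum>i\<in>UNIV. \<Sum>j\<in>UNIV. G y $ i $ j * (\<chi> i. Im (X $ i)) $ i * (\<chi> i. Im (X $ i)) $ j)"
  by (simp add: CG_def bil_def sum.distrib[symmetric] algebra_simps)

lemma CG_pos: assumes "y \<in> V" "X \<noteq> 0" shows "0 < Re (CG y X (vcnj X))"
proof -
  let ?Q = "\<lambda>v::real^'n. \<Sum>i\<in>UNIV. \<Sum>j\<in>UNIV. G y $ i $ j * v $ i * v $ j"
  have nn: "0 \<le> ?Q v" for v using pos[OF assms(1), of v] by (cases "v = 0") (auto simp: less_imp_le)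
  have "(\<chi> i. Re (X $ i)) \<noteq> (0::real^'n) \<or> (\<chi> i. Im (X $ i)) \<noteq> (0::real^'n)"
    using assms(2) by (auto simp: vec_eq_iff complex_eq_iff)
  then show ?thesis
    unfolding Re_CG_vcnj
    by (elim disjE) (blast intro: add_pos_nonneg add_nonneg_pos pos[OF assms(1)] nn)+
qed

lemma CG_nonneg: "y \<in> V \<Longrightarrow> 0 \<le> Re (CG y X (vcnj X))"
  using CG_pos[of y X] by (cases "X = 0") (auto simp: CG_simps)

text \<open>The Christoffel symbols and the map are real, so conjugating a section amounts to
  conjugating the direction.\<close>

lemma nab_vcnj:
  assumes "u differentiable (at z)" "\<xi> differentiable (at z)"
  shows "nab p u (\<lambda>w. vcnj (\<xi> w)) z = vcnj (nab (bar p) u \<xi> z)"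
proof -
  have "(\<lambda>w. cvec (u w)) differentiable (at z)"
    using bounded_linear.has_derivative[OF bounded_linear_cvec frechet_derivative_worksI[OF assms(1)]]
    by (auto simp: differentiable_def)
  from vcderiv_vcnj[OF this, of p] have "vcderiv p (\<lambda>w. cvec (u w)) z = vcnj (vcderiv (bar p) (\<lambda>w. cvec (u w)) z)"
    by simp
  then show ?thesis by (simp add: nab_def vcderiv_vcnj assms Gam_cnj del: vcderiv_nth)
qed

text \<open>A Hermitian matrix with vector entries whose trace against a positive definite Hermitian
  matrix vanishes has nonpositive determinant: complete the square after eliminating \<open>A11\<close>.\<close>

lemma traceless_det:
  assumes y: "y \<in> V" and p: "0 < p" and pq: "(cmod c)\<^sup>2 < p * q"
    and tr: "of_real p *s A11 + c *s A12 + cnj c *s A21 + of_real q *s A22 = 0"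
    and herm: "A21 = vcnj A12" "A22 = vcnj A22"
  shows "0 \<le> Re (CG y A12 A21 - CG y A11 A22)"
    and "Re (CG y A12 A21 - CG y A11 A22) \<le> 0 \<Longrightarrow> A12 = 0 \<and> A22 = 0 \<and> A11 = 0"
proof -
  \<comment> \<open>Solving the trace equation for \<open>A11\<close> makes \<open>p\<close> times
    the difference a quadratic form in \<open>A12\<close> and \<open>A22\<close>; \<open>B\<close>
    completes its square. What is left for \<open>A22\<close> has the coefficient
    \<open>q - (cmod c)\<^sup>2 / p\<close>, positive by \<open>pq\<close>.\<close>
  define B where "B = A12 + (cnj c / of_real p) *s A22"
  have vB: "vcnj B = A21 + (c / of_real p) *s A22" using herm by (simp add: B_def)
  have A11: "of_real p *s A11 = - (c *s A12 + cnj c *s A21 + of_real q *s A22)"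
    using tr by (simp add: add_eq_0_iff2 add.assoc)
  have cc: "c * cnj c = of_real ((cmod c)\<^sup>2)" by (rule complex_norm_square[symmetric])
  have "of_real p * CG y A11 A22 = - (c * CG y A12 A22 + cnj c * CG y A21 A22 + of_real q * CG y A22 A22)"
    using arg_cong[OF A11, of "\<lambda>X. CG y X A22"] by (simp add: CG_simps)
  then have "of_real p * (CG y A12 A21 - CG y A11 A22)
      = of_real p * CG y A12 A21 + (c * CG y A12 A22 + cnj c * CG y A21 A22 + of_real q * CG y A22 A22)"
    by (simp add: algebra_simps)
  also have "\<dots> = of_real p * CG y B (vcnj B) + (of_real q - c * cnj c / of_real p) * CG y A22 A22"
    using p CG_sym[OF y, of A22 A21] unfolding vB unfolding B_def
    by (simp add: CG_simps field_simps)
  also have "\<dots> = of_real p * CG y B (vcnj B) + of_real (q - (cmod c)\<^sup>2 / p) * CG y A22 (vcnj A22)"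
    using herm(2) by (simp add: cc)
  finally have *: "of_real p * (CG y A12 A21 - CG y A11 A22)
     = of_real p * CG y B (vcnj B) + of_real (q - (cmod c)\<^sup>2 / p) * CG y A22 (vcnj A22)" .
  have *: "p * Re (CG y A12 A21 - CG y A11 A22)
     = p * Re (CG y B (vcnj B)) + (q - (cmod c)\<^sup>2 / p) * Re (CG y A22 (vcnj A22))"
    using arg_cong[OF *, of Re] by simp
  have k: "0 < q - (cmod c)\<^sup>2 / p" using p pq by (simp add: field_simps)
  have n: "0 \<le> Re (CG y B (vcnj B))" "0 \<le> Re (CG y A22 (vcnj A22))" by (rule CG_nonneg[OF y])+
  have "0 \<le> p * Re (CG y A12 A21 - CG y A11 A22)"
    unfolding * using n k p by simp
  then show "0 \<le> Re (CG y A12 A21 - CG y A11 A22)" using p by (simp add: zero_le_mult_iff)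
  assume "Re (CG y A12 A21 - CG y A11 A22) \<le> 0"
  then have "p * Re (CG y A12 A21 - CG y A11 A22) \<le> 0" using p by (simp add: mult_le_0_iff)
  then have "p * Re (CG y B (vcnj B)) + (q - (cmod c)\<^sup>2 / p) * Re (CG y A22 (vcnj A22)) \<le> 0" unfolding * .
  moreover have "0 \<le> p * Re (CG y B (vcnj B))" "0 \<le> (q - (cmod c)\<^sup>2 / p) * Re (CG y A22 (vcnj A22))"
    using n p k by simp_all
  ultimately have "p * Re (CG y B (vcnj B)) = 0" "(q - (cmod c)\<^sup>2 / p) * Re (CG y A22 (vcnj A22)) = 0"
    by linarith+
  then have "Re (CG y B (vcnj B)) = 0" "Re (CG y A22 (vcnj A22)) = 0" using p k by auto
  then have z: "B = 0" "A22 = 0" using CG_pos[OF y] by (metis less_irrefl)+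
  then have "A12 = 0" by (simp add: B_def)
  moreover have "A11 = 0" using A11 z(2) \<open>A12 = 0\<close> herm p by (simp add: vec_eq_iff)
  ultimately show "A12 = 0 \<and> A22 = 0 \<and> A11 = 0" using z by simp
qed

definition nonpos_at :: "real^'n \<Rightarrow> bool" where
  "nonpos_at y \<longleftrightarrow> (\<forall>Z W. Re (riemann_complex G y Z (vcnj W) W (vcnj Z)) \<le> 0)"

text \<open>For conjugate pairs of directions the matrix of Hessian vectors is Hermitian, so the
  trace equation and \<open>traceless_det\<close> make the determinant part of
  \<open>theta_formula\<close> nonnegative; the curvature part is minus a value covered by
  \<open>nonpos_at\<close>. Since neither part can be negative, a nonpositive sum forces the Hessian
  vectors to vanish.\<close>

lemma theta_nonneg:
  fixes u :: "'e::real_normed_vector \<Rightarrow> real^'n" and p1 p2 :: "'e \<times> 'e"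
  assumes U: "open U" "z \<in> U" "u ` U \<subseteq> V" and u: "Ck_on 3 U u" and np: "nonpos_at (u z)"
  defines "c \<equiv> \<lambda>w. cvec (u w)"
  defines "\<eta> \<equiv> \<lambda>p q w. CG (u w) (vcderiv p c w) (vcderiv q c w)"
  defines "A \<equiv> \<lambda>q p. nab q u (vcderiv p c) z"
  defines "\<Theta> \<equiv> cderiv p1 (cderiv (bar p1) (\<eta> p2 (bar p2))) z + cderiv p2 (cderiv (bar p2) (\<eta> p1 (bar p1))) z
       - cderiv p1 (cderiv (bar p2) (\<eta> p2 (bar p1))) z - cderiv p2 (cderiv (bar p1) (\<eta> p1 (bar p2))) z"
  assumes p: "0 < k11" and pq: "(cmod k12)\<^sup>2 < k11 * k22"
    and tr: "of_real k11 *s A (bar p1) p1 + k12 *s A (bar p2) p1 + cnj k12 *s A (bar p1) p2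
       + of_real k22 *s A (bar p2) p2 = 0"
  shows "0 \<le> Re \<Theta>" and "Re \<Theta> \<le> 0 \<Longrightarrow>
     A (bar p1) p1 = 0 \<and> A (bar p2) p1 = 0 \<and> A (bar p1) p2 = 0 \<and> A (bar p2) p2 = 0"
proof -
  have uz: "u z \<in> V" using U by auto
  have c3: "Ck_on 3 U c" unfolding c_def by (rule Ck_on_cvec[OF U(1) u])
  have u2: "Ck_on 2 U u" using Ck_on_le[OF u] by auto
  have du: "u differentiable (at w)" if "w \<in> U" for w using Ck_on_differentiable[OF u that] by simp
  have dc: "c differentiable (at w)" if "w \<in> U" for w using Ck_on_differentiable[OF c3 that] by simp
  have dv: "vcderiv p c differentiable (at w)" if "w \<in> U" for p w
    using Ck_on_differentiable[OF Ck_on_vcderiv_le[OF U(1) c3, of 1] that] by simp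
  have cc: "vcnj (c w) = c w" for w by (simp add: c_def)
  have bar_vcderiv: "vcderiv (bar p) c w = vcnj (vcderiv p c w)" if "w \<in> U" for p w
    using vcderiv_vcnj[OF dc[OF that], of "bar p"] by (simp add: cc del: vcderiv_nth)
  \<comment> \<open>Hermitian symmetry has two sources: reality of the connection moves the
    conjugation to the directions, and \<open>nab_sym\<close> exchanges their order.\<close>
  have Acnj: "vcnj (A q p) = A (bar p) (bar q)" for p q
  proof -
    have "vcnj (A q p) = nab (bar q) u (\<lambda>w. vcnj (vcderiv p c w)) z"
      using nab_vcnj[OF du[OF U(2)] dv[OF U(2)], of "bar q" p] by (simp add: A_def)
    also have "\<dots> = nab (bar q) u (vcderiv (bar p) c) z"
      by (rule nab_cong[OF U(1,2)]) (simp add: bar_vcderiv del: vcderiv_nth)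
    also have "\<dots> = A (bar p) (bar q)"
      using nab_sym[OF U u2, of "bar q" "bar p"] by (simp add: A_def c_def)
    finally show ?thesis .
  qed
  let ?f1 = "vcderiv p1 c z" and ?f2 = "vcderiv p2 c z"
  \<comment> \<open>The curvature hypothesis is taken at \<open>Z\<close> equal to the first
    derivative and \<open>W\<close> equal to the conjugate of the second one.\<close>
  have "Re (riemann_complex G (u z) ?f1 (vcnj (vcnj ?f2)) (vcnj ?f2) (vcnj ?f1)) \<le> 0"
    using np unfolding nonpos_at_def by blast
  then have R: "0 \<le> Re (CG (u z) (Rm (u z) ?f1 ?f2 (vcnj ?f1)) (vcnj ?f2))"
    using Rm_metric_antisym[OF uz, of ?f1 ?f2 "vcnj ?f1" "vcnj ?f2"] by (simp add: riemann_complex_eq[OF uz])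
  have \<Theta>: "\<Theta> = 2 * (CG (u z) (A (bar p2) p1) (A (bar p1) p2) - CG (u z) (A (bar p1) p1) (A (bar p2) p2))
     + 2 * CG (u z) (Rm (u z) ?f1 ?f2 (vcnj ?f1)) (vcnj ?f2)"
    using theta_formula[OF U u, of p1 "bar p1" p2 "bar p2"] CG_sym[OF uz, of "A (bar p1) p2"]
      bar_vcderiv[OF U(2)]
    unfolding \<Theta>_def \<eta>_def A_def c_def by (simp del: vcderiv_nth)
  have herm: "A (bar p1) p2 = vcnj (A (bar p2) p1)" "A (bar p2) p2 = vcnj (A (bar p2) p2)"
    by (simp_all add: Acnj)
  note T = traceless_det[OF uz p pq tr herm]
  have Re\<Theta>: "Re \<Theta> = 2 * Re (CG (u z) (A (bar p2) p1) (A (bar p1) p2) - CG (u z) (A (bar p1) p1) (A (bar p2) p2))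
     + 2 * Re (CG (u z) (Rm (u z) ?f1 ?f2 (vcnj ?f1)) (vcnj ?f2))"
    unfolding \<Theta> by simp
  show "0 \<le> Re \<Theta>" unfolding Re\<Theta> using T(1) R by linarith
  assume "Re \<Theta> \<le> 0"
  then have "Re (CG (u z) (A (bar p2) p1) (A (bar p1) p2) - CG (u z) (A (bar p1) p1) (A (bar p2) p2)) \<le> 0"
    unfolding Re\<Theta> using R by linarith
  from T(2)[OF this] herm(1) show "A (bar p1) p1 = 0 \<and> A (bar p2) p1 = 0 \<and> A (bar p1) p2 = 0 \<and> A (bar p2) p2 = 0"
    by simp
qed

text \<open>For a pluriharmonic map the hypothesis holds with \<open>X\<close>, \<open>W\<close> the derivatives of the map in two holomorphic
  directions; the first Bianchi identity then turns the term into a complex sectional curvature.\<close>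

lemma pluriharmonic_curvature_sign:
  assumes y: "y \<in> V" and np: "nonpos_at y" and z: "Rm y X W (vcnj X) = 0"
  shows "0 \<le> Re (CG y W (Rm y X (vcnj X) (vcnj W)))"
proof -
  have z': "Rm y (vcnj X) (vcnj W) X = 0"
    using arg_cong[OF z, of vcnj] by (simp add: Rm_cnj)
  have "Rm y X (vcnj X) (vcnj W) + Rm y (vcnj X) (vcnj W) X + Rm y (vcnj W) X (vcnj X) = 0"
    by (rule Bianchi[OF y])
  then have "Rm y X (vcnj X) (vcnj W) = Rm y X (vcnj W) (vcnj X)"
    using Rm_antisym[of y "vcnj W" X] by (simp add: z' add_eq_0_iff2)
  then have "CG y W (Rm y X (vcnj X) (vcnj W)) = - CG y (Rm y X (vcnj W) W) (vcnj X)"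
    using Rm_metric_antisym[OF y, of X "vcnj W" "vcnj X" W] CG_sym[OF y, of W] by simp
  moreover have "Re (riemann_complex G y X (vcnj W) W (vcnj X)) \<le> 0"
    using np unfolding nonpos_at_def by blast
  ultimately show ?thesis by (simp add: riemann_complex_eq[OF y])
qed

end

text \<open>\<open>wz u\<close> is the direction \<open>\<Sum> u\<^sup>\<alpha> \<partial>/\<partial>z\<^sup>\<alpha>\<close>, so \<open>bar (wz u)\<close> is its conjugate.\<close>

definition wz :: "complex^'m \<Rightarrow> (complex^'m) \<times> (complex^'m)" where
  "wz u = ((1/2) *\<^sub>R u, - ((1/2) *\<^sub>R (\<i> *s u)))"

definition complex_linear :: "(complex^'m \<Rightarrow> complex^'k) \<Rightarrow> bool" where
  "complex_linear L \<longleftrightarrow> (\<forall>a v. L (a *s v) = a *s L v)"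

lemma cderiv_wz_axis:
  assumes "F differentiable (at z)"
  shows "cderiv (wz (axis \<alpha> 1)) F z = dz \<alpha> F z" "cderiv (bar (wz (axis \<alpha> 1))) F z = dzbar \<alpha> F z"
proof -
  have l: "linear (frechet_derivative F (at z))" by (rule linear_frechet_derivative[OF assms])
  have "\<i> *s axis \<alpha> 1 = (axis \<alpha> \<i> :: complex^'a)" by (simp add: vec_eq_iff axis_def)
  then show "cderiv (wz (axis \<alpha> 1)) F z = dz \<alpha> F z" "cderiv (bar (wz (axis \<alpha> 1))) F z = dzbar \<alpha> F z"
    by (simp_all add: cderiv_def wz_def bar_def dz_def dzbar_def linear_neg[OF l] linear_scale[OF l] scaleR_conv_of_real[where 'a=complex] field_simps)
qed

lemma linear_complex_coordinates:
  fixes L :: "complex^'m \<Rightarrow> 'b::real_vector"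
  assumes "linear L"
  shows "L v = (\<Sum>k\<in>UNIV. Re (v $ k) *\<^sub>R L (axis k 1) + Im (v $ k) *\<^sub>R L (axis k \<i>))"
proof -
  have "Re (v $ k) *\<^sub>R axis k 1 + Im (v $ k) *\<^sub>R axis k \<i> = axis k (v $ k)" for k
    by (simp add: vec_eq_iff axis_def complex_eq_iff)
  then have "v = (\<Sum>k\<in>UNIV. Re (v $ k) *\<^sub>R axis k 1 + Im (v $ k) *\<^sub>R axis k \<i>)"
    by (simp add: vec_eq_iff axis_def)
  then have "L v = L (\<Sum>k\<in>UNIV. Re (v $ k) *\<^sub>R axis k 1 + Im (v $ k) *\<^sub>R axis k \<i>)" by simp
  then show ?thesis using assms by (simp add: linear_sum linear_scale linear_add)
qed

text \<open>Real differentiability is enough: \<open>wz\<close> singles out the complex linear part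
  of the differential and its conjugate the antilinear part, whence the coefficients
  \<open>u $ k\<close> and \<open>cnj (u $ k)\<close>.\<close>

lemma cderiv_wz_sum:
  assumes "F differentiable (at z)"
  shows "cderiv (wz u) F z = (\<Sum>k\<in>UNIV. u $ k * cderiv (wz (axis k 1)) F z)"
    "cderiv (bar (wz u)) F z = (\<Sum>k\<in>UNIV. cnj (u $ k) * cderiv (bar (wz (axis k 1))) F z)"
proof -
  let ?L = "frechet_derivative F (at z)"
  have l: "linear ?L" by (rule linear_frechet_derivative[OF assms])
  have ax: "\<i> *s axis k 1 = (axis k \<i> :: complex^'a)" for k by (simp add: vec_eq_iff axis_def)
  note e = linear_complex_coordinates[OF l, of u] linear_complex_coordinates[OF l, of "\<i> *s u"]
  have c: "complex_of_real (Re a) + \<i> * complex_of_real (Im a) = a" "complex_of_real (Re a) - \<i> * complex_of_real (Im a) = cnj a" for a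
    by (simp_all add: complex_eq_iff)
  have 1: "?L u - \<i> * ?L (\<i> *s u) = (\<Sum>k\<in>UNIV. u $ k * (?L (axis k 1) - \<i> * ?L (axis k \<i>)))"
    unfolding e sum_distrib_left sum_subtractf[symmetric]
    by (intro sum.cong refl) (subst (3 4) c(1)[symmetric], simp add: scaleR_conv_of_real[where 'a=complex] algebra_simps)
  have 2: "?L u + \<i> * ?L (\<i> *s u) = (\<Sum>k\<in>UNIV. cnj (u $ k) * (?L (axis k 1) + \<i> * ?L (axis k \<i>)))"
    unfolding e sum_distrib_left sum.distrib[symmetric]
    by (intro sum.cong refl) (simp add: c(2)[symmetric] scaleR_conv_of_real[where 'a=complex] algebra_simps)
  have h: "cderiv (wz v) F z = (?L v - \<i> * ?L (\<i> *s v)) / 2" "cderiv (bar (wz v)) F z = (?L v + \<i> * ?L (\<i> *s v)) / 2" for v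
    by (simp_all add: cderiv_def wz_def bar_def linear_neg[OF l] linear_scale[OF l] scaleR_conv_of_real[where 'a=complex] field_simps)
  show "cderiv (wz u) F z = (\<Sum>k\<in>UNIV. u $ k * cderiv (wz (axis k 1)) F z)"
    "cderiv (bar (wz u)) F z = (\<Sum>k\<in>UNIV. cnj (u $ k) * cderiv (bar (wz (axis k 1))) F z)"
    unfolding h ax 1 2 by (simp_all add: sum_divide_distrib)
qed

lemma vcderiv_wz_sum:
  assumes "\<xi> differentiable (at z)"
  shows "vcderiv (wz u) \<xi> z = (\<Sum>k\<in>UNIV. u $ k *s vcderiv (wz (axis k 1)) \<xi> z)"
    "vcderiv (bar (wz u)) \<xi> z = (\<Sum>k\<in>UNIV. cnj (u $ k) *s vcderiv (bar (wz (axis k 1))) \<xi> z)"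
  unfolding vec_eq_iff
  by (simp_all add: cderiv_wz_sum[OF differentiable_vec_nth[OF assms], where u=u])

text \<open>A complex linear derivative commutes with multiplication by \<open>\<i>\<close> and
  therefore preserves the type of a direction.\<close>

lemma cderiv_holomorphic_compose:
  assumes "g differentiable (at (\<phi> z))" "(\<phi> has_derivative \<phi>') (at z)" "complex_linear \<phi>'"
  shows "cderiv (wz u) (\<lambda>w. g (\<phi> w)) z = cderiv (wz (\<phi>' u)) g (\<phi> z)"
    "cderiv (bar (wz u)) (\<lambda>w. g (\<phi> w)) z = cderiv (bar (wz (\<phi>' u))) g (\<phi> z)"
proof -
  have d: "((\<lambda>w. g (\<phi> w)) has_derivative (\<lambda>v. frechet_derivative g (at (\<phi> z)) (\<phi>' v))) (at z)"
    using has_derivative_compose[OF assms(2) frechet_derivative_worksI[OF assms(1)]] .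
  have l: "linear \<phi>'" using assms(2) has_derivative_linear by blast
  show "cderiv (wz u) (\<lambda>w. g (\<phi> w)) z = cderiv (wz (\<phi>' u)) g (\<phi> z)"
    "cderiv (bar (wz u)) (\<lambda>w. g (\<phi> w)) z = cderiv (bar (wz (\<phi>' u))) g (\<phi> z)"
    using assms(3) unfolding cderiv_eqI[OF d]
    by (simp_all add: cderiv_def wz_def bar_def linear_neg[OF l] linear_scale[OF l] complex_linear_def)
qed

lemma dzbar_holomorphic:
  assumes "(F has_derivative F') (at z)" "\<And>a v. F' (a *s v) = a * F' v"
  shows "cderiv (bar (wz u)) F z = 0" "cderiv (wz u) F z = F' u"
proof -
  have l: "linear F'" using assms(1) has_derivative_linear by blast
  show "cderiv (bar (wz u)) F z = 0" "cderiv (wz u) F z = F' u"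
    by (simp_all add: cderiv_eqI[OF assms(1)] wz_def bar_def linear_neg[OF l] linear_scale[OF l] assms(2) scaleR_conv_of_real[where 'a=complex])
qed

section \<open>Holomorphic functions of several variables are smooth\<close>

lemma bounded_linear_smult_vec: "bounded_linear (\<lambda>t::complex. t *s (v::complex^'m))"
  by (intro linear_conv_bounded_linear[THEN iffD1] linearI)
    (simp_all add: vec_eq_iff algebra_simps)

text \<open>Cauchy's formula on a circle in the complex line through \<open>z\<close> in direction
  \<open>v\<close> writes \<open>F' z v\<close> as an integral of values of \<open>F\<close>, which
  can be differentiated in \<open>z\<close>. Transition maps are only assumed complex
  differentiable, while derivatives of higher order are needed.\<close>

lemma has_derivative_holomorphic_directional:
  fixes F :: "complex^'m \<Rightarrow> complex"
  assumes S: "open S" and F: "\<And>z. z \<in> S \<Longrightarrow> (F has_derivative F' z) (at z)"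
    and lin: "\<And>z a v. z \<in> S \<Longrightarrow> F' z (a *s v) = a * F' z v"
    and z0: "z0 \<in> S"
  shows "\<exists>L. ((\<lambda>z. F' z v) has_derivative L) (at z0) \<and> (\<forall>a w. L (a *s w) = a * L w)"
proof -
  have contF: "continuous_on S F"
    using F has_derivative_continuous by (blast intro: continuous_at_imp_continuous_on)
  have "\<exists>\<delta> \<rho>. 0 < \<delta> \<and> 0 < \<rho> \<and> (\<forall>z t. z \<in> ball x \<delta> \<longrightarrow> cmod t \<le> \<rho> \<longrightarrow> z + t *s v \<in> S)" if "x \<in> S" for x v
  proof -
    obtain e where e: "e > 0" "ball x e \<subseteq> S" using S \<open>x \<in> S\<close> openE by blast
    obtain B where B: "B > 0" "\<And>t. norm (t *s v) \<le> cmod t * B"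
      using bounded_linear.pos_bounded[OF bounded_linear_smult_vec] by blast
    have "z + t *s v \<in> S" if "z \<in> ball x (e / 2)" "cmod t \<le> e / (2 * B)" for z t
    proof -
      have "norm (t *s v) \<le> e / 2"
        using order_trans[OF B(2) mult_right_mono[OF that(2)]] B(1) by (simp add: field_simps)
      moreover have "norm (z - x) < e / 2" using that(1) by (simp add: dist_norm norm_minus_commute)
      ultimately have "norm ((z - x) + t *s v) < e" using norm_triangle_ineq[of "z - x" "t *s v"] by linarith
      then have "z + t *s v \<in> ball x e"
        using norm_minus_commute[of x "z + t *s v"] by (simp add: dist_norm algebra_simps)
      then show ?thesis using e(2) by blast
    qed
    then show ?thesis using e(1) B(1) by (intro exI[of _ "e/2"] exI[of _ "e / (2*B)"]) auto
  qed
  note nbhd = this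
  \<comment> \<open>The circle of radius \<rho> over the unit interval. Cauchy's kernel for the
    derivative contributes the inverse square of \<open>\<gamma> \<rho> s\<close> and the velocity
    contributes \<open>2 * pi * \<i>\<close> times \<open>\<gamma> \<rho> s\<close>; division by
    \<open>\<gamma> \<rho> s\<close> remains.\<close>
  define \<gamma> :: "real \<Rightarrow> real \<Rightarrow> complex" where "\<gamma> \<rho> s = of_real \<rho> * exp (2 * of_real pi * \<i> * of_real s)" for \<rho> s
  have \<gamma>_norm: "cmod (\<gamma> \<rho> s) = \<rho>" if "\<rho> > 0" for \<rho> s
    using that by (simp add: \<gamma>_def norm_mult norm_exp_eq_Re)
  have \<gamma>_nz: "\<gamma> \<rho> s \<noteq> 0" if "\<rho> > 0" for \<rho> s using that by (simp add: \<gamma>_def)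
  have Cauchy: "F' z v = integral (cbox 0 1) (\<lambda>s. F (z + \<gamma> \<rho> s *s v) / \<gamma> \<rho> s)"
    if \<rho>: "0 < \<rho>" and sub: "\<And>t. cmod t \<le> \<rho> \<Longrightarrow> z + t *s v \<in> S" for z v \<rho>
  proof -
    let ?h = "\<lambda>t. F (z + t *s v)"
    have der: "(?h has_field_derivative F' (z + t *s v) v) (at t)" if "cmod t \<le> \<rho>" for t
    proof -
      have "((\<lambda>t. z + t *s v) has_derivative (\<lambda>t. t *s v)) (at t)"
        using bounded_linear_imp_has_derivative[OF bounded_linear_smult_vec] by (auto intro!: derivative_eq_intros)
      from has_derivative_compose[OF this F[OF sub[OF that]]]
      show ?thesis using lin[OF sub[OF that]] by (simp add: has_field_derivative_def mult_commute_abs)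
    qed
    have c: "continuous_on (cball 0 \<rho>) ?h"
      by (intro continuous_at_imp_continuous_on ballI DERIV_isCont) (use der in auto)
    have hol: "?h holomorphic_on ball 0 \<rho>"
    proof (rule holomorphic_onI)
      fix t :: complex assume "t \<in> ball 0 \<rho>"
      then have "(?h has_field_derivative F' (z + t *s v) v) (at t)" using der[of t] by simp
      then show "?h field_differentiable at t within ball 0 \<rho>"
        unfolding field_differentiable_def by (blast intro: has_field_derivative_at_within)
    qed
    have "(?h has_field_derivative (1/(2 * of_real pi * \<i>) * contour_integral (circlepath 0 \<rho>) (\<lambda>u. ?h u / (u - 0)^2))) (at 0)"
      using Cauchy_derivative_integral_circlepath[OF c hol, of 0] \<rho> by simp
    from DERIV_unique[OF this der[of 0]] \<rho>
    have "F' z v = 1/(2 * of_real pi * \<i>) * contour_integral (circlepath 0 \<rho>) (\<lambda>u. ?h u / (u - 0)^2)" by simp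
    also have "contour_integral (circlepath 0 \<rho>) (\<lambda>u. ?h u / (u - 0)^2)
      = integral {0..1} (\<lambda>s. (2 * of_real pi * \<i>) * (F (z + \<gamma> \<rho> s *s v) / \<gamma> \<rho> s))"
      unfolding contour_integral_integral
    proof (rule integral_cong)
      fix s
      have "circlepath 0 \<rho> s = \<gamma> \<rho> s" by (simp add: circlepath \<gamma>_def)
      then show "?h (circlepath 0 \<rho> s) / (circlepath 0 \<rho> s - 0)\<^sup>2 * vector_derivative (circlepath 0 \<rho>) (at s)
        = (2 * of_real pi * \<i>) * (F (z + \<gamma> \<rho> s *s v) / \<gamma> \<rho> s)"
        using \<rho> by (simp add: vector_derivative_circlepath \<gamma>_def power2_eq_square)
    qed
    also have "\<dots> = (2 * of_real pi * \<i>) * integral {0..1} (\<lambda>s. F (z + \<gamma> \<rho> s *s v) / \<gamma> \<rho> s)"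
      by (rule integral_mult_right)
    finally show ?thesis by simp
  qed
  have cont\<gamma>: "continuous_on X (\<lambda>p. \<gamma> \<rho> (f p))" if "continuous_on X f" for X :: "'x::topological_space set" and f \<rho>
    unfolding \<gamma>_def using that by (intro continuous_intros)
  have cont_smult: "continuous_on X (\<lambda>p. g p *s w)" if "continuous_on X g" for X :: "'x::topological_space set" and g and w :: "complex^'m"
    using bounded_linear.continuous_on[OF bounded_linear_smult_vec that] .
  \<comment> \<open>Cauchy's formula contains only values of the continuous function
    \<open>F\<close>, so it gives continuity of the derivative in the base point. Differentiation
    under the integral sign relies on this.\<close>
  have contF': "continuous_on S (\<lambda>z. F' z w)" for w
  proof -
    have "isCont (\<lambda>z. F' z w) x" if "x \<in> S" for x
    proof -
      obtain \<delta> \<rho> where \<delta>: "0 < \<delta>" "0 < \<rho>" "\<And>z t. z \<in> ball x \<delta> \<Longrightarrow> cmod t \<le> \<rho> \<Longrightarrow> z + t *s w \<in> S"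
        using nbhd[OF \<open>x \<in> S\<close>, of w] by blast
      have "continuous_on (ball x \<delta> \<times> cbox 0 1) (\<lambda>p. F (fst p + \<gamma> \<rho> (snd p) *s w) / \<gamma> \<rho> (snd p))"
        using \<delta> by (intro continuous_intros continuous_on_compose2[OF contF] cont\<gamma> cont_smult)
          (auto simp: \<gamma>_norm \<gamma>_nz)
      then have "continuous_on (ball x \<delta>) (\<lambda>z. integral (cbox 0 1) (\<lambda>s. F (z + \<gamma> \<rho> s *s w) / \<gamma> \<rho> s))"
        by (intro integral_continuous_on_param) (simp add: case_prod_unfold)
      moreover have "integral (cbox 0 1) (\<lambda>s. F (z + \<gamma> \<rho> s *s w) / \<gamma> \<rho> s) = F' z w" if "z \<in> ball x \<delta>" for z
        using Cauchy[OF \<delta>(2) \<delta>(3)[OF that]] by simp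
      ultimately have "continuous_on (ball x \<delta>) (\<lambda>z. F' z w)"
        by (rule continuous_on_eq)
      then show ?thesis using \<delta>(1) by (simp add: continuous_on_eq_continuous_at)
    qed
    then show ?thesis by (blast intro: continuous_at_imp_continuous_on)
  qed
  obtain \<delta> \<rho> where \<delta>: "0 < \<delta>" "0 < \<rho>" "\<And>z t. z \<in> ball z0 \<delta> \<Longrightarrow> cmod t \<le> \<rho> \<Longrightarrow> z + t *s v \<in> S"
    using nbhd[OF z0, of v] by blast
  \<comment> \<open>The Leibniz rule asks for the derivative of the integrand as a bounded linear
    map depending continuously on the parameters; continuity is then checked on single
    vectors.\<close>
  define fx where "fx z s = Blinfun (\<lambda>w. F' (z + \<gamma> \<rho> s *s v) w / \<gamma> \<rho> s)" for z s
  have inS: "z + \<gamma> \<rho> s *s v \<in> S" if "z \<in> ball z0 \<delta>" for z s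
    using \<delta>(3)[OF that, of "\<gamma> \<rho> s"] \<gamma>_norm[OF \<delta>(2)] by simp
  have fx: "blinfun_apply (fx z s) = (\<lambda>w. F' (z + \<gamma> \<rho> s *s v) w / \<gamma> \<rho> s)" if "z \<in> ball z0 \<delta>" for z s
    unfolding fx_def
    by (intro bounded_linear_Blinfun_apply bounded_linear_divide[THEN bounded_linear_compose]
        has_derivative_bounded_linear[OF F] inS that)
  have cfx: "continuous_on (ball z0 \<delta> \<times> cbox 0 1) (\<lambda>(z, s). fx z s)"
  proof (rule continuous_on_blinfun_componentwise)
    fix i :: "complex^'m"
    have "continuous_on (ball z0 \<delta> \<times> cbox 0 1) (\<lambda>p. F' (fst p + \<gamma> \<rho> (snd p) *s v) i / \<gamma> \<rho> (snd p))"
      using \<delta>(2) inS by (intro continuous_intros continuous_on_compose2[OF contF'] cont\<gamma> cont_smult)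
        (auto simp: \<gamma>_nz)
    then show "continuous_on (ball z0 \<delta> \<times> cbox 0 1) (\<lambda>x. blinfun_apply (case x of (z, s) \<Rightarrow> fx z s) i)"
      by (rule continuous_on_eq) (auto simp: fx)
  qed
  have "((\<lambda>z. integral (cbox 0 1) (\<lambda>s. F (z + \<gamma> \<rho> s *s v) / \<gamma> \<rho> s)) has_derivative
     blinfun_apply (integral (cbox 0 1) (fx z0))) (at z0 within ball z0 \<delta>)"
  proof (rule leibniz_rule[where fx=fx])
    fix z and s :: real assume z: "z \<in> ball z0 \<delta>"
    have "((\<lambda>z. z + \<gamma> \<rho> s *s v) has_derivative (\<lambda>w. w)) (at z)" by (auto intro!: derivative_eq_intros)
    from has_derivative_compose[OF this F[OF inS[OF z]]]
    have "((\<lambda>z. F (z + \<gamma> \<rho> s *s v) / \<gamma> \<rho> s) has_derivative (\<lambda>w. F' (z + \<gamma> \<rho> s *s v) w / \<gamma> \<rho> s)) (at z)"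
      by (rule bounded_linear.has_derivative[OF bounded_linear_divide])
    then show "((\<lambda>z. F (z + \<gamma> \<rho> s *s v) / \<gamma> \<rho> s) has_derivative blinfun_apply (fx z s)) (at z within ball z0 \<delta>)"
      by (simp add: fx[OF z] has_derivative_at_withinI)
  next
    fix z assume z: "z \<in> ball z0 \<delta>"
    have "continuous_on (cbox 0 1) (\<lambda>s. F (z + \<gamma> \<rho> s *s v) / \<gamma> \<rho> s)"
      using \<delta>(2) inS[OF z] by (intro continuous_intros continuous_on_compose2[OF contF] cont\<gamma> cont_smult)
        (auto simp: \<gamma>_nz)
    then show "(\<lambda>s. F (z + \<gamma> \<rho> s *s v) / \<gamma> \<rho> s) integrable_on cbox 0 1" by (rule integrable_continuous)
  qed (use cfx \<delta>(1) in auto)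
  then have "((\<lambda>z. F' z v) has_derivative blinfun_apply (integral (cbox 0 1) (fx z0))) (at z0 within ball z0 \<delta>)"
    by (rule has_derivative_transform[rotated 2]) (use \<delta> Cauchy in auto)
  then have L: "((\<lambda>z. F' z v) has_derivative blinfun_apply (integral (cbox 0 1) (fx z0))) (at z0)"
    using \<delta>(1) by (simp add: at_within_open[of z0 "ball z0 \<delta>"])
  have "continuous_on (cbox 0 1) (fx z0)"
  proof -
    have "continuous_on (cbox (0::real) 1) (\<lambda>s. (z0, s))" by (intro continuous_intros)
    from continuous_on_compose2[OF cfx this] \<delta>(1) show ?thesis by (simp add: image_subset_iff)
  qed
  then have int: "fx z0 integrable_on cbox 0 1" by (rule integrable_continuous)
  have "blinfun_apply (integral (cbox 0 1) (fx z0)) (a *s w) = a * blinfun_apply (integral (cbox 0 1) (fx z0)) w" for a w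
    unfolding blinfun_apply_integral[OF int] integral_mult_right[symmetric]
    using \<delta>(1) lin[OF inS] by (intro integral_cong) (simp add: fx)
  with L show ?thesis by blast
qed

text \<open>Every directional derivative satisfies the hypothesis on \<open>F\<close> again, so the
  induction generalises over \<open>F\<close>.\<close>

lemma holomorphic_imp_Ck_on:
  fixes F :: "complex^'m \<Rightarrow> complex"
  assumes S: "open S" and F: "\<And>z. z \<in> S \<Longrightarrow> \<exists>L. (F has_derivative L) (at z) \<and> (\<forall>a v. L (a *s v) = a * L v)"
  shows "Ck_on k S F"
  using F
proof (induction k arbitrary: F)
  case 0
  then show ?case
    using has_derivative_continuous by (fastforce intro: continuous_at_imp_continuous_on)
next
  case (Suc k)
  have d: "(F has_derivative frechet_derivative F (at z)) (at z)" if "z \<in> S" for z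
    using Suc.prems[OF that] by (auto intro!: frechet_derivative_worksI simp: differentiable_def)
  have l: "frechet_derivative F (at z) (a *s v) = a * frechet_derivative F (at z) v" if "z \<in> S" for z a v
    using Suc.prems[OF that] frechet_derivative_at by metis
  have "Ck_on k S (\<lambda>z. frechet_derivative F (at z) v)" for v
    by (rule Suc.IH) (rule has_derivative_holomorphic_directional[OF S d l])
  then show ?case using d by (auto simp: Ck_on.simps(2) differentiable_def)
qed

section \<open>Integration over \<open>\<complex>\<^sup>2\<close>\<close>

lemma frechet_derivative_zero_outside:
  assumes "closed K" "\<And>x. x \<notin> K \<Longrightarrow> g x = 0" "x \<notin> K"
  shows "frechet_derivative g (at x) v = 0"
proof -
  have "frechet_derivative g (at x) = frechet_derivative (\<lambda>_. 0) (at x)"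
    using assms by (intro frechet_derivative_cong_open[of "- K"]) (auto simp: open_Compl)
  then show ?thesis by (simp add: frechet_derivative_const)
qed

lemma has_integral_zero_outside:
  fixes g :: "'e::euclidean_space \<Rightarrow> 'f::banach"
  assumes "\<And>x. x \<notin> K \<Longrightarrow> g x = 0" "K \<subseteq> S"
  shows "(g has_integral J) UNIV \<longleftrightarrow> (g has_integral J) S"
proof -
  have "(\<lambda>x. if x \<in> S then g x else 0) = g" using assms by (auto simp: fun_eq_iff)
  then show ?thesis using has_integral_restrict_UNIV[of S g J] by simp
qed

text \<open>By translation invariance the integral of \<open>g (x + t v)\<close> does not depend on \<open>t\<close>.\<close>

lemma integral_derivative_compact_support:
  fixes g :: "'e::euclidean_space \<Rightarrow> 'f::euclidean_space"
  assumes g: "Ck_on 1 UNIV g" and K: "compact K" and g0: "\<And>x. x \<notin> K \<Longrightarrow> g x = 0"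
  shows "((\<lambda>x. frechet_derivative g (at x) v) has_integral 0) UNIV"
proof -
  let ?D = "\<lambda>x. frechet_derivative g (at x) v"
  obtain R where R: "\<And>x. x \<in> K \<Longrightarrow> norm x \<le> R"
    using compact_imp_bounded[OF K] bounded_iff by blast
  \<comment> \<open>The margin \<open>norm v\<close> makes the box contain all translates of
    \<open>K\<close> by \<open>- t\<close> times \<open>v\<close> with
    \<open>\<bar>t\<bar> \<le> 1\<close>, so integrals over one fixed box see the whole translated
    function.\<close>
  obtain a where a: "cball 0 (R + norm v) \<subseteq> cbox (-a) (a::'e)"
    using bounded_subset_cbox_symmetric[OF bounded_cball] by blast
  define J where "J = integral (cbox (-a) a) g"
  have Kt: "K \<subseteq> cbox (- a + t *\<^sub>R v) (a + t *\<^sub>R v)" if "\<bar>t\<bar> \<le> 1" for t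
  proof
    fix x assume "x \<in> K"
    have "norm (x - t *\<^sub>R v) \<le> norm x + norm (t *\<^sub>R v)" by (rule norm_triangle_ineq4)
    also have "\<dots> \<le> R + norm v" using R[OF \<open>x \<in> K\<close>] that by (simp add: mult_left_le_one_le add_mono)
    finally have "x - t *\<^sub>R v \<in> cball 0 (R + norm v)" by simp
    then have "x - t *\<^sub>R v \<in> cbox (-a) a" using a by (rule subsetD[rotated])
    then show "x \<in> cbox (- a + t *\<^sub>R v) (a + t *\<^sub>R v)"
      unfolding mem_box by (simp add: inner_diff_left inner_add_left) (simp add: algebra_simps)
  qed
  have dg: "g differentiable (at x)" for x using C1_differentiable[OF g] by simp
  have cg: "continuous_on UNIV g" by (rule Ck_on_imp_continuous[OF g])
  have cD: "continuous_on UNIV ?D" using g by (simp add: Ck_on.simps(2))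
  have intg: "g integrable_on cbox b c" for b c
    using continuous_on_subset[OF cg] by (intro integrable_continuous) auto
  have gJ: "(g has_integral J) UNIV"
    using has_integral_zero_outside[where g=g and K=K and S="cbox (-a) a" and J=J] g0 Kt[of 0] integrable_integral[OF intg[of "-a" a]]
    by (simp add: J_def)
  have shift: "integral (cbox (-a) a) (\<lambda>x. g (x + t *\<^sub>R v)) = J" if "\<bar>t\<bar> \<le> 1" for t
  proof -
    have "(g has_integral J) (cbox (- a + t *\<^sub>R v) (a + t *\<^sub>R v))"
      using gJ has_integral_zero_outside[where g=g and K=K, OF _ Kt[OF that]] g0 by blast
    from has_integral_affinity'[OF this, of 1 "t *\<^sub>R v"] show ?thesis by (simp add: integral_unique)
  qed
  have "((\<lambda>t. integral (cbox (-a) a) (\<lambda>x. g (x + t *\<^sub>R v))) has_vector_derivative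
      integral (cbox (-a) a) (\<lambda>x. ?D (x + 0 *\<^sub>R v))) (at 0 within {-1..1})"
  proof (rule leibniz_rule_vector_derivative)
    show "((\<lambda>t. g (x + t *\<^sub>R v)) has_vector_derivative ?D (x + t *\<^sub>R v)) (at t within {-1..1})" for t x
      by (rule has_vector_derivative_at_within[OF frechet_derivative_along_line[OF dg]])
    show "(\<lambda>x. g (x + t *\<^sub>R v)) integrable_on cbox (-a) a" for t
      by (intro integrable_continuous continuous_on_compose2[OF cg]) (auto intro!: continuous_intros)
    have "continuous_on ({-1..1} \<times> cbox (-a) a) (\<lambda>p. ?D (snd p + fst p *\<^sub>R v))"
      by (rule continuous_on_compose2[OF cD]) (auto intro!: continuous_intros)
    then show "continuous_on ({-1..1} \<times> cbox (-a) a) (\<lambda>(t, x). ?D (x + t *\<^sub>R v))"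
      by (simp add: case_prod_unfold)
  qed auto
  then have "((\<lambda>t. integral (cbox (-a) a) (\<lambda>x. g (x + t *\<^sub>R v))) has_vector_derivative
      integral (cbox (-a) a) ?D) (at 0 within {-1..1})" by simp
  moreover have "((\<lambda>t. integral (cbox (-a) a) (\<lambda>x. g (x + t *\<^sub>R v))) has_vector_derivative 0) (at 0 within {-1..1})"
    by (rule has_vector_derivative_transform[OF _ _ has_vector_derivative_const[of J]]) (use shift in auto)
  moreover have "at (0::real) within {-1..1} \<noteq> bot"
    by (simp add: trivial_limit_within islimpt_Icc)
  ultimately have "integral (cbox (-a) a) ?D = 0"
    using vector_derivative_unique_within by blast
  moreover have "?D integrable_on cbox (-a) a"
    using continuous_on_subset[OF cD] by (intro integrable_continuous) auto
  ultimately have "(?D has_integral 0) (cbox (-a) a)" by (simp add: has_integral_iff)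
  moreover have "K \<subseteq> cbox (-a) a" using Kt[of 0] by simp
  moreover have "?D x = 0" if "x \<notin> K" for x
    by (rule frechet_derivative_zero_outside[OF compact_imp_closed[OF K] g0 that])
  ultimately show ?thesis
    using has_integral_zero_outside[where g="?D" and K=K and S="cbox (-a) a" and J=0] by simp
qed

text \<open>Integrals over complex two-space are taken over \<open>real^4\<close> through this
  identification, where the Jacobian of a map is a real determinant.\<close>

definition r2c :: "real^4 \<Rightarrow> complex^2" where
  "r2c x = (\<chi> i. if i = 1 then Complex (x $ 1) (x $ 2) else Complex (x $ 3) (x $ 4))"

definition c2r :: "complex^2 \<Rightarrow> real^4" where
  "c2r z = (\<chi> i. if i = 1 then Re (z $ 1) else if i = 2 then Im (z $ 1)
     else if i = 3 then Re (z $ 2) else Im (z $ 2))"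

lemma r2c_c2r [simp]: "r2c (c2r z) = z"
  by (simp add: r2c_def c2r_def vec_eq_iff forall_2)

lemma c2r_r2c [simp]: "c2r (r2c x) = x"
  by (simp add: r2c_def c2r_def vec_eq_iff forall_4)

lemma bounded_linear_r2c: "bounded_linear r2c"
  by (intro linear_conv_bounded_linear[THEN iffD1] linearI)
    (simp_all add: r2c_def vec_eq_iff complex_eq_iff)

lemma bounded_linear_c2r: "bounded_linear c2r"
  by (intro linear_conv_bounded_linear[THEN iffD1] linearI)
    (simp_all add: c2r_def vec_eq_iff)

lemma c2r_image: "c2r ` S = r2c -` S"
proof (intro equalityI subsetI)
  fix x assume "x \<in> r2c -` S"
  then show "x \<in> c2r ` S" using c2r_r2c[of x] by (metis imageI vimageD)
qed auto

lemma compact_c2r: "compact K \<Longrightarrow> compact (c2r ` K)"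
  by (intro compact_continuous_image linear_continuous_on bounded_linear_c2r)

lemma open_c2r: "open U \<Longrightarrow> open (c2r ` U)"
  unfolding c2r_image by (intro open_vimage linear_continuous_on bounded_linear_r2c)

lemma has_integral_derivative_r2c:
  fixes g :: "complex^2 \<Rightarrow> 'f::euclidean_space"
  assumes g: "Ck_on 1 UNIV g" and K: "compact K" and g0: "\<And>x. x \<notin> K \<Longrightarrow> g x = 0"
  shows "((\<lambda>x. frechet_derivative g (at (r2c x)) v) has_integral 0) UNIV"
proof -
  have d: "((\<lambda>x. g (r2c x)) has_derivative (\<lambda>v. frechet_derivative g (at (r2c x)) (r2c v))) (at x)" for x
    using has_derivative_compose[OF bounded_linear_imp_has_derivative[OF bounded_linear_r2c] frechet_derivative_worksI]
      C1_differentiable[OF g] by blast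
  have "((\<lambda>x. frechet_derivative (\<lambda>x. g (r2c x)) (at x) (c2r v)) has_integral 0) UNIV"
  proof (rule integral_derivative_compact_support[OF _ compact_c2r[OF K]])
    show "Ck_on 1 UNIV (\<lambda>x. g (r2c x))"
      by (rule Ck_on_compose[OF _ _ _ Ck_on_linear[OF bounded_linear_r2c] g]) auto
    show "g (r2c x) = 0" if "x \<notin> c2r ` K" for x
      using that g0 by (auto simp: c2r_image)
  qed
  moreover have "frechet_derivative (\<lambda>x. g (r2c x)) (at x) (c2r v) = frechet_derivative g (at (r2c x)) v" for x
    using fun_cong[OF frechet_derivative_at[OF d[of x]], of "c2r v"] by simp
  ultimately show ?thesis by simp
qed

lemma has_integral_cderiv:
  assumes g: "Ck_on 1 UNIV g" and K: "compact K" and g0: "\<And>x. x \<notin> K \<Longrightarrow> g x = 0"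
  shows "((\<lambda>x. cderiv p g (r2c x)) has_integral 0) UNIV"
  using has_integral_add[OF has_integral_derivative_r2c[OF g K g0, of "fst p"]
      has_integral_mult_right[OF has_integral_derivative_r2c[OF g K g0, of "snd p"], of \<i>]]
  by (simp add: cderiv_def)

text \<open>Two open sets cover the space: \<open>U\<close>, where both factors are of class
  \<open>C^k\<close>, and the complement of \<open>K\<close>, where the product is zero whatever
  \<open>w\<close> does there.\<close>

lemma Ck_on_mult_compact_support:
  fixes \<psi> w :: "'e::euclidean_space \<Rightarrow> complex"
  assumes "open U" "compact K" "K \<subseteq> U" "\<And>x. x \<notin> K \<Longrightarrow> \<psi> x = 0" "Ck_on k U \<psi>" "Ck_on k U w"
  shows "Ck_on k UNIV (\<lambda>z. \<psi> z * w z)"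
proof (rule Ck_on_local)
  fix x :: 'e
  show "\<exists>T. open T \<and> x \<in> T \<and> Ck_on k T (\<lambda>z. \<psi> z * w z)"
  proof (cases "x \<in> U")
    case True
    then show ?thesis using assms(1) Ck_on_mult[OF assms(1,5,6)] by (intro exI[of _ U]) simp
  next
    case False
    have o: "open (- K)" using assms(2) compact_imp_closed by blast
    have "Ck_on k (- K) (\<lambda>z. \<psi> z * w z) \<longleftrightarrow> Ck_on k (- K) (\<lambda>z. 0::complex)"
      by (rule Ck_on_cong[OF o]) (use assms(4) in auto)
    then show ?thesis using o False assms(3) by (intro exI[of _ "- K"]) auto
  qed
qed

lemma cderiv_zero_outside:
  assumes "closed K" "\<And>x. x \<notin> K \<Longrightarrow> g x = 0" "x \<notin> K"
  shows "cderiv p g x = 0"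
  by (simp add: cderiv_def frechet_derivative_zero_outside[OF assms])

text \<open>The integrand is the derivative along \<open>p\<close> of \<psi> times the
  \<open>q\<close>-derivative of \<open>w\<close>, minus the derivative along \<open>q\<close> of
  the \<open>p\<close>-derivative of \<psi> times \<open>w\<close>. Both products have compact
  support.\<close>

lemma integration_by_parts:
  fixes \<psi> w :: "complex^2 \<Rightarrow> complex"
  assumes U: "open U" and K: "compact K" "K \<subseteq> U" "\<And>x. x \<notin> K \<Longrightarrow> \<psi> x = 0"
    and \<psi>: "Ck_on 2 U \<psi>" and w: "Ck_on 2 U w"
  shows "((\<lambda>x. \<psi> (r2c x) * cderiv p (cderiv q w) (r2c x) - cderiv p (cderiv q \<psi>) (r2c x) * w (r2c x)) has_integral 0) UNIV"
proof -
  have \<psi>1: "Ck_on 1 U \<psi>" and w1: "Ck_on 1 U w" using Ck_on_le[OF \<psi>] Ck_on_le[OF w] by simp_all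
  have c\<psi>: "Ck_on 1 U (cderiv q \<psi>)" for q using Ck_on_cderiv[OF U, of 1 \<psi>] \<psi> by (simp add: numeral_2_eq_2)
  have cw: "Ck_on 1 U (cderiv q w)" for q using Ck_on_cderiv[OF U, of 1 w] w by (simp add: numeral_2_eq_2)
  note cl = compact_imp_closed[OF K(1)]
  have z1: "cderiv q \<psi> x = 0" if "x \<notin> K" for q x by (rule cderiv_zero_outside[OF cl K(3) that])
  have z2: "cderiv p (cderiv q \<psi>) x = 0" if "x \<notin> K" for p q x by (rule cderiv_zero_outside[OF cl z1 that])
  have 1: "((\<lambda>x. cderiv p (\<lambda>z. \<psi> z * cderiv q w z) (r2c x)) has_integral 0) UNIV"
    by (rule has_integral_cderiv[OF Ck_on_mult_compact_support[OF U K \<psi>1 cw] K(1)]) (use K(3) in auto)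
  have 2: "((\<lambda>x. cderiv q (\<lambda>z. cderiv p \<psi> z * w z) (r2c x)) has_integral 0) UNIV"
    by (rule has_integral_cderiv[OF Ck_on_mult_compact_support[OF U K(1,2) z1 c\<psi> w1] K(1)]) (use z1 in auto)
  have "cderiv p (\<lambda>z. \<psi> z * cderiv q w z) z - cderiv q (\<lambda>z. cderiv p \<psi> z * w z) z
      = \<psi> z * cderiv p (cderiv q w) z - cderiv p (cderiv q \<psi>) z * w z" for z
  proof (cases "z \<in> U")
    case True
    then show ?thesis
      using cderiv_commute[OF U True \<psi>, of p q]
        C1_differentiable[OF \<psi>1 True] C1_differentiable[OF w1 True]
        C1_differentiable[OF c\<psi> True] C1_differentiable[OF cw True]
      by (simp add: cderiv_mult algebra_simps)
  next
    case False
    then have "z \<notin> K" using K(2) by auto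
    moreover have "cderiv p (\<lambda>z. \<psi> z * cderiv q w z) z = 0" "cderiv q (\<lambda>z. cderiv p \<psi> z * w z) z = 0"
      using K(3) z1 \<open>z \<notin> K\<close> by (auto intro!: cderiv_zero_outside[OF cl])
    ultimately show ?thesis using z2 K(3) by simp
  qed
  with has_integral_diff[OF 1 2] show ?thesis by simp
qed

section \<open>Jacobians and change of variables for holomorphic maps\<close>

lemma det_4:
  "det (A::'a::comm_ring_1^4^4) =
     A$1$1 * (A$2$2 * (A$3$3 * A$4$4 - A$3$4 * A$4$3) - A$2$3 * (A$3$2 * A$4$4 - A$3$4 * A$4$2) + A$2$4 * (A$3$2 * A$4$3 - A$3$3 * A$4$2))
   - A$1$2 * (A$2$1 * (A$3$3 * A$4$4 - A$3$4 * A$4$3) - A$2$3 * (A$3$1 * A$4$4 - A$3$4 * A$4$1) + A$2$4 * (A$3$1 * A$4$3 - A$3$3 * A$4$1))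
   + A$1$3 * (A$2$1 * (A$3$2 * A$4$4 - A$3$4 * A$4$2) - A$2$2 * (A$3$1 * A$4$4 - A$3$4 * A$4$1) + A$2$4 * (A$3$1 * A$4$2 - A$3$2 * A$4$1))
   - A$1$4 * (A$2$1 * (A$3$2 * A$4$3 - A$3$3 * A$4$2) - A$2$2 * (A$3$1 * A$4$3 - A$3$3 * A$4$1) + A$2$3 * (A$3$1 * A$4$2 - A$3$2 * A$4$1))"
proof -
  have f1: "finite {2::4, 3, 4}" "1 \<notin> {2::4, 3, 4}" by auto
  have f2: "finite {3::4, 4}" "2 \<notin> {3::4, 4}" by auto
  have f3: "finite {4::4}" "3 \<notin> {4::4}" by auto
  show ?thesis
    unfolding det_def UNIV_4
    unfolding sum_over_permutations_insert[OF f1]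
    unfolding sum_over_permutations_insert[OF f2]
    unfolding sum_over_permutations_insert[OF f3]
    unfolding permutes_sing
    by (simp add: sign_swap_id permutation_swap_id sign_compose sign_id swap_id_eq permutation_compose algebra_simps)
qed

definition jac :: "(complex^2 \<Rightarrow> complex^2) \<Rightarrow> complex" where
  "jac L = L (axis 1 1) $ 1 * L (axis 2 1) $ 2 - L (axis 2 1) $ 1 * L (axis 1 1) $ 2"

lemma complex_linear_2:
  fixes v :: "complex^2"
  assumes "linear L" "complex_linear L"
  shows "L v = v $ 1 *s L (axis 1 1) + v $ 2 *s L (axis 2 (1::complex))"
proof -
  have "v = v $ 1 *s axis 1 1 + v $ 2 *s axis 2 1" by (simp add: vec_eq_iff axis_def forall_2)
  then have "L v = L (v $ 1 *s axis 1 1 + v $ 2 *s axis 2 1)" by simp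
  then show ?thesis using assms by (simp add: linear_add complex_linear_def)
qed

text \<open>The real determinant of a complex linear map is the squared modulus of its complex
  determinant; for two variables this is an expansion in the four complex entries.\<close>

lemma det_complex_linear:
  fixes L :: "complex^2 \<Rightarrow> complex^2"
  assumes "linear L" "complex_linear L"
  shows "det (matrix (\<lambda>x. c2r (L (r2c x)))) = (cmod (jac L))\<^sup>2"
proof -
  obtain a b c d where L: "L (axis 1 1) $ 1 = a" "L (axis 2 1) $ 1 = b" "L (axis 1 1) $ 2 = c" "L (axis 2 1) $ 2 = d"
    by blast
  have r: "r2c (axis 1 1) $ 1 = 1" "r2c (axis 1 1) $ 2 = 0" "r2c (axis 2 1) $ 1 = \<i>" "r2c (axis 2 1) $ 2 = 0"
     "r2c (axis 3 1) $ 1 = 0" "r2c (axis 3 1) $ 2 = 1" "r2c (axis 4 1) $ 1 = 0" "r2c (axis 4 1) $ 2 = \<i>"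
    by (simp_all add: r2c_def axis_def complex_eq_iff)
  show ?thesis
    unfolding det_4 matrix_def cmod_power2 jac_def L
    by (simp add: c2r_def complex_linear_2[OF assms, of "r2c x" for x] r L power2_eq_square algebra_simps)
qed

lemma holomorphic_change_of_variables:
  fixes \<phi> :: "complex^2 \<Rightarrow> complex^2" and w :: "complex^2 \<Rightarrow> real"
  assumes D: "open D" and inj: "inj_on \<phi> D"
    and der: "\<And>z. z \<in> D \<Longrightarrow> (\<phi> has_derivative \<phi>' z) (at z)"
    and lin: "\<And>z. z \<in> D \<Longrightarrow> complex_linear (\<phi>' z)"
    and w: "(\<lambda>x. w (r2c x)) absolutely_integrable_on c2r ` \<phi> ` D"
  shows "integral (c2r ` \<phi> ` D) (\<lambda>x. w (r2c x))
       = integral (c2r ` D) (\<lambda>x. (cmod (jac (\<phi>' (r2c x))))\<^sup>2 * w (\<phi> (r2c x)))"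
    and "(\<lambda>x. (cmod (jac (\<phi>' (r2c x))))\<^sup>2 * w (\<phi> (r2c x))) absolutely_integrable_on c2r ` D"
proof -
  let ?g = "\<lambda>x. c2r (\<phi> (r2c x))" and ?g' = "\<lambda>x v. c2r (\<phi>' (r2c x) (r2c v))"
  have S: "c2r ` D \<in> sets lebesgue" using open_c2r[OF D] by auto
  have gd: "(?g has_derivative ?g' x) (at x within c2r ` D)" if "x \<in> c2r ` D" for x
  proof -
    have "r2c x \<in> D" using that by auto
    from has_derivative_compose[OF bounded_linear_imp_has_derivative[OF bounded_linear_r2c] der[OF this]]
    show ?thesis
      by (rule has_derivative_at_withinI[OF bounded_linear.has_derivative[OF bounded_linear_c2r]])
  qed
  have gi: "inj_on ?g (c2r ` D)"
  proof (rule inj_onI)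
    fix x y assume xy: "x \<in> c2r ` D" "y \<in> c2r ` D" and "?g x = ?g y"
    then have "\<phi> (r2c x) = \<phi> (r2c y)" by (metis r2c_c2r)
    moreover have "r2c x \<in> D" "r2c y \<in> D" using xy by auto
    ultimately have "r2c x = r2c y" using inj by (simp add: inj_on_eq_iff)
    then show "x = y" by (metis c2r_r2c)
  qed
  have im: "?g ` c2r ` D = c2r ` \<phi> ` D" by (auto simp: image_image)
  have dt: "\<bar>det (matrix (?g' x))\<bar> = (cmod (jac (\<phi>' (r2c x))))\<^sup>2" if "x \<in> c2r ` D" for x
    using det_complex_linear[of "\<phi>' (r2c x)"] has_derivative_linear[OF der] lin that by auto
  \<comment> \<open>Real values are wrapped as \<open>real^1\<close>, the form of integrand that
    \<open>has_absolute_integral_change_of_variables\<close> takes.\<close>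
  define b where "b = integral (c2r ` \<phi> ` D) (\<lambda>x. vec (w (r2c x)) :: real^1)"
  have v: "(\<lambda>x. vec (w (r2c x)) :: real^1) absolutely_integrable_on c2r ` \<phi> ` D"
    using w by (simp add: absolutely_integrable_on_1_iff)
  have main: "(\<lambda>x. \<bar>det (matrix (?g' x))\<bar> *\<^sub>R (vec (w (r2c (?g x))) :: real^1)) absolutely_integrable_on c2r ` D \<and>
      integral (c2r ` D) (\<lambda>x. \<bar>det (matrix (?g' x))\<bar> *\<^sub>R (vec (w (r2c (?g x))) :: real^1)) = b"
    using has_absolute_integral_change_of_variables[OF S gd gi, of "\<lambda>x. vec (w (r2c x)) :: real^1" b] v
    unfolding im b_def by blast
  have e: "\<bar>det (matrix (?g' x))\<bar> *\<^sub>R (vec (w (r2c (?g x))) :: real^1)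
     = vec ((cmod (jac (\<phi>' (r2c x))))\<^sup>2 * w (\<phi> (r2c x)))" if "x \<in> c2r ` D" for x
    using dt[OF that] by (simp add: vec_eq_iff)
  have "(\<lambda>x. vec ((cmod (jac (\<phi>' (r2c x))))\<^sup>2 * w (\<phi> (r2c x))) :: real^1) absolutely_integrable_on c2r ` D"
    using absolutely_integrable_spike[OF conjunct1[OF main] negligible_empty] e by simp
  moreover have I: "integral (c2r ` D) (\<lambda>x. vec ((cmod (jac (\<phi>' (r2c x))))\<^sup>2 * w (\<phi> (r2c x))) :: real^1) = b"
    using conjunct2[OF main] integral_cong[of "c2r ` D", OF e] by simp
  ultimately show "(\<lambda>x. (cmod (jac (\<phi>' (r2c x))))\<^sup>2 * w (\<phi> (r2c x))) absolutely_integrable_on c2r ` D"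
    by (simp add: absolutely_integrable_on_1_iff)
  show "integral (c2r ` \<phi> ` D) (\<lambda>x. w (r2c x))
       = integral (c2r ` D) (\<lambda>x. (cmod (jac (\<phi>' (r2c x))))\<^sup>2 * w (\<phi> (r2c x)))"
    using I unfolding b_def
    by (simp add: integral_on_1_eq vec_eq_iff)
qed

section \<open>Charts\<close>

lemma chart_facts:
  assumes M: "connected_topological_manifold X A" and c: "c \<in> A"
  shows chart_subset: "cdom c \<subseteq> topspace X"
    and chart_open: "openin X (cdom c)"
    and chart_image_open: "open (coord c ` cdom c)"
    and chart_homeo: "homeomorphic_map (subtopology X (cdom c)) (top_of_set (coord c ` cdom c)) (coord c)"
    and chart_inj: "inj_on (coord c) (cdom c)"
proof -
  show o: "openin X (cdom c)" and "open (coord c ` cdom c)"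
    and h: "homeomorphic_map (subtopology X (cdom c)) (top_of_set (coord c ` cdom c)) (coord c)"
    using M c unfolding connected_topological_manifold_def by blast+
  show s: "cdom c \<subseteq> topspace X" using openin_subset[OF o] .
  show "inj_on (coord c) (cdom c)"
    using homeomorphic_imp_injective_map[OF h] s by (simp add: topspace_subtopology Int_absorb1)
qed

lemma param_coord:
  assumes "connected_topological_manifold X A" "c \<in> A" "p \<in> cdom c"
  shows "param c (coord c p) = p"
  using chart_inj[OF assms(1,2)] assms(3) by (simp add: param_def)

lemma coord_param:
  assumes "z \<in> coord c ` cdom c"
  shows "coord c (param c z) = z" "param c z \<in> cdom c"
  using assms by (simp_all add: param_def f_inv_into_f inv_into_into)

lemma chart_openin_image:
  assumes M: "connected_topological_manifold X A" and c: "c \<in> A" and W: "openin X W"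
  shows "open (coord c ` (cdom c \<inter> W))"
proof -
  have "openin (subtopology X (cdom c)) (cdom c \<inter> W)"
    using W by (metis openin_subtopology_Int2)
  then have "openin (top_of_set (coord c ` cdom c)) (coord c ` (cdom c \<inter> W))"
    using homeomorphic_map_openness_eq[OF chart_homeo[OF M c]] by blast
  then show ?thesis using chart_image_open[OF M c] by (metis openin_open_eq)
qed

lemma chart_openin_vimage:
  assumes M: "connected_topological_manifold X A" and c: "c \<in> A" and U: "open U"
  shows "openin X {p \<in> cdom c. coord c p \<in> U}"
proof -
  have "continuous_map (subtopology X (cdom c)) (top_of_set (coord c ` cdom c)) (coord c)"
    using chart_homeo[OF M c] homeomorphic_imp_continuous_map by blast
  moreover have "openin (top_of_set (coord c ` cdom c)) (coord c ` cdom c \<inter> U)"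
    using U by (simp add: openin_open_Int)
  ultimately have "openin (subtopology X (cdom c))
      {p \<in> topspace (subtopology X (cdom c)). coord c p \<in> coord c ` cdom c \<inter> U}"
    by (rule openin_continuous_map_preimage)
  moreover have "{p \<in> topspace (subtopology X (cdom c)). coord c p \<in> coord c ` cdom c \<inter> U} = {p \<in> cdom c. coord c p \<in> U}"
    using chart_subset[OF M c] by auto
  ultimately show ?thesis using chart_open[OF M c] by (metis openin_trans_full)
qed

text \<open>The inverse of the chart maps \<open>K\<close> to a compact set, and compact sets are
  closed in a Hausdorff space. It allows functions supported in a chart to be extended by zero
  without losing smoothness.\<close>

lemma chart_closedin_compact:
  assumes M: "connected_topological_manifold X A" and c: "c \<in> A"
    and K: "compact K" "K \<subseteq> coord c ` cdom c"
  shows "closedin X {p \<in> cdom c. coord c p \<in> K}"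
proof -
  obtain k where k: "homeomorphic_maps (subtopology X (cdom c)) (top_of_set (coord c ` cdom c)) (coord c) k"
    using chart_homeo[OF M c] homeomorphic_map_maps by blast
  then have ck: "continuous_map (top_of_set (coord c ` cdom c)) (subtopology X (cdom c)) k"
    and kc: "\<And>p. p \<in> cdom c \<Longrightarrow> k (coord c p) = p"
    using chart_subset[OF M c] by (auto simp: homeomorphic_maps_def topspace_subtopology)
  have "compactin (top_of_set (coord c ` cdom c)) K"
    using K by (simp add: compactin_subtopology)
  then have "compactin (subtopology X (cdom c)) (k ` K)"
    using image_compactin[OF _ ck] by blast
  then have "compactin X (k ` K)" by (simp add: compactin_subtopology)
  moreover have "k ` K = {p \<in> cdom c. coord c p \<in> K}"
    using K(2) kc by force
  ultimately show ?thesis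
    using compactin_imp_closedin M unfolding connected_topological_manifold_def by metis
qed

definition overlap :: "('a, 'e) chart \<Rightarrow> ('a, 'e) chart \<Rightarrow> 'e set" where
  "overlap c c' = coord c ` (cdom c \<inter> cdom c')"

lemma transition_facts:
  assumes M: "connected_topological_manifold X A" and c: "c \<in> A" "c' \<in> A"
  shows overlap_open: "open (overlap c c')"
    and transition_in: "z \<in> overlap c c' \<Longrightarrow> transition c c' z \<in> overlap c' c"
    and param_transition: "z \<in> overlap c c' \<Longrightarrow> param c' (transition c c' z) = param c z"
    and transition_inj: "inj_on (transition c c') (overlap c c')"
    and transition_image: "transition c c' ` overlap c c' = overlap c' c"
    and transition_coord: "p \<in> cdom c \<inter> cdom c' \<Longrightarrow> transition c c' (coord c p) = coord c' p"
proof -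
  show "open (overlap c c')"
    unfolding overlap_def using chart_openin_image[OF M c(1) chart_open[OF M c(2)]] .
  show tc: "transition c c' (coord c p) = coord c' p" if "p \<in> cdom c \<inter> cdom c'" for p
    using param_coord[OF M c(1)] that by (simp add: transition_def)
  show "z \<in> overlap c c' \<Longrightarrow> transition c c' z \<in> overlap c' c"
    using tc by (auto simp: overlap_def)
  show "z \<in> overlap c c' \<Longrightarrow> param c' (transition c c' z) = param c z"
    using tc param_coord[OF M c(1)] param_coord[OF M c(2)] by (auto simp: overlap_def)
  show "inj_on (transition c c') (overlap c c')"
    using tc chart_inj[OF M c(1)] chart_inj[OF M c(2)]
    by (auto simp: inj_on_def overlap_def)
  show "transition c c' ` overlap c c' = overlap c' c"
    using tc by (force simp: overlap_def)
qed

lemma overlap_param: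
  assumes "connected_topological_manifold X A" "c \<in> A" "z \<in> overlap c c'"
  shows "param c z \<in> cdom c" "param c z \<in> cdom c'" "z \<in> coord c ` cdom c" "coord c (param c z) = z"
  using assms param_coord[OF assms(1,2)] by (auto simp: overlap_def)

section \<open>Pulling back sesquilinear forms\<close>

definition sesq :: "(complex^2 \<Rightarrow> complex^2 \<Rightarrow> complex) \<Rightarrow> bool" where
  "sesq Q \<longleftrightarrow> (\<forall>a b. Q a b = (\<Sum>\<alpha>\<in>UNIV. \<Sum>\<beta>\<in>UNIV. a $ \<alpha> * cnj (b $ \<beta>) * Q (axis \<alpha> 1) (axis \<beta> 1)))"

text \<open>The polarised determinant: the coefficient of the wedge product of the (1,1)-forms with
  matrices \<open>P\<close> and \<open>Q\<close>.\<close>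

definition mixed_disc :: "(complex^2 \<Rightarrow> complex^2 \<Rightarrow> complex) \<Rightarrow> (complex^2 \<Rightarrow> complex^2 \<Rightarrow> complex) \<Rightarrow> complex" where
  "mixed_disc P Q = P (axis 1 1) (axis 1 1) * Q (axis 2 1) (axis 2 1) + P (axis 2 1) (axis 2 1) * Q (axis 1 1) (axis 1 1)
     - P (axis 1 1) (axis 2 1) * Q (axis 2 1) (axis 1 1) - P (axis 2 1) (axis 1 1) * Q (axis 1 1) (axis 2 1)"

text \<open>The expression is alternating in the two linear slots and in the two antilinear slots:
  the former yield the factor \<open>jac L\<close>, by \<open>left\<close>, and the latter its
  conjugate, by \<open>right\<close>.\<close>

lemma mixed_disc_pullback:
  assumes "sesq P" "sesq Q"
  shows "mixed_disc (\<lambda>a b. P (L a) (L b)) (\<lambda>a b. Q (L a) (L b)) = of_real ((cmod (jac L))\<^sup>2) * mixed_disc P Q"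
proof -
  obtain a b c d where L: "L (axis 1 1) $ 1 = a" "L (axis 2 1) $ 1 = b" "L (axis 1 1) $ 2 = c" "L (axis 2 1) $ 2 = d"
    by blast
  have left: "(a * p11 + c * p21) * (b * q12 + d * q22) + (b * p12 + d * p22) * (a * q11 + c * q21)
      - (a * p12 + c * p22) * (b * q11 + d * q21) - (b * p11 + d * p21) * (a * q12 + c * q22)
     = (a * d - b * c) * (p11 * q22 + p22 * q11 - p12 * q21 - p21 * q12)" for a b c d p11 p12 p21 p22 q11 q12 q21 q22 :: complex
    by (simp add: algebra_simps)
  have right: "(a * p11 + c * p12) * (b * q21 + d * q22) + (b * p21 + d * p22) * (a * q11 + c * q12)
      - (b * p11 + d * p12) * (a * q21 + c * q22) - (a * p21 + c * p22) * (b * q11 + d * q12)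
     = (a * d - b * c) * (p11 * q22 + p22 * q11 - p12 * q21 - p21 * q12)" for a b c d p11 p12 p21 p22 q11 q12 q21 q22 :: complex
    by (simp add: algebra_simps)
  define r where "r R \<mu> w = cnj (w $ 1) * R (axis \<mu> 1) (axis 1 1) + cnj (w $ 2) * R (axis \<mu> 1) (axis 2 1)"
    for R :: "complex^2 \<Rightarrow> complex^2 \<Rightarrow> complex" and \<mu> and w :: "complex^2"
  have *: "R v w = v $ 1 * r R 1 w + v $ 2 * r R 2 w" if "sesq R" for R v w
    using that[unfolded sesq_def sum_2, rule_format, of v w] by (simp add: r_def algebra_simps)
  have n: "of_real ((cmod (jac L))\<^sup>2) = jac L * cnj (jac L)" by (rule complex_norm_square)
  have j: "jac L = a * d - b * c" by (simp add: jac_def L)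
  have "mixed_disc (\<lambda>a b. P (L a) (L b)) (\<lambda>a b. Q (L a) (L b))
     = jac L * (r P 1 (L (axis 1 1)) * r Q 2 (L (axis 2 1)) + r P 2 (L (axis 2 1)) * r Q 1 (L (axis 1 1))
       - r P 1 (L (axis 2 1)) * r Q 2 (L (axis 1 1)) - r P 2 (L (axis 1 1)) * r Q 1 (L (axis 2 1)))"
    unfolding mixed_disc_def j
    by (simp only: *[OF assms(1), of "L v" for v] *[OF assms(2), of "L v" for v] L left)
  also have "\<dots> = jac L * (cnj (jac L) * mixed_disc P Q)"
    unfolding r_def L j complex_cnj_diff complex_cnj_mult mixed_disc_def by (subst right) (rule refl)
  finally show ?thesis unfolding n by (simp only: mult.assoc)
qed

text \<open>\<open>levi F z a b\<close> is \<open>\<partial>\<close>\<open>\<partial>\<close>-bar of \<open>F\<close> on \<open>a\<close> and the conjugate of \<open>b\<close>.\<close>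

definition levi :: "(complex^'m \<Rightarrow> complex) \<Rightarrow> complex^'m \<Rightarrow> complex^'m \<Rightarrow> complex^'m \<Rightarrow> complex" where
  "levi F z a b = cderiv (wz a) (cderiv (bar (wz b)) F) z"

lemma levi_cong:
  assumes "open S" "z \<in> S" "\<And>w. w \<in> S \<Longrightarrow> F w = F' w"
  shows "levi F z a b = levi F' z a b"
  unfolding levi_def by (rule cderiv_cong[OF assms(1,2)]) (rule cderiv_cong[OF assms(1)], use assms in auto)

lemma C2_cderiv:
  assumes "open S" "Ck_on 2 S F" shows "Ck_on 1 S (cderiv p F)" "Ck_on 1 S F"
  using Ck_on_cderiv[OF assms(1), of 1 F p] assms(2) Ck_on_le[OF assms(2)] by (simp_all add: numeral_2_eq_2)

lemma levi_expand_right: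
  assumes S: "open S" "z \<in> S" and F: "Ck_on 2 S F"
  shows "levi F z a b = (\<Sum>\<beta>\<in>UNIV. cnj (b $ \<beta>) * levi F z a (axis \<beta> 1))"
proof -
  have "cderiv (wz a) (cderiv (bar (wz b)) F) z = cderiv (wz a) (\<lambda>w. \<Sum>\<beta>\<in>UNIV. cnj (b $ \<beta>) * cderiv (bar (wz (axis \<beta> 1))) F w) z"
    by (rule cderiv_cong[OF S]) (rule cderiv_wz_sum, rule C1_differentiable[OF C2_cderiv(2)[OF S(1) F]])
  then show ?thesis
    using C1_differentiable[OF C2_cderiv(1)[OF S(1) F] S(2)]
    by (simp add: levi_def cderiv_sum cderiv_cmult differentiable_mult)
qed

lemma sesq_levi:
  assumes S: "open S" "z \<in> S" and F: "Ck_on 2 S F"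
  shows "sesq (levi F z)"
  unfolding sesq_def
proof (intro allI)
  fix a b
  have "levi F z a c = (\<Sum>\<alpha>\<in>UNIV. a $ \<alpha> * levi F z (axis \<alpha> 1) c)" for c
    unfolding levi_def using cderiv_wz_sum(1)[OF C1_differentiable[OF C2_cderiv(1)[OF S(1) F] S(2)]] by blast
  then show "levi F z a b = (\<Sum>\<alpha>\<in>UNIV. \<Sum>\<beta>\<in>UNIV. a $ \<alpha> * cnj (b $ \<beta>) * levi F z (axis \<alpha> 1) (axis \<beta> 1))"
    unfolding levi_expand_right[OF S F, of a b] by (subst sum.swap) (simp add: sum_distrib_left mult_ac)
qed

text \<open>The chain rule could leave a term with second derivatives of \<phi>. Here it would be a
  (1,0)-derivative of the conjugate of a component of \<phi>', which vanishes because that component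
  is itself holomorphic in the base point.\<close>

lemma levi_holomorphic_compose:
  fixes \<phi> :: "complex^2 \<Rightarrow> complex^2"
  assumes S: "open S" "z \<in> S" and T: "open T" "\<phi> ` S \<subseteq> T" and F: "Ck_on 2 T F"
    and der: "\<And>w. w \<in> S \<Longrightarrow> (\<phi> has_derivative \<phi>' w) (at w)"
    and lin: "\<And>w. w \<in> S \<Longrightarrow> complex_linear (\<phi>' w)"
  shows "levi (\<lambda>w. F (\<phi> w)) z a b = levi F (\<phi> z) (\<phi>' z a) (\<phi>' z b)"
proof -
  let ?e = "\<lambda>\<beta>. bar (wz (axis \<beta> 1))"
  have F1: "F differentiable (at w)" "cderiv q F differentiable (at w)" if "w \<in> T" for w q
    using C1_differentiable[OF C2_cderiv(1)[OF T(1) F] that] C1_differentiable[OF C2_cderiv(2)[OF T(1) F] that] by blast+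
  have first: "cderiv (bar (wz b)) (\<lambda>w. F (\<phi> w)) w = (\<Sum>\<beta>\<in>UNIV. cnj (\<phi>' w b $ \<beta>) * cderiv (?e \<beta>) F (\<phi> w))" if "w \<in> S" for w
    using cderiv_holomorphic_compose(2)[OF F1(1) der[OF that] lin[OF that], of b]
      cderiv_wz_sum(2)[OF F1(1), of "\<phi> w" "\<phi>' w b"] T(2) that by auto
  have dphi: "\<exists>L. ((\<lambda>w. \<phi>' w b $ \<beta>) has_derivative L) (at z) \<and> (\<forall>a v. L (a *s v) = a * L v)" for \<beta>
  proof (rule has_derivative_holomorphic_directional[OF S(1) _ _ S(2), of "\<lambda>w. \<phi> w $ \<beta>"])
    show "((\<lambda>w. \<phi> w $ \<beta>) has_derivative (\<lambda>v. \<phi>' w v $ \<beta>)) (at w)" if "w \<in> S" for w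
      using bounded_linear.has_derivative[OF bounded_linear_vec_nth der[OF that]] .
    show "\<phi>' w (a *s v) $ \<beta> = a * \<phi>' w v $ \<beta>" if "w \<in> S" for w a v
      using lin[OF that] by (simp add: complex_linear_def)
  qed
  have d1: "(\<lambda>w. \<phi>' w b $ \<beta>) differentiable (at z)" and d1c: "(\<lambda>w. cnj (\<phi>' w b $ \<beta>)) differentiable (at z)" for \<beta>
    using dphi[of \<beta>] has_derivative_cnj unfolding differentiable_def by blast+
  have zero: "cderiv (wz a) (\<lambda>w. cnj (\<phi>' w b $ \<beta>)) z = 0" for \<beta>
    using dphi[of \<beta>] dzbar_holomorphic(1) by (auto simp: cderiv_cnj_bar[OF d1])
  have zT: "\<phi> z \<in> T" using T S by auto
  have d2: "(\<lambda>w. cderiv (?e \<beta>) F (\<phi> w)) differentiable (at z)" for \<beta>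
    using has_derivative_compose[OF der[OF S(2)] frechet_derivative_worksI[OF F1(2)[OF zT]]]
    unfolding differentiable_def by blast
  have s1: "levi (\<lambda>w. F (\<phi> w)) z a b = cderiv (wz a) (\<lambda>w. \<Sum>\<beta>\<in>UNIV. cnj (\<phi>' w b $ \<beta>) * cderiv (?e \<beta>) F (\<phi> w)) z"
    unfolding levi_def by (rule cderiv_cong[OF S first])
  have s2: "cderiv (wz a) (\<lambda>w. \<Sum>\<beta>\<in>UNIV. cnj (\<phi>' w b $ \<beta>) * cderiv (?e \<beta>) F (\<phi> w)) z
      = (\<Sum>\<beta>\<in>UNIV. cnj (\<phi>' z b $ \<beta>) * levi F (\<phi> z) (\<phi>' z a) (axis \<beta> 1))"
    using cderiv_holomorphic_compose(1)[OF F1(2)[OF zT] der[OF S(2)] lin[OF S(2)]]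
    by (simp add: cderiv_sum cderiv_mult d1c d2 differentiable_mult zero levi_def)
  show ?thesis
    by (rule trans[OF s1 trans[OF s2 levi_expand_right[OF T(1) zT F, symmetric]]])
qed

section \<open>The pulled-back metric\<close>

lemma (in riem) sesq_CG:
  assumes "\<xi> differentiable (at z)"
  shows "sesq (\<lambda>a b. CG y (vcderiv (wz a) \<xi> z) (vcderiv (bar (wz b)) \<xi> z))"
  unfolding sesq_def
proof (intro allI)
  fix a b
  show "CG y (vcderiv (wz a) \<xi> z) (vcderiv (bar (wz b)) \<xi> z) = (\<Sum>\<alpha>\<in>UNIV. \<Sum>\<beta>\<in>UNIV. a $ \<alpha> * cnj (b $ \<beta>) *
      CG y (vcderiv (wz (axis \<alpha> 1)) \<xi> z) (vcderiv (bar (wz (axis \<beta> 1))) \<xi> z))"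
    unfolding vcderiv_wz_sum(1)[OF assms, of a] vcderiv_wz_sum(2)[OF assms, of b]
    by (subst sum.swap) (simp add: CG_def bil_sum bil_simps sum_distrib_left mult_ac del: vcderiv_nth)
qed

lemma vcderiv_holomorphic_compose:
  assumes "\<xi> differentiable (at (\<phi> z))" "(\<phi> has_derivative \<phi>') (at z)" "complex_linear \<phi>'"
  shows "vcderiv (wz a) (\<lambda>w. \<xi> (\<phi> w)) z = vcderiv (wz (\<phi>' a)) \<xi> (\<phi> z)"
    "vcderiv (bar (wz a)) (\<lambda>w. \<xi> (\<phi> w)) z = vcderiv (bar (wz (\<phi>' a))) \<xi> (\<phi> z)"
  by (simp_all add: vec_eq_iff cderiv_holomorphic_compose[where g="\<lambda>w. \<xi> w $ _", OF differentiable_vec_nth[OF assms(1)] assms(2,3)])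

locale harmonic_setting =
  fixes X :: "'a topology" and A :: "('a, complex^2) chart set"
    and h :: "('a, 2) hmetric"
    and Y :: "'b topology" and B :: "('b, real^'n) chart set"
    and g :: "('b, 'n) rmetric"
    and f :: "'a \<Rightarrow> 'b"
  assumes surface: "complex_surface X A" and compact: "compact_space X"
    and metric: "hermitian_metric A h"
    and target: "smooth_manifold Y B" and rmetric: "riemannian_metric B g"
    and nonpos: "nonpositive_complex_sectional_curvature B g"
    and harmonic: "hermitian_harmonic X A h Y B g f"
begin

lemma MX: "connected_topological_manifold X A"
  using surface by (simp add: complex_surface_def complex_manifold_def)

lemma MY: "connected_topological_manifold Y B"
  using target by (simp add: smooth_manifold_def)

lemma riem_chart: assumes d: "d \<in> B" shows "riem (in_chart g d) (coord d ` cdom d)"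
proof
  show "open (coord d ` cdom d)" by (rule chart_image_open[OF MY d])
  show "smooth_on (coord d ` cdom d) (in_chart g d)"
    using rmetric d by (simp add: riemannian_metric_def)
  fix y assume y: "y \<in> coord d ` cdom d"
  show "in_chart g d y $ i $ j = in_chart g d y $ j $ i" for i j
    using rmetric d coord_param(2)[OF y] unfolding riemannian_metric_def in_chart_def by blast
  show "0 < (\<Sum>i\<in>UNIV. \<Sum>j\<in>UNIV. in_chart g d y $ i $ j * v $ i * v $ j)" if "v \<noteq> 0" for v
    using rmetric d coord_param(2)[OF y] that unfolding riemannian_metric_def in_chart_def by blast
qed

text \<open>The part of the source chart that \<open>f\<close> sends into the target chart
  \<open>d\<close>; there the coordinate expression \<open>u c d\<close> of \<open>f\<close> is
  meaningful.\<close>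

definition W :: "('a, complex^2) chart \<Rightarrow> ('b, real^'n) chart \<Rightarrow> (complex^2) set" where
  "W c d = coord c ` {p \<in> cdom c. f p \<in> cdom d}"

definition u :: "('a, complex^2) chart \<Rightarrow> ('b, real^'n) chart \<Rightarrow> complex^2 \<Rightarrow> real^'n" where
  "u c d = local_rep c d f"

lemma cont_f: "continuous_map X Y f"
  using harmonic by (simp add: hermitian_harmonic_def smooth_map_def)

lemma openin_preimage_f: "d \<in> B \<Longrightarrow> openin X {p \<in> topspace X. f p \<in> cdom d}"
  by (rule openin_continuous_map_preimage[OF cont_f chart_open[OF MY]])

lemma open_W: assumes "c \<in> A" "d \<in> B" shows "open (W c d)"
proof -
  have "cdom c \<inter> {p \<in> topspace X. f p \<in> cdom d} = {p \<in> cdom c. f p \<in> cdom d}"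
    using chart_subset[OF MX assms(1)] by auto
  then show ?thesis
    using chart_openin_image[OF MX assms(1) openin_preimage_f[OF assms(2)]] by (simp add: W_def)
qed

lemma W_subset: "W c d \<subseteq> coord c ` cdom c" by (auto simp: W_def)

lemma W_param:
  assumes "c \<in> A" "z \<in> W c d"
  shows "param c z \<in> cdom c" "f (param c z) \<in> cdom d" "coord c (param c z) = z"
  using assms param_coord[OF MX assms(1)] by (auto simp: W_def)

lemma mem_W_iff: "c \<in> A \<Longrightarrow> z \<in> coord c ` cdom c \<Longrightarrow> z \<in> W c d \<longleftrightarrow> f (param c z) \<in> cdom d"
  by (rule iffI, erule (1) W_param(2), unfold W_def, rule image_eqI[of _ _ "param c z"])
    (simp_all add: coord_param)

lemma u_image: "c \<in> A \<Longrightarrow> u c d ` W c d \<subseteq> coord d ` cdom d"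
  using W_param(2)[of c _ d] by (auto simp: u_def local_rep_def)

lemma u_in: "c \<in> A \<Longrightarrow> z \<in> W c d \<Longrightarrow> u c d z \<in> coord d ` cdom d"
  using u_image by blast

lemma Ck_u: "c \<in> A \<Longrightarrow> d \<in> B \<Longrightarrow> Ck_on k (W c d) (u c d)"
  using harmonic unfolding hermitian_harmonic_def smooth_map_def smooth_on_def W_def u_def by blast

lemma differentiable_u: "c \<in> A \<Longrightarrow> d \<in> B \<Longrightarrow> z \<in> W c d \<Longrightarrow> u c d differentiable (at z)"
  by (rule C1_differentiable[OF Ck_u])

lemma differentiable_cu: "c \<in> A \<Longrightarrow> d \<in> B \<Longrightarrow> z \<in> W c d \<Longrightarrow> (\<lambda>w. cvec (u c d w)) differentiable (at z)"
  by (rule C1_differentiable[OF Ck_on_cvec[OF open_W Ck_u]])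

text \<open>The form \<eta> of the overview on \<open>a\<close> and the conjugate of
  \<open>b\<close>, computed in a chosen pair of charts.\<close>

definition E :: "('a, complex^2) chart \<Rightarrow> ('b, real^'n) chart \<Rightarrow> complex^2 \<Rightarrow> complex^2 \<Rightarrow> complex^2 \<Rightarrow> complex" where
  "E c d z a b = riem.CG (in_chart g d) (u c d z) (vcderiv (wz a) (\<lambda>w. cvec (u c d w)) z)
     (vcderiv (bar (wz b)) (\<lambda>w. cvec (u c d w)) z)"

lemma sesq_E:
  assumes "c \<in> A" "d \<in> B" "z \<in> W c d" shows "sesq (E c d z)"
proof -
  interpret riem "in_chart g d" "coord d ` cdom d" by (rule riem_chart[OF assms(2)])
  show ?thesis using sesq_CG[OF differentiable_cu[OF assms]] unfolding E_def[abs_def] .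
qed

lemma Ck_E:
  assumes "c \<in> A" "d \<in> B" shows "Ck_on k (W c d) (\<lambda>z. E c d z a b)"
proof -
  interpret riem "in_chart g d" "coord d ` cdom d" by (rule riem_chart[OF assms(2)])
  have cu: "Ck_on (Suc k) (W c d) (\<lambda>w. cvec (u c d w))"
    by (rule Ck_on_cvec[OF open_W[OF assms] Ck_u[OF assms]])
  show ?thesis unfolding E_def
    by (intro Ck_CG Ck_u Ck_on_vcderiv cu open_W u_image assms)
qed

definition J :: "('a, complex^2) chart \<Rightarrow> ('a, complex^2) chart \<Rightarrow> complex^2 \<Rightarrow> complex^2 \<Rightarrow> complex^2" where
  "J c c' z = frechet_derivative (transition c c') (at z)"

lemma transition_derivative:
  assumes "c \<in> A" "c' \<in> A" "z \<in> overlap c c'"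
  shows "(transition c c' has_derivative J c c' z) (at z)" "complex_linear (J c c' z)"
proof -
  obtain F where F: "(transition c c' has_derivative F) (at z)" "\<forall>a v. F (a *s v) = a *s F v"
    using surface assms unfolding complex_surface_def complex_manifold_def holomorphic_map_on_def overlap_def
    by blast
  have "J c c' z = F" unfolding J_def using frechet_derivative_at[OF F(1)] by simp
  then show "(transition c c' has_derivative J c c' z) (at z)" "complex_linear (J c c' z)"
    using F by (simp_all add: complex_linear_def)
qed

lemma Ck_transition:
  assumes "c \<in> A" "c' \<in> A" shows "Ck_on k (overlap c c') (transition c c')"
proof -
  have "Ck_on k (overlap c c') (\<lambda>z. transition c c' z $ i)" for i
  proof (rule holomorphic_imp_Ck_on[OF overlap_open[OF MX assms]])
    fix z assume z: "z \<in> overlap c c'"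
    have "((\<lambda>z. transition c c' z $ i) has_derivative (\<lambda>v. J c c' z v $ i)) (at z)"
      using bounded_linear.has_derivative[OF bounded_linear_vec_nth transition_derivative(1)[OF assms z]] .
    then show "\<exists>L. ((\<lambda>z. transition c c' z $ i) has_derivative L) (at z) \<and> (\<forall>a v. L (a *s v) = a * L v)"
      using transition_derivative(2)[OF assms z]
      by (intro exI[of _ "\<lambda>v. J c c' z v $ i"]) (simp add: complex_linear_def)
  qed
  then show ?thesis using Ck_on_componentwise[OF overlap_open[OF MX assms]] by blast
qed

lemma W_transition:
  assumes "c \<in> A" "c' \<in> A" "z \<in> overlap c c'"
  shows "transition c c' z \<in> W c' d \<longleftrightarrow> z \<in> W c d"
  using mem_W_iff[OF assms(1) overlap_param(3)[OF MX assms(1,3)]]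
    mem_W_iff[OF assms(2) overlap_param(3)[OF MX assms(2) transition_in[OF MX assms]]]
  by (simp add: param_transition[OF MX assms])

lemma E_transition:
  assumes c: "c \<in> A" "c' \<in> A" and d: "d \<in> B" and z: "z \<in> overlap c c'" "z \<in> W c d"
  shows "E c d z a b = E c' d (transition c c' z) (J c c' z a) (J c c' z b)"
proof -
  let ?S = "overlap c c'"
  have eq: "u c d w = u c' d (transition c c' w)" if "w \<in> ?S" for w
    using param_transition[OF MX c that] by (simp add: u_def local_rep_def)
  have zW: "transition c c' z \<in> W c' d" using W_transition[OF c z(1)] z(2) by simp
  note d' = differentiable_cu[OF c(2) d zW]
  have "vcderiv p (\<lambda>w. cvec (u c d w)) z = vcderiv p (\<lambda>w. cvec (u c' d (transition c c' w))) z" for p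
    by (rule vcderiv_cong[OF overlap_open[OF MX c] z(1)]) (simp add: eq)
  then show ?thesis
    using vcderiv_holomorphic_compose[OF d' transition_derivative[OF c z(1)]]
    by (simp add: E_def eq[OF z(1)])
qed

text \<open>The transformation law of \<open>g\<close> puts the factors \<open>D\<close> on the
  metric coefficients, the chain rule puts the same factors on the derivatives of the map; the
  equality is a regrouping of the sums.\<close>

lemma E_target:
  assumes c: "c \<in> A" and d: "d \<in> B" "d' \<in> B" and z: "z \<in> W c d" "z \<in> W c d'"
  shows "E c d z a b = E c d' z a b"
proof -
  let ?q = "f (param c z)"
  let ?t = "transition d d'"
  interpret N: riem "in_chart g d" "coord d ` cdom d" by (rule riem_chart[OF d(1)])
  interpret N': riem "in_chart g d'" "coord d' ` cdom d'" by (rule riem_chart[OF d(2)])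
  let ?S = "W c d \<inter> W c d'"
  have oS: "open ?S" using open_W[OF c d(1)] open_W[OF c d(2)] by blast
  have q: "?q \<in> cdom d \<inter> cdom d'" using W_param[OF c z(1)] W_param[OF c z(2)] by simp
  have uz: "u c d z = coord d ?q" "u c d' z = coord d' ?q" by (simp_all add: u_def local_rep_def)
  have pd: "param d (coord d ?q) = ?q" "param d' (coord d' ?q) = ?q"
    using param_coord[OF MY d(1)] param_coord[OF MY d(2)] q by auto
  have eq: "u c d' w = ?t (u c d w)" if "w \<in> ?S" for w
    using W_param(2)[OF c, of w d] that param_coord[OF MY d(1)]
    by (simp add: u_def local_rep_def transition_def)
  define D where "D k i = dreal i (\<lambda>y. ?t y $ k) (coord d ?q)" for k i
  have law: "g d ?q $ i $ j = (\<Sum>k\<in>UNIV. \<Sum>l\<in>UNIV. g d' ?q $ k $ l * D k i * D l j)" for i j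
    using rmetric d q unfolding riemannian_metric_def D_def by blast
  have "smooth_on (overlap d d') ?t"
    using target d by (simp add: smooth_manifold_def overlap_def)
  then have "Ck_on 1 (overlap d d') ?t" by (simp only: smooth_on_def)
  moreover have "coord d ?q \<in> overlap d d'" using q by (auto simp: overlap_def)
  ultimately have dt: "?t differentiable (at (u c d z))" using C1_differentiable uz by metis
  let ?v = "\<lambda>p. vcderiv p (\<lambda>w. cvec (u c d w)) z"
  have ch: "vcderiv p (\<lambda>w. cvec (u c d' w)) z $ k = (\<Sum>i\<in>UNIV. ?v p $ i * of_real (D k i))" for p k
  proof -
    have "vcderiv p (\<lambda>w. cvec (u c d' w)) z = vcderiv p (\<lambda>w. cvec (?t (u c d w))) z"
      by (rule vcderiv_cong[OF oS]) (use z eq in auto)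
    then have "vcderiv p (\<lambda>w. cvec (u c d' w)) z $ k = cderiv p (\<lambda>w. of_real (?t (u c d w) $ k)) z" by simp
    also have "\<dots> = (\<Sum>i\<in>UNIV. ?v p $ i * of_real (dreal i (\<lambda>y. ?t y $ k) (u c d z)))"
      by (rule cderiv_compose_real[OF differentiable_u[OF c d(1) z(1)] differentiable_vec_nth[OF dt]])
    finally show ?thesis by (simp add: D_def uz)
  qed
  let ?a = "?v (wz a)" and ?b = "?v (bar (wz b))"
  have "E c d z a b = (\<Sum>i\<in>UNIV. \<Sum>j\<in>UNIV. of_real (g d ?q $ i $ j) * ?a $ i * ?b $ j)"
    unfolding E_def N.CG_def bil_def by (simp add: in_chart_def uz pd del: vcderiv_nth)
  also have "\<dots> = (\<Sum>i\<in>UNIV. \<Sum>j\<in>UNIV. \<Sum>k\<in>UNIV. \<Sum>l\<in>UNIV.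
      of_real (g d' ?q $ k $ l) * (?a $ i * of_real (D k i)) * (?b $ j * of_real (D l j)))"
    unfolding law by (simp add: sum_distrib_left sum_distrib_right mult_ac del: vcderiv_nth)
  also have "\<dots> = (\<Sum>i\<in>UNIV. \<Sum>k\<in>UNIV. \<Sum>j\<in>UNIV. \<Sum>l\<in>UNIV.
      of_real (g d' ?q $ k $ l) * (?a $ i * of_real (D k i)) * (?b $ j * of_real (D l j)))"
    by (rule sum.cong[OF refl], rule sum.swap)
  also have "\<dots> = (\<Sum>k\<in>UNIV. \<Sum>i\<in>UNIV. \<Sum>l\<in>UNIV. \<Sum>j\<in>UNIV.
      of_real (g d' ?q $ k $ l) * (?a $ i * of_real (D k i)) * (?b $ j * of_real (D l j)))"
    by (rule trans[OF sum.swap], rule sum.cong[OF refl], rule sum.cong[OF refl], rule sum.swap)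
  also have "\<dots> = (\<Sum>k\<in>UNIV. \<Sum>l\<in>UNIV. \<Sum>i\<in>UNIV. \<Sum>j\<in>UNIV.
      of_real (g d' ?q $ k $ l) * (?a $ i * of_real (D k i)) * (?b $ j * of_real (D l j)))"
    by (rule sum.cong[OF refl], rule sum.swap)
  also have "\<dots> = (\<Sum>k\<in>UNIV. \<Sum>l\<in>UNIV. of_real (g d' ?q $ k $ l)
      * (\<Sum>i\<in>UNIV. ?a $ i * of_real (D k i)) * (\<Sum>j\<in>UNIV. ?b $ j * of_real (D l j)))"
    unfolding mult.assoc[of "of_real _"] by (simp only: sum_product) (simp only: sum_distrib_left)
  also have "\<dots> = E c d' z a b"
    unfolding ch[symmetric] E_def N'.CG_def bil_def by (simp add: in_chart_def uz pd del: vcderiv_nth)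
  finally show ?thesis .
qed

text \<open>By \<open>E_target\<close> the choice of the target chart does not matter.\<close>

definition eta :: "('a, complex^2) chart \<Rightarrow> complex^2 \<Rightarrow> complex^2 \<Rightarrow> complex^2 \<Rightarrow> complex" where
  "eta c z = E c (SOME d. d \<in> B \<and> f (param c z) \<in> cdom d) z"

lemma ex_target_chart: assumes "p \<in> topspace X" shows "\<exists>d\<in>B. f p \<in> cdom d"
proof -
  have "f p \<in> topspace Y" using cont_f assms by (auto simp: continuous_map_def)
  then show ?thesis using MY unfolding connected_topological_manifold_def by blast
qed

lemma ex_source_chart: "p \<in> topspace X \<Longrightarrow> \<exists>c\<in>A. p \<in> cdom c"
  using MX unfolding connected_topological_manifold_def by blast

lemma param_in: assumes "c \<in> A" "z \<in> coord c ` cdom c" shows "param c z \<in> topspace X"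
  using coord_param(2)[OF assms(2)] chart_subset[OF MX assms(1)] by blast

lemma ex_W: assumes "c \<in> A" "z \<in> coord c ` cdom c" shows "\<exists>d\<in>B. z \<in> W c d"
  using ex_target_chart[OF param_in[OF assms]] mem_W_iff[OF assms] by blast

lemma eta_eq:
  assumes c: "c \<in> A" and d: "d \<in> B" and z: "z \<in> W c d"
  shows "eta c z = E c d z"
proof -
  let ?d = "SOME d. d \<in> B \<and> f (param c z) \<in> cdom d"
  have "d \<in> B \<and> f (param c z) \<in> cdom d" using d W_param[OF c z] by simp
  then have s: "?d \<in> B \<and> f (param c z) \<in> cdom ?d" by (rule someI)
  then have "z \<in> W c ?d" using mem_W_iff[OF c] W_subset z by blast
  then show ?thesis using E_target[OF c _ d _ z, of ?d] s by (simp add: eta_def fun_eq_iff)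
qed

lemma sesq_eta: assumes "c \<in> A" "z \<in> coord c ` cdom c" shows "sesq (eta c z)"
  using ex_W[OF assms] sesq_E[OF assms(1)] eta_eq[OF assms(1)] by fastforce

lemma Ck_eta: assumes "c \<in> A" shows "Ck_on k (coord c ` cdom c) (\<lambda>z. eta c z a b)"
proof (rule Ck_on_local)
  fix z assume "z \<in> coord c ` cdom c"
  then obtain d where d: "d \<in> B" "z \<in> W c d" using ex_W[OF assms] by blast
  have "Ck_on k (W c d) (\<lambda>z. eta c z a b)"
    using Ck_on_cong[OF open_W[OF assms d(1)], of "\<lambda>z. eta c z a b" "\<lambda>z. E c d z a b"]
      eta_eq[OF assms d(1)] Ck_E[OF assms d(1)] by simp
  then show "\<exists>T. open T \<and> z \<in> T \<and> Ck_on k T (\<lambda>z. eta c z a b)"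
    using open_W[OF assms d(1)] d(2) by blast
qed

lemma eta_transition:
  assumes c: "c \<in> A" "c' \<in> A" and z: "z \<in> overlap c c'"
  shows "eta c z a b = eta c' (transition c c' z) (J c c' z a) (J c c' z b)"
proof -
  obtain d where d: "d \<in> B" "z \<in> W c d"
    using ex_W[OF c(1) overlap_param(3)[OF MX c(1) z]] by blast
  then have "transition c c' z \<in> W c' d" using W_transition[OF c z] by simp
  then show ?thesis
    using E_transition[OF c d(1) z d(2)] eta_eq[OF c(1) d] eta_eq[OF c(2) d(1)] by simp
qed

section \<open>A partition of unity\<close>

text \<open>Two derivatives are what \<open>ddb\<close> takes of a cut-off, and order two is what
  the cubed bumps below provide.\<close>

definition C2X :: "('a \<Rightarrow> real) \<Rightarrow> bool" where
  "C2X \<psi> \<longleftrightarrow> (\<forall>c\<in>A. Ck_on 2 (coord c ` cdom c) (\<lambda>z. \<psi> (param c z)))"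

definition ddb :: "('a, complex^2) chart \<Rightarrow> ('a \<Rightarrow> real) \<Rightarrow> complex^2 \<Rightarrow> complex^2 \<Rightarrow> complex^2 \<Rightarrow> complex" where
  "ddb c \<psi> = levi (\<lambda>z. of_real (\<psi> (param c z)))"

text \<open>The coefficient of the wedge product of \<partial>\<partial>-bar \<psi> with \<eta>,
  that is, the side of Stokes' formula on which the cut-off is differentiated. It is linear in
  \<psi>.\<close>

definition Lam :: "('a, complex^2) chart \<Rightarrow> ('a \<Rightarrow> real) \<Rightarrow> complex^2 \<Rightarrow> complex" where
  "Lam c \<psi> z = mixed_disc (ddb c \<psi> z) (eta c z)"

text \<open>Both forms pull back under the holomorphic transition, so their product changes like a
  density: by the squared modulus of the complex Jacobian, which is the real one.\<close>

lemma Lam_transition: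
  assumes c: "c \<in> A" "c' \<in> A" and z: "z \<in> overlap c c'" and \<psi>: "C2X \<psi>"
  shows "Lam c \<psi> z = of_real ((cmod (jac (J c c' z)))\<^sup>2) * Lam c' \<psi> (transition c c' z)"
proof -
  let ?U = "coord c' ` cdom c'" and ?F = "\<lambda>z. complex_of_real (\<psi> (param c' z))"
  have oU: "open ?U" by (rule chart_image_open[OF MX c(2)])
  have F: "Ck_on 2 ?U ?F" using \<psi> c(2) unfolding C2X_def by (intro Ck_on_of_real oU) auto
  have sub: "transition c c' ` overlap c c' \<subseteq> ?U"
    using transition_image[OF MX c] by (auto simp: overlap_def)
  have zU: "transition c c' z \<in> ?U" using sub z by blast
  have "ddb c \<psi> z a b = ddb c' \<psi> (transition c c' z) (J c c' z a) (J c c' z b)" for a b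
  proof -
    have s1: "ddb c \<psi> z a b = levi (\<lambda>w. ?F (transition c c' w)) z a b"
      unfolding ddb_def
      by (rule levi_cong[OF overlap_open[OF MX c] z]) (simp add: param_transition[OF MX c])
    have s2: "levi (\<lambda>w. ?F (transition c c' w)) z a b = levi ?F (transition c c' z) (J c c' z a) (J c c' z b)"
      by (rule levi_holomorphic_compose[OF overlap_open[OF MX c] z oU sub F transition_derivative[OF c]])
    show ?thesis unfolding s1 s2 by (simp add: ddb_def)
  qed
  then have "Lam c \<psi> z = mixed_disc (\<lambda>a b. ddb c' \<psi> (transition c c' z) (J c c' z a) (J c c' z b))
      (\<lambda>a b. eta c' (transition c c' z) (J c c' z a) (J c c' z b))"
    unfolding Lam_def by (simp add: mixed_disc_def eta_transition[OF c z])
  also have "\<dots> = of_real ((cmod (jac (J c c' z)))\<^sup>2) * Lam c' \<psi> (transition c c' z)"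
    unfolding Lam_def
    by (rule mixed_disc_pullback)
      (use sesq_levi[OF oU zU F] sesq_eta[OF c(2) zU] in \<open>simp_all add: ddb_def\<close>)
  finally show ?thesis .
qed

lemma C2X_closure:
  assumes "C2X \<psi>" "C2X \<psi>'"
  shows "C2X (\<lambda>p. \<psi> p + \<psi>' p)" "(\<And>p. p \<in> topspace X \<Longrightarrow> \<psi>' p \<noteq> 0) \<Longrightarrow> C2X (\<lambda>p. \<psi> p / \<psi>' p)"
  using assms param_in unfolding C2X_def
  by (auto intro!: Ck_on_add Ck_on_divide chart_image_open[OF MX])

lemma C2X_sum: "(\<And>i. i \<in> I \<Longrightarrow> C2X (\<psi> i)) \<Longrightarrow> C2X (\<lambda>p. \<Sum>i\<in>I. \<psi> i p)"
  unfolding C2X_def by (auto intro!: Ck_on_sum chart_image_open[OF MX])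

end

section \<open>A bump function of class C^2\<close>

lemma DERIV_max_power:
  "((\<lambda>t::real. max 0 t ^ Suc (Suc n)) has_field_derivative (of_nat (Suc (Suc n)) * max 0 t ^ Suc n)) (at t)"
proof -
  consider "t > 0" | "t < 0" | "t = 0" by linarith
  then show ?thesis
  proof cases
    case 1
    have "((\<lambda>t::real. t ^ Suc (Suc n)) has_field_derivative (of_nat (Suc (Suc n)) * max 0 t ^ Suc n)) (at t)"
      using 1 DERIV_pow[of "Suc (Suc n)" t UNIV] by (simp add: max_def)
    then show ?thesis
      by (rule has_field_derivative_transform_within_open[of _ _ _ "{0<..}"]) (use 1 in \<open>auto simp: max_def\<close>)
  next
    case 2
    have "((\<lambda>t::real. 0) has_field_derivative (of_nat (Suc (Suc n)) * max 0 t ^ Suc n)) (at t)"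
      using 2 by (simp add: max_def)
    then show ?thesis
      by (rule has_field_derivative_transform_within_open[of _ _ _ "{..<0}"]) (use 2 in \<open>auto simp: max_def\<close>)
  next
    case 3
    \<comment> \<open>At zero the difference quotient is a lower power of the positive part, which
      tends to zero.\<close>
    have "isCont (\<lambda>h::real. max 0 h ^ Suc n) 0" by (intro continuous_intros)
    then have "((\<lambda>h::real. max 0 h ^ Suc n) \<longlongrightarrow> 0) (at 0)" by (simp add: isCont_def)
    then have "((\<lambda>h::real. max 0 h ^ Suc (Suc n) / h) \<longlongrightarrow> 0) (at 0)"
      by (rule Lim_transform_eventually) (auto simp: eventually_at_filter max_def)
    then show ?thesis using 3 by (simp add: DERIV_def)
  qed
qed

lemma Ck_on_DERIV:
  fixes F :: "real \<Rightarrow> real"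
  assumes "\<And>t. (F has_field_derivative F' t) (at t)" "Ck_on k UNIV F'"
  shows "Ck_on (Suc k) UNIV F"
proof -
  have d: "(F has_derivative (*) (F' t)) (at t)" for t using assms(1) by (simp add: has_field_derivative_def)
  have "frechet_derivative F (at t) v = F' t * v" for t v using fun_cong[OF frechet_derivative_at[OF d]] by metis
  moreover have "Ck_on k UNIV (\<lambda>t. F' t * v)" for v using assms(2) by (intro Ck_on_mult) auto
  moreover have "F differentiable (at t)" for t using d[of t] unfolding differentiable_def by blast
  ultimately show ?thesis by (simp add: Ck_on.simps(2))
qed

lemma Ck_max_cube: "Ck_on 2 UNIV (\<lambda>t::real. max 0 t ^ 3)"
proof -
  have "Ck_on 0 UNIV (\<lambda>t::real. of_nat 3 * (of_nat 2 * max 0 t ^ 1))" by (auto intro!: continuous_intros)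
  moreover have "((\<lambda>t::real. of_nat 3 * max 0 t ^ 2) has_field_derivative of_nat 3 * (of_nat 2 * max 0 t ^ 1)) (at t)" for t
    using DERIV_max_power[of 0 t] by (intro DERIV_cmult) (simp add: numeral_2_eq_2)
  ultimately have "Ck_on (Suc 0) UNIV (\<lambda>t::real. of_nat 3 * max 0 t ^ 2)" by (rule Ck_on_DERIV[rotated])
  moreover have "((\<lambda>t::real. max 0 t ^ 3) has_field_derivative of_nat 3 * max 0 t ^ 2) (at t)" for t
    using DERIV_max_power[of 1 t] by (simp add: numeral_3_eq_3 numeral_2_eq_2)
  ultimately have "Ck_on (Suc (Suc 0)) UNIV (\<lambda>t::real. max 0 t ^ 3)" by (rule Ck_on_DERIV[rotated])
  then show ?thesis by (simp add: numeral_2_eq_2)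
qed

text \<open>Cubing the positive part makes it twice continuously differentiable across the sphere of
  radius \<open>r\<close>.\<close>

definition bump :: "complex^2 \<Rightarrow> real \<Rightarrow> complex^2 \<Rightarrow> real" where
  "bump z0 r z = max 0 (r\<^sup>2 - (z - z0) \<bullet> (z - z0)) ^ 3"

lemma bump_props:
  assumes "r > 0"
  shows "Ck_on 2 UNIV (bump z0 r)" "0 \<le> bump z0 r z" "0 < bump z0 r z0" "bump z0 r z \<noteq> 0 \<Longrightarrow> z \<in> cball z0 r"
proof -
  have "Ck_on 2 UNIV (\<lambda>z. r\<^sup>2 - (z - z0) \<bullet> (z - z0))"
    by (intro Ck_on_diff Ck_on_const Ck_on_bilinear[OF _ bounded_bilinear_inner] Ck_on_id) auto
  from Ck_on_compose[OF _ _ _ this Ck_max_cube] show "Ck_on 2 UNIV (bump z0 r)"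
    by (simp add: bump_def[abs_def])
  show "0 \<le> bump z0 r z" "0 < bump z0 r z0" using assms by (simp_all add: bump_def max_def)
  assume "bump z0 r z \<noteq> 0"
  then have "(z - z0) \<bullet> (z - z0) \<le> r\<^sup>2" by (auto simp: bump_def max_def split: if_splits)
  then have "norm (z - z0) \<le> r" using assms by (simp add: power2_norm_eq_inner[symmetric] power2_le_iff_abs_le)
  then show "z \<in> cball z0 r" by (simp add: dist_norm norm_minus_commute)
qed

context harmonic_setting
begin

text \<open>At points of the chart \<open>c\<close> the function is \<open>b\<close> composed with a
  smooth transition map. Any other point has a neighbourhood avoiding the set of points with
  coordinate in \<open>K\<close>, closed by \<open>chart_closedin_compact\<close>, and there the
  function is zero.\<close>

lemma C2X_cutoff:
  assumes c: "c \<in> A" and K: "compact K" "K \<subseteq> coord c ` cdom c" and b: "Ck_on 2 UNIV b"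
    and b0: "\<And>z. z \<notin> K \<Longrightarrow> b z = 0"
  shows "C2X (\<lambda>p. if p \<in> cdom c then b (coord c p) else 0)"
  unfolding C2X_def
proof (intro ballI Ck_on_local)
  fix c' z assume c': "c' \<in> A" and z: "z \<in> coord c' ` cdom c'"
  let ?\<beta> = "\<lambda>p. if p \<in> cdom c then b (coord c p) else 0"
  show "\<exists>T. open T \<and> z \<in> T \<and> Ck_on 2 T (\<lambda>z. ?\<beta> (param c' z))"
  proof (cases "param c' z \<in> cdom c")
    case True
    have "Ck_on 2 (overlap c' c) (\<lambda>w. b (transition c' c w))"
      by (rule Ck_on_compose[OF overlap_open[OF MX c' c] _ _ Ck_transition[OF c' c] b]) auto
    moreover have "?\<beta> (param c' w) = b (transition c' c w)" if "w \<in> overlap c' c" for w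
      using overlap_param[OF MX c' that] by (simp add: transition_def)
    ultimately have "Ck_on 2 (overlap c' c) (\<lambda>z. ?\<beta> (param c' z))"
      using Ck_on_cong[OF overlap_open[OF MX c' c], of "\<lambda>z. ?\<beta> (param c' z)"] by simp
    moreover have "z \<in> overlap c' c"
      using coord_param[OF z] True by (auto simp: overlap_def image_iff intro!: bexI[of _ "param c' z"])
    ultimately show ?thesis using overlap_open[OF MX c' c] by blast
  next
    case False
    let ?L = "{p \<in> cdom c. coord c p \<in> K}"
    let ?T = "coord c' ` (cdom c' \<inter> (topspace X - ?L))"
    have o: "open ?T"
      using chart_closedin_compact[OF MX c K] by (intro chart_openin_image[OF MX c']) (auto intro: openin_diff)
    have "?\<beta> (param c' w) = 0" if "w \<in> ?T" for w
      using that param_coord[OF MX c'] by (auto intro: b0)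
    then have "Ck_on 2 ?T (\<lambda>z. ?\<beta> (param c' z))"
      using Ck_on_cong[OF o, of "\<lambda>z. ?\<beta> (param c' z)" "\<lambda>_. 0"] by simp
    moreover have "z \<in> ?T"
      using coord_param[OF z] False param_in[OF c' z] by (intro image_eqI[of _ _ "param c' z"]) auto
    ultimately show ?thesis using o by blast
  qed
qed

text \<open>Around each point a bump is placed inside a ball contained in some \<open>W c d\<close>;
  by compactness finitely many of the sets where they are positive cover \<open>X\<close>, and each
  bump is divided by their sum. Subordination to source and target charts at once gives \<eta> a
  coordinate expression on each support.\<close>

lemma partition_of_unity:
  obtains I :: "'a set" and cc dd KK and \<chi>\<chi> :: "'a \<Rightarrow> 'a \<Rightarrow> real"
  where "finite I" "\<And>i. i \<in> I \<Longrightarrow> cc i \<in> A" "\<And>i. i \<in> I \<Longrightarrow> dd i \<in> B"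
    "\<And>i. i \<in> I \<Longrightarrow> compact (KK i)" "\<And>i. i \<in> I \<Longrightarrow> KK i \<subseteq> W (cc i) (dd i)"
    "\<And>i. i \<in> I \<Longrightarrow> C2X (\<chi>\<chi> i)" "\<And>i p. i \<in> I \<Longrightarrow> p \<in> topspace X \<Longrightarrow> 0 \<le> \<chi>\<chi> i p"
    "\<And>i p. i \<in> I \<Longrightarrow> p \<in> topspace X \<Longrightarrow> \<chi>\<chi> i p \<noteq> 0 \<Longrightarrow> p \<in> cdom (cc i) \<and> coord (cc i) p \<in> KK i"
    "\<And>p. p \<in> topspace X \<Longrightarrow> (\<Sum>i\<in>I. \<chi>\<chi> i p) = 1"
proof -
  have "\<exists>c d r. c \<in> A \<and> d \<in> B \<and> p \<in> cdom c \<and> 0 < r \<and> cball (coord c p) r \<subseteq> W c d" if pX: "p \<in> topspace X" for p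
  proof -
    obtain c d where chs: "c \<in> A" "p \<in> cdom c" "d \<in> B" "f p \<in> cdom d"
      using ex_source_chart[OF pX] ex_target_chart[OF pX] by blast
    then have "coord c p \<in> W c d" by (auto simp: W_def)
    then obtain r where "0 < r" "cball (coord c p) r \<subseteq> W c d"
      using open_W[OF chs(1,3)] open_contains_cball by blast
    then show ?thesis using chs by blast
  qed
  then obtain cc dd rr where *: "\<And>p. p \<in> topspace X \<Longrightarrow>
      cc p \<in> A \<and> dd p \<in> B \<and> p \<in> cdom (cc p) \<and> 0 < rr p \<and> cball (coord (cc p) p) (rr p) \<subseteq> W (cc p) (dd p)"
    by metis
  define KK where "KK p = cball (coord (cc p) p) (rr p)" for p
  define \<beta> where "\<beta> p x = (if x \<in> cdom (cc p) then bump (coord (cc p) p) (rr p) (coord (cc p) x) else 0)" for p x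
  have \<beta>C: "C2X (\<beta> p)" if "p \<in> topspace X" for p
    unfolding \<beta>_def
    using *[OF that] W_subset[of "cc p" "dd p"] bump_props(1,4)[of "rr p"]
    by (intro C2X_cutoff[of _ "KK p"]) (auto simp: KK_def)
  have \<beta>n: "0 \<le> \<beta> p x" if "p \<in> topspace X" for p x
    using *[OF that] bump_props(2) by (simp add: \<beta>_def)
  have \<beta>p: "0 < \<beta> p p" if "p \<in> topspace X" for p
    using *[OF that] bump_props(3) by (simp add: \<beta>_def)
  have \<beta>K: "x \<in> cdom (cc p) \<and> coord (cc p) x \<in> KK p" if "p \<in> topspace X" "\<beta> p x \<noteq> 0" for p x
    using *[OF that(1)] bump_props(4) that(2) by (auto simp: \<beta>_def KK_def split: if_splits)
  define O' where "O' p = {x \<in> cdom (cc p). coord (cc p) x \<in> {z. 0 < bump (coord (cc p) p) (rr p) z}}" for p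
  have oO: "openin X (O' p)" if "p \<in> topspace X" for p
  proof -
    have "continuous_on UNIV (bump (coord (cc p) p) (rr p))"
      using bump_props(1)[of "rr p"] *[OF that] Ck_on_imp_continuous by blast
    then have "open {z. 0 < bump (coord (cc p) p) (rr p) z}"
      by (intro open_Collect_less continuous_on_const)
    then show ?thesis unfolding O'_def using chart_openin_vimage[OF MX] *[OF that] by blast
  qed
  have "\<exists>\<F>. finite \<F> \<and> \<F> \<subseteq> O' ` topspace X \<and> topspace X \<subseteq> \<Union>\<F>"
  proof -
    have "topspace X \<subseteq> \<Union>(O' ` topspace X)"
      using \<beta>p * bump_props(3) unfolding O'_def by fastforce
    then show ?thesis using compact oO unfolding compact_space_alt by (metis (no_types, lifting) imageE)
  qed
  then obtain I where I: "finite I" "I \<subseteq> topspace X" "topspace X \<subseteq> (\<Union>p\<in>I. O' p)"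
    by (metis finite_subset_image)
  define \<sigma> where "\<sigma> x = (\<Sum>p\<in>I. \<beta> p x)" for x
  have \<sigma>p: "0 < \<sigma> x" if x: "x \<in> topspace X" for x
  proof -
    obtain p where p: "p \<in> I" "x \<in> O' p" using I x by blast
    then have "0 < \<beta> p x" by (simp add: O'_def \<beta>_def)
    then show ?thesis unfolding \<sigma>_def using p I \<beta>n by (intro sum_pos2[OF I(1) p(1)]) auto
  qed
  have \<sigma>C: "C2X \<sigma>" unfolding \<sigma>_def using \<beta>C I(2) by (intro C2X_sum) auto
  define \<chi>\<chi> where "\<chi>\<chi> p x = \<beta> p x / \<sigma> x" for p x
  show thesis
  proof (rule that[of I cc dd KK \<chi>\<chi>])
    fix i assume i: "i \<in> I"
    then have iX: "i \<in> topspace X" using I(2) by blast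
    show "cc i \<in> A" "dd i \<in> B" "compact (KK i)" "KK i \<subseteq> W (cc i) (dd i)"
      using *[OF iX] by (simp_all add: KK_def)
    show "C2X (\<chi>\<chi> i)" unfolding \<chi>\<chi>_def using \<sigma>p by (intro C2X_closure \<beta>C iX \<sigma>C) (auto simp: less_imp_neq[symmetric])
    fix p assume p: "p \<in> topspace X"
    show "0 \<le> \<chi>\<chi> i p" using \<beta>n[OF iX] \<sigma>p[OF p] by (simp add: \<chi>\<chi>_def)
    show "p \<in> cdom (cc i) \<and> coord (cc i) p \<in> KK i" if "\<chi>\<chi> i p \<noteq> 0"
      using that \<beta>K[OF iX] by (auto simp: \<chi>\<chi>_def)
  next
    fix p assume p: "p \<in> topspace X"
    show "(\<Sum>i\<in>I. \<chi>\<chi> i p) = 1"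
      unfolding \<chi>\<chi>_def sum_divide_distrib[symmetric] \<sigma>_def[symmetric] using \<sigma>p[OF p] by simp
  qed (use I in auto)
qed

end

section \<open>Hermitian harmonic maps on compact surfaces are pluriharmonic\<close>

text \<open>Positivity makes the diagonal entries and the determinant positive; the inverse is the
  adjugate over the determinant and is positive definite again. Transposing it only swaps the two
  conjugate off-diagonal entries.\<close>

lemma hinv_pos_def_2:
  fixes H :: "complex^2^2"
  assumes herm: "\<And>\<alpha> \<beta>. H $ \<alpha> $ \<beta> = cnj (H $ \<beta> $ \<alpha>)"
    and pos: "\<And>v. v \<noteq> 0 \<Longrightarrow> 0 < Re (\<Sum>\<alpha>\<in>UNIV. \<Sum>\<beta>\<in>UNIV. H $ \<alpha> $ \<beta> * v $ \<alpha> * cnj (v $ \<beta>))"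
  obtains k11 k12 k22 where "0 < k11" "(cmod k12)\<^sup>2 < k11 * k22"
    "hinv H $ 1 $ 1 = of_real k11" "hinv H $ 1 $ 2 = k12" "hinv H $ 2 $ 1 = cnj k12" "hinv H $ 2 $ 2 = of_real k22"
proof -
  define a where "a = Re (H $ 1 $ 1)"
  define d where "d = Re (H $ 2 $ 2)"
  define b where "b = H $ 1 $ 2"
  have H: "H $ 1 $ 1 = of_real a" "H $ 2 $ 2 = of_real d" "H $ 1 $ 2 = b" "H $ 2 $ 1 = cnj b"
    using herm[of 1 1] herm[of 2 2] herm[of 2 1] by (auto simp: a_def d_def b_def complex_eq_iff)
  have a: "0 < a" using pos[of "axis 1 1"] by (simp add: sum_2 H axis_def vec_eq_iff forall_2)
  have d: "0 < d" using pos[of "axis 2 1"] by (simp add: sum_2 H axis_def vec_eq_iff forall_2)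
  have bb: "b * cnj b = of_real ((cmod b)\<^sup>2)" by (rule complex_norm_square[symmetric])
  \<comment> \<open>On this vector the form takes the value \<open>a\<close> times the determinant,
    so positivity there is positivity of the determinant.\<close>
  define v :: "complex^2" where "v = (\<chi> i. if i = 1 then - cnj b else of_real a)"
  have "v \<noteq> 0" using a by (auto simp: v_def vec_eq_iff forall_2)
  have "(\<Sum>\<alpha>\<in>UNIV. \<Sum>\<beta>\<in>UNIV. H $ \<alpha> $ \<beta> * v $ \<alpha> * cnj (v $ \<beta>))
      = of_real a * (of_real (a * d) - b * cnj b)"
    by (simp add: sum_2 H v_def algebra_simps)
  then have "0 < Re (of_real a * (of_real (a * d) - b * cnj b))" using pos[OF \<open>v \<noteq> 0\<close>] by simp
  also have "of_real a * (of_real (a * d) - b * cnj b) = complex_of_real (a * (a * d - (cmod b)\<^sup>2))"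
    unfolding bb by simp
  finally have D: "0 < a * d - (cmod b)\<^sup>2" using a by (simp add: zero_less_mult_iff)
  define D where "D = a * d - (cmod b)\<^sup>2"
  have D0: "0 < D" using D by (simp add: D_def)
  have Dc: "complex_of_real D = of_real a * of_real d - b * cnj b" unfolding bb by (simp add: D_def)
  define N :: "complex^2^2" where
    "N = (\<chi> i j. if i = 1 then if j = 1 then of_real d / of_real D else - b / of_real D
        else if j = 1 then - cnj b / of_real D else of_real a / of_real D)"
  have Dn: "complex_of_real D \<noteq> 0" using D0 by simp
  have "of_real a * of_real d / complex_of_real D - b * cnj b / of_real D = 1"
    unfolding diff_divide_distrib[symmetric] using Dn Dc by simp
  then have HN: "H ** N = mat 1"
    by (simp add: vec_eq_iff forall_2 matrix_matrix_mult_def sum_2 mat_def N_def H mult_ac)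
  then have inv: "invertible H" unfolding invertible_def using matrix_left_right_inverse by blast
  have "matrix_inv H ** H = mat 1" using matrix_inv_right[OF inv] matrix_left_right_inverse by blast
  then have "matrix_inv H = N" using HN by (metis matrix_mul_assoc matrix_mul_lid matrix_mul_rid)
  then have K: "hinv H = transpose N" by (simp add: hinv_def)
  have "(cmod (- cnj b / of_real D))\<^sup>2 < (d / D) * (a / D)"
    using D D0 by (simp add: norm_divide power_divide field_simps power2_eq_square)
  then show thesis
    using that[of "d / D" "- cnj b / of_real D" "a / D"] d D0
    by (simp add: K N_def transpose_def)
qed

lemma overlapI:
  assumes "z \<in> coord c ` cdom c" "param c z \<in> cdom c'" shows "z \<in> overlap c c'"
  unfolding overlap_def using coord_param[OF assms(1)] assms(2)
  by (intro image_eqI[of _ _ "param c z"]) simp_all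

lemma levi_const [simp]:
  fixes z :: "complex^'m"
  shows "levi (\<lambda>_. c) z a b = 0"
proof -
  have "cderiv p (\<lambda>_. c) = (\<lambda>_. 0)" for p :: "(complex^'m) \<times> (complex^'m)" by (rule ext) simp
  then show ?thesis by (simp add: levi_def)
qed

lemma continuous_zero_extension:
  assumes "open U" "compact K" "K \<subseteq> U" "continuous_on U F" "\<And>z. z \<notin> K \<Longrightarrow> F z = (0::'b::real_normed_vector)"
  shows "continuous_on UNIV (F :: 'e::euclidean_space \<Rightarrow> 'b)"
proof -
  have "continuous_on (- K) F"
    by (rule continuous_on_eq[OF continuous_on_const[of "- K" 0]]) (simp add: assms(5))
  moreover have "U \<union> - K = UNIV" using assms(3) by auto
  moreover have "open (- K)" using assms(2) compact_imp_closed by blast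
  ultimately show ?thesis using continuous_on_open_Un[OF assms(1) _ assms(4)] by metis
qed

text \<open>The integral reduces to a box around the support. For the second claim the box is chosen
  to contain the given point as well, and a nonnegative continuous function with zero integral over
  it vanishes there.\<close>

lemma compact_support_integrable:
  fixes F :: "complex^2 \<Rightarrow> real"
  assumes "continuous_on UNIV F" "compact K" "\<And>z. z \<notin> K \<Longrightarrow> F z = 0"
  shows "(\<lambda>x. F (r2c x)) absolutely_integrable_on UNIV"
    and "(\<And>z. 0 \<le> F z) \<Longrightarrow> ((\<lambda>x. F (r2c x)) has_integral 0) UNIV \<Longrightarrow> F z = 0"
proof -
  let ?G = "\<lambda>x. F (r2c x)"
  have c: "continuous_on S ?G" for S
    by (rule continuous_on_compose2[OF assms(1) linear_continuous_on[OF bounded_linear_r2c]]) auto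
  obtain a where a: "insert (c2r z) (c2r ` K) \<subseteq> box (-a) a"
    using bounded_subset_box_symmetric[of "insert (c2r z) (c2r ` K)"] compact_c2r[OF assms(2)] compact_imp_bounded by auto
  have z: "?G x = 0" if "x \<notin> box (-a) a" for x
    using a that assms(3)[of "r2c x"] by (auto simp: c2r_image)
  have sub: "box (-a) a \<subseteq> cbox (-a) a" by (rule box_subset_cbox)
  have "?G absolutely_integrable_on cbox (-a) a"
    by (rule absolutely_integrable_continuous[OF c])
  then have "(\<lambda>x. if x \<in> cbox (-a) a then ?G x else 0) absolutely_integrable_on UNIV"
    by (simp only: absolutely_integrable_restrict_UNIV)
  moreover have "(\<lambda>x. if x \<in> cbox (-a) a then ?G x else 0) = ?G" using z sub by (auto simp: fun_eq_iff)
  ultimately show "?G absolutely_integrable_on UNIV" by simp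
  assume nn: "\<And>z. 0 \<le> F z" and i: "(?G has_integral 0) UNIV"
  have "(?G has_integral 0) (cbox (-a) a)"
    using has_integral_zero_outside[of "cbox (-a) a" ?G "cbox (-a) a" 0] z sub i by blast
  moreover have zin: "c2r z \<in> box (-a) a" using a by simp
  ultimately have "?G (c2r z) = 0"
    using has_integral_0_cbox_imp_0[OF c _ _ _] nn sub by (metis empty_iff subsetD)
  then show "F z = 0" by simp
qed

context harmonic_setting
begin

abbreviation ez :: "2 \<Rightarrow> (complex^2) \<times> (complex^2)" where
  "ez \<alpha> \<equiv> wz (axis \<alpha> 1)"

text \<open>\<open>hess c d \<alpha> \<beta>\<close> is the \<open>(\<alpha>, \<beta>)\<close> entry (\<open>\<beta>\<close> barred) of the \<open>(1,1)\<close>-part of the Hessian of \<open>f\<close>,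
  whose \<open>h\<close>-trace is the Hermitian harmonic map operator.\<close>

definition hess :: "('a, complex^2) chart \<Rightarrow> ('b, real^'n) chart \<Rightarrow> 2 \<Rightarrow> 2 \<Rightarrow> complex^2 \<Rightarrow> complex^'n" where
  "hess c d \<alpha> \<beta> z = riem.nab (in_chart g d) (bar (ez \<beta>)) (u c d) (vcderiv (ez \<alpha>) (\<lambda>w. cvec (u c d w))) z"

text \<open>The coefficient of \<open>\<partial>\<close>\<open>\<partial>\<close>-bar of the \<open>(1,1)\<close>-form \<open>eta\<close>; its integral against a cut-off \<open>\<psi>\<close> is that of
  \<open>Lam c \<psi>\<close>.\<close>

definition Th :: "('a, complex^2) chart \<Rightarrow> ('b, real^'n) chart \<Rightarrow> complex^2 \<Rightarrow> complex" where
  "Th c d z = levi (\<lambda>w. E c d w (axis 2 1) (axis 2 1)) z (axis 1 1) (axis 1 1)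
    + levi (\<lambda>w. E c d w (axis 1 1) (axis 1 1)) z (axis 2 1) (axis 2 1)
    - levi (\<lambda>w. E c d w (axis 2 1) (axis 1 1)) z (axis 1 1) (axis 2 1)
    - levi (\<lambda>w. E c d w (axis 1 1) (axis 2 1)) z (axis 2 1) (axis 1 1)"

lemma nonpos_at_chart:
  assumes "d \<in> B" "y \<in> coord d ` cdom d"
  shows "riem.nonpos_at (in_chart g d) y"
proof -
  interpret riem "in_chart g d" "coord d ` cdom d" by (rule riem_chart[OF assms(1)])
  show ?thesis
    using nonpos assms unfolding nonpos_at_def nonpositive_complex_sectional_curvature_def by auto
qed

text \<open>Rewrites the harmonic map equation in terms of \<open>hess\<close>. The equation applies
  \<open>dzbar\<close> before \<open>dz\<close>, the Hessian uses the opposite order, hence the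
  appeal to \<open>cderiv_commute\<close>.\<close>

lemma hess_trace:
  assumes c: "c \<in> A" and d: "d \<in> B" and z: "z \<in> W c d"
  shows "(\<Sum>\<alpha>\<in>UNIV. \<Sum>\<beta>\<in>UNIV. hinv (h c (param c z)) $ \<alpha> $ \<beta> *s hess c d \<alpha> \<beta> z) = 0"
proof -
  interpret riem "in_chart g d" "coord d ` cdom d" by (rule riem_chart[OF d])
  let ?p = "param c z" and ?F = "\<lambda>i w. complex_of_real (local_rep c d f w $ i)"
  have oW: "open (W c d)" by (rule open_W[OF c d])
  have p: "?p \<in> cdom c" "f ?p \<in> cdom d" "coord c ?p = z" using W_param[OF c z] by auto
  have Fu: "?F i = (\<lambda>w. cvec (u c d w) $ i)" for i by (simp add: u_def)
  have C2: "Ck_on 2 (W c d) (?F i)" for i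
    unfolding Fu by (rule Ck_on_linear_comp[OF oW bounded_linear_vec_nth Ck_on_cvec[OF oW Ck_u[OF c d]]])
  have dF: "?F i differentiable (at w)" if "w \<in> W c d" for i w
    by (rule C1_differentiable[OF C2_cderiv(2)[OF oW C2] that])
  have 1: "dz \<alpha> (?F i) w = cderiv (ez \<alpha>) (?F i) w" "dzbar \<alpha> (?F i) w = cderiv (bar (ez \<alpha>)) (?F i) w"
    if "w \<in> W c d" for \<alpha> i w
    using cderiv_wz_axis[OF dF[OF that]] by simp_all
  have 2: "dz \<alpha> (dzbar \<beta> (?F i)) z = cderiv (bar (ez \<beta>)) (cderiv (ez \<alpha>) (?F i)) z" for \<alpha> \<beta> i
  proof -
    have "cderiv (bar (ez \<beta>)) (?F i) differentiable (at z)"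
      by (rule C1_differentiable[OF C2_cderiv(1)[OF oW C2] z])
    moreover have "dzbar \<beta> (?F i) differentiable (at z) \<longleftrightarrow> cderiv (bar (ez \<beta>)) (?F i) differentiable (at z)"
      by (rule differentiable_cong_open[OF oW z 1(2)])
    ultimately have "dz \<alpha> (dzbar \<beta> (?F i)) z = cderiv (ez \<alpha>) (dzbar \<beta> (?F i)) z"
      using cderiv_wz_axis(1) by metis
    also have "\<dots> = cderiv (ez \<alpha>) (cderiv (bar (ez \<beta>)) (?F i)) z"
      by (rule cderiv_cong[OF oW z 1(2)])
    also have "\<dots> = cderiv (bar (ez \<beta>)) (cderiv (ez \<alpha>) (?F i)) z"
      by (rule cderiv_commute[OF oW z C2])
    finally show ?thesis .
  qed
  have hs: "hess c d \<alpha> \<beta> z $ i = dz \<alpha> (dzbar \<beta> (?F i)) z + (\<Sum>j\<in>UNIV. \<Sum>k\<in>UNIV.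
      of_real (christoffel (in_chart g d) i j k (coord d (f ?p))) * dzbar \<beta> (?F j) z * dz \<alpha> (?F k) z)" for \<alpha> \<beta> i
    unfolding 2 1[OF z] by (simp add: hess_def nab_def Gam_def bil_def u_def local_rep_def)
  have "(\<Sum>\<alpha>\<in>UNIV. \<Sum>\<beta>\<in>UNIV. hinv (h c ?p) $ \<alpha> $ \<beta> * hess c d \<alpha> \<beta> z $ i) = 0" for i
    unfolding hs
    by (rule harmonic[unfolded hermitian_harmonic_def, THEN conjunct2, THEN bspec, OF c, THEN bspec, OF d,
          THEN bspec, OF p(1), THEN mp, OF p(2), unfolded Let_def p(3), THEN spec])
  then show ?thesis by (simp add: vec_eq_iff)
qed

text \<open>\<open>theta_nonneg\<close> for the two coordinate directions, weighted by the entries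
  of the inverse of \<open>h\<close>; \<open>hess_trace\<close> is its trace hypothesis and
  \<open>hinv_pos_def_2\<close> its positivity hypothesis.\<close>

lemma Th_nonneg:
  assumes c: "c \<in> A" and d: "d \<in> B" and z: "z \<in> W c d"
  shows "0 \<le> Re (Th c d z)" and "Re (Th c d z) \<le> 0 \<Longrightarrow> hess c d \<alpha> \<beta> z = 0"
proof -
  interpret riem "in_chart g d" "coord d ` cdom d" by (rule riem_chart[OF d])
  let ?p = "param c z"
  have p: "?p \<in> cdom c" using W_param[OF c z] by auto
  have "\<And>\<alpha> \<beta>. h c ?p $ \<alpha> $ \<beta> = cnj (h c ?p $ \<beta> $ \<alpha>)"
    and "\<And>v. v \<noteq> 0 \<Longrightarrow> 0 < Re (\<Sum>\<alpha>\<in>UNIV. \<Sum>\<beta>\<in>UNIV. h c ?p $ \<alpha> $ \<beta> * v $ \<alpha> * cnj (v $ \<beta>))"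
    using metric c p unfolding hermitian_metric_def by blast+
  from hinv_pos_def_2[OF this] obtain k11 k12 k22 where k: "0 < k11" "(cmod k12)\<^sup>2 < k11 * k22"
    "hinv (h c ?p) $ 1 $ 1 = of_real k11" "hinv (h c ?p) $ 1 $ 2 = k12" "hinv (h c ?p) $ 2 $ 1 = cnj k12"
    "hinv (h c ?p) $ 2 $ 2 = of_real k22" by metis
  have tr: "of_real k11 *s hess c d 1 1 z + k12 *s hess c d 1 2 z + cnj k12 *s hess c d 2 1 z
      + of_real k22 *s hess c d 2 2 z = 0"
    using hess_trace[OF c d z] by (simp add: sum_2 k add.assoc)
  note T = theta_nonneg[OF open_W[OF c d] z u_image[OF c] Ck_u[OF c d] nonpos_at_chart[OF d u_in[OF c z]] k(1,2),
      of "ez 1" "ez 2", folded hess_def, OF tr]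
  have Th: "Th c d z = cderiv (ez 1) (cderiv (bar (ez 1)) (\<lambda>w. E c d w (axis 2 1) (axis 2 1))) z
     + cderiv (ez 2) (cderiv (bar (ez 2)) (\<lambda>w. E c d w (axis 1 1) (axis 1 1))) z
     - cderiv (ez 1) (cderiv (bar (ez 2)) (\<lambda>w. E c d w (axis 2 1) (axis 1 1))) z
     - cderiv (ez 2) (cderiv (bar (ez 1)) (\<lambda>w. E c d w (axis 1 1) (axis 2 1))) z"
    by (simp add: Th_def levi_def)
  show "0 \<le> Re (Th c d z)" unfolding Th E_def by (rule T(1))
  assume "Re (Th c d z) \<le> 0"
  then have "hess c d 1 1 z = 0 \<and> hess c d 1 2 z = 0 \<and> hess c d 2 1 z = 0 \<and> hess c d 2 2 z = 0"
    unfolding Th E_def by (rule T(2))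
  then show "hess c d \<alpha> \<beta> z = 0" using exhaust_2[of \<alpha>] exhaust_2[of \<beta>] by auto
qed

lemma Ck_Th: assumes "c \<in> A" "d \<in> B" shows "Ck_on k (W c d) (Th c d)"
  unfolding Th_def[abs_def] levi_def
  by (intro Ck_on_diff Ck_on_add Ck_on_cderiv Ck_E open_W assms)

lemma Ck_Lam:
  assumes "c \<in> A" "C2X \<psi>" shows "continuous_on (coord c ` cdom c) (Lam c \<psi>)"
proof -
  let ?U = "coord c ` cdom c"
  have o: "open ?U" by (rule chart_image_open[OF MX assms(1)])
  have "Ck_on (Suc (Suc 0)) ?U (\<lambda>z. complex_of_real (\<psi> (param c z)))"
    using assms unfolding C2X_def by (intro Ck_on_of_real o) (simp add: numeral_2_eq_2)
  then have "Ck_on 0 ?U (\<lambda>z. ddb c \<psi> z a b)" for a b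
    unfolding ddb_def levi_def by (intro Ck_on_cderiv o)
  then have "Ck_on 0 ?U (Lam c \<psi>)"
    unfolding Lam_def[abs_def] mixed_disc_def
    by (intro Ck_on_diff Ck_on_add Ck_on_mult Ck_eta o assms)
  then show ?thesis by simp
qed

lemma Lam_zero_near:
  assumes "c \<in> A" "open S" "z \<in> S" "\<And>w. w \<in> S \<Longrightarrow> \<psi> (param c w) = 0"
  shows "Lam c \<psi> z = 0"
proof -
  have "ddb c \<psi> z a b = levi (\<lambda>_. 0) z a b" for a b
    unfolding ddb_def by (rule levi_cong[OF assms(2,3)]) (simp add: assms(4))
  then show ?thesis by (simp add: Lam_def mixed_disc_def)
qed

text \<open>\<open>Lam\<close> is linear in the cut-off, and the sum of the cut-offs is the constant
  1, which \<partial>\<partial>-bar kills.\<close>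

lemma Lam_sum:
  assumes c: "c \<in> A" and z: "z \<in> coord c ` cdom c" and fin: "finite I"
    and \<psi>: "\<And>i. i \<in> I \<Longrightarrow> C2X (\<psi> i)" and one: "\<And>p. p \<in> topspace X \<Longrightarrow> (\<Sum>i\<in>I. \<psi> i p) = 1"
  shows "(\<Sum>i\<in>I. Lam c (\<psi> i) z) = 0"
proof -
  let ?U = "coord c ` cdom c"
  have o: "open ?U" by (rule chart_image_open[OF MX c])
  have C: "Ck_on 2 ?U (\<lambda>z. complex_of_real (\<psi> i (param c z)))" if "i \<in> I" for i
    using \<psi>[OF that] c unfolding C2X_def by (intro Ck_on_of_real o) auto
  have d1: "(\<lambda>z. complex_of_real (\<psi> i (param c z))) differentiable (at w)" if "i \<in> I" "w \<in> ?U" for i w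
    by (rule C1_differentiable[OF C2_cderiv(2)[OF o C[OF that(1)]] that(2)])
  have d2: "cderiv p (\<lambda>z. complex_of_real (\<psi> i (param c z))) differentiable (at z)" if "i \<in> I" for i p
    by (rule C1_differentiable[OF C2_cderiv(1)[OF o C[OF that]] z])
  have "(\<Sum>i\<in>I. ddb c (\<psi> i) z a b) = 0" for a b
  proof -
    have "(\<Sum>i\<in>I. ddb c (\<psi> i) z a b)
        = cderiv (wz a) (\<lambda>w. \<Sum>i\<in>I. cderiv (bar (wz b)) (\<lambda>z. complex_of_real (\<psi> i (param c z))) w) z"
      unfolding ddb_def levi_def by (rule cderiv_sum[symmetric]) (rule d2)
    also have "\<dots> = cderiv (wz a) (\<lambda>w. 0) z"
    proof (rule cderiv_cong[OF o z])
      fix w assume w: "w \<in> ?U"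
      have "(\<Sum>i\<in>I. cderiv (bar (wz b)) (\<lambda>z. complex_of_real (\<psi> i (param c z))) w)
        = cderiv (bar (wz b)) (\<lambda>z. \<Sum>i\<in>I. complex_of_real (\<psi> i (param c z))) w"
        by (rule cderiv_sum[symmetric]) (rule d1[OF _ w])
      also have "\<dots> = cderiv (bar (wz b)) (\<lambda>z. 1) w"
        by (rule cderiv_cong[OF o w]) (simp only: of_real_sum[symmetric] one[OF param_in[OF c]] of_real_1)
      finally show "(\<Sum>i\<in>I. cderiv (bar (wz b)) (\<lambda>z. complex_of_real (\<psi> i (param c z))) w) = 0" by simp
    qed
    finally show ?thesis by simp
  qed
  then have s: "(\<Sum>i\<in>I. ddb c (\<psi> i) z a b * t) = 0" for a b t
    by (simp add: sum_distrib_right[symmetric])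
  show ?thesis unfolding Lam_def mixed_disc_def by (simp add: sum.distrib sum_subtractf s)
qed

text \<open>\<open>integration_by_parts\<close> is applied to each of the four terms of
  \<open>Th\<close>; the derivatives that land on \<psi> assemble to a \<open>mixed_disc\<close>.
  Outside \<open>K\<close> the cut-off, extended by zero, is locally zero, so both integrands
  vanish.\<close>

lemma Lam_integral:
  assumes c: "c \<in> A" and d: "d \<in> B" and K: "compact K" "K \<subseteq> W c d" and \<psi>: "C2X \<psi>"
    and \<psi>0: "\<And>p. p \<in> cdom c \<Longrightarrow> coord c p \<notin> K \<Longrightarrow> \<psi> p = 0"
  shows "((\<lambda>x. Re ((if r2c x \<in> coord c ` cdom c then of_real (\<psi> (param c (r2c x))) else 0) * Th c d (r2c x))
      - (if r2c x \<in> coord c ` cdom c then Re (Lam c \<psi> (r2c x)) else 0)) has_integral 0) UNIV"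
proof -
  let ?U = "coord c ` cdom c"
  let ?\<psi> = "\<lambda>z. if z \<in> ?U then complex_of_real (\<psi> (param c z)) else 0"
  have oU: "open ?U" by (rule chart_image_open[OF MX c])
  have oW: "open (W c d)" by (rule open_W[OF c d])
  have z0: "?\<psi> z = 0" if "z \<notin> K" for z
    using \<psi>0[of "param c z"] coord_param[of z c] that by auto
  have "Ck_on 2 ?U (\<lambda>z. complex_of_real (\<psi> (param c z)))"
    using \<psi> c unfolding C2X_def by (intro Ck_on_of_real oU) auto
  then have "Ck_on 2 ?U ?\<psi>" using Ck_on_cong[OF oU, of ?\<psi>] by simp
  then have C\<psi>: "Ck_on 2 (W c d) ?\<psi>" using Ck_on_subset W_subset by blast
  have P: "((\<lambda>x. ?\<psi> (r2c x) * levi (\<lambda>w. E c d w a b) (r2c x) v v' - levi ?\<psi> (r2c x) v v' * E c d (r2c x) a b)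
      has_integral 0) UNIV" for a b v v'
    unfolding levi_def by (rule integration_by_parts[OF oW K z0 C\<psi> Ck_E[OF c d]])
  let ?e1 = "axis 1 1 :: complex^2" and ?e2 = "axis 2 1 :: complex^2"
  have "((\<lambda>x. ?\<psi> (r2c x) * Th c d (r2c x) - mixed_disc (levi ?\<psi> (r2c x)) (E c d (r2c x))) has_integral 0 + 0 - 0 - 0) UNIV"
    by (rule has_integral_eq[OF _ has_integral_diff[OF has_integral_diff[OF has_integral_add
            [OF P[of ?e2 ?e2 ?e1 ?e1] P[of ?e1 ?e1 ?e2 ?e2]] P[of ?e2 ?e1 ?e1 ?e2]] P[of ?e1 ?e2 ?e2 ?e1]]])
      (simp add: Th_def mixed_disc_def algebra_simps)
  then have I: "((\<lambda>x. Re (?\<psi> (r2c x) * Th c d (r2c x) - mixed_disc (levi ?\<psi> (r2c x)) (E c d (r2c x)))) has_integral 0) UNIV"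
    using has_integral_linear[OF _ bounded_linear_Re, of _ 0 UNIV] by (fastforce simp: o_def)
  have "Re (mixed_disc (levi ?\<psi> z) (E c d z)) = (if z \<in> ?U then Re (Lam c \<psi> z) else 0)" for z
  proof (cases "z \<in> K")
    case True
    then have z: "z \<in> W c d" "z \<in> ?U" using K W_subset by blast+
    have "levi ?\<psi> z a b = ddb c \<psi> z a b" for a b
      unfolding ddb_def by (rule levi_cong[OF oU z(2)]) simp
    then show ?thesis using z eta_eq[OF c d z(1)] by (simp add: Lam_def mixed_disc_def)
  next
    case False
    have oK: "open (- K)" using K(1) compact_imp_closed by blast
    have "levi ?\<psi> z a b = levi (\<lambda>_. 0) z a b" for a b
      by (rule levi_cong[OF oK]) (use False z0 in auto)
    then have "levi ?\<psi> z a b = 0" for a b by simp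
    moreover have "Lam c \<psi> z = 0" if "z \<in> ?U"
    proof (rule Lam_zero_near[OF c])
      show "open (?U \<inter> - K)" using oU oK by blast
      show "z \<in> ?U \<inter> - K" using that False by blast
      show "\<psi> (param c w) = 0" if "w \<in> ?U \<inter> - K" for w
        using \<psi>0[of "param c w"] coord_param[of w c] that by auto
    qed
    ultimately show ?thesis by (simp add: mixed_disc_def)
  qed
  with I show ?thesis by simp
qed

text \<open>The factor \<psi>' confines the density to the chart \<open>c'\<close> and
  \<open>Lam\<close> of \<psi> confines it to \<open>c\<close>, so both integrals live on the
  overlap. There \<open>Lam_transition\<close> supplies exactly the Jacobian factor of the change of
  variables.\<close>

lemma Lam_change_chart:
  assumes c: "c \<in> A" "c' \<in> A" and K: "compact K" "K \<subseteq> coord c ` cdom c" and K': "compact K'" "K' \<subseteq> coord c' ` cdom c'"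
    and \<psi>: "C2X \<psi>" "C2X \<psi>'"
    and \<psi>0: "\<And>p. p \<in> topspace X \<Longrightarrow> \<psi> p \<noteq> 0 \<Longrightarrow> p \<in> cdom c \<and> coord c p \<in> K"
    and \<psi>0': "\<And>p. p \<in> topspace X \<Longrightarrow> \<psi>' p \<noteq> 0 \<Longrightarrow> p \<in> cdom c' \<and> coord c' p \<in> K'"
  defines "F \<equiv> \<lambda>c z. if z \<in> coord c ` cdom c then \<psi>' (param c z) * Re (Lam c \<psi> z) else 0"
  shows "(\<lambda>x. F c (r2c x)) absolutely_integrable_on UNIV" "(\<lambda>x. F c' (r2c x)) absolutely_integrable_on UNIV"
    and "integral UNIV (\<lambda>x. F c (r2c x)) = integral UNIV (\<lambda>x. F c' (r2c x))"
proof -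
  have o: "open (coord k ` cdom k)" if "k \<in> A" for k by (rule chart_image_open[OF MX that])
  have contF: "continuous_on (coord k ` cdom k) (F k)" if k: "k \<in> A" for k
  proof -
    have "Ck_on 2 (coord k ` cdom k) (\<lambda>z. \<psi>' (param k z))" using \<psi>(2) k by (simp add: C2X_def)
    then have "continuous_on (coord k ` cdom k) (\<lambda>z. \<psi>' (param k z))" by (rule Ck_on_imp_continuous)
    then have "continuous_on (coord k ` cdom k) (\<lambda>z. \<psi>' (param k z) * Re (Lam k \<psi> z))"
      using Ck_Lam[OF k \<psi>(1)] by (intro continuous_intros)
    then show ?thesis by (rule continuous_on_eq) (simp add: F_def)
  qed
  have L0: "Lam k \<psi> z = 0" if k: "k \<in> A" and z: "z \<in> coord k ` cdom k" and n: "\<not> (param k z \<in> cdom c \<and> coord c (param k z) \<in> K)" for k z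
  proof -
    let ?L = "{p \<in> cdom c. coord c p \<in> K}"
    let ?S = "coord k ` (cdom k \<inter> (topspace X - ?L))"
    have "open ?S"
      using chart_closedin_compact[OF MX c(1) K] by (intro chart_openin_image[OF MX k]) (auto intro: openin_diff)
    moreover have "z \<in> ?S"
      using coord_param[OF z] n param_in[OF k z] by (intro image_eqI[of _ _ "param k z"]) auto
    moreover have "\<psi> (param k w) = 0" if "w \<in> ?S" for w
      using that param_coord[OF MX k] \<psi>0 by force
    ultimately show ?thesis by (rule Lam_zero_near[OF k])
  qed
  have F0: "F c z = 0" if "z \<notin> K" for z
    using L0[OF c(1), of z] coord_param[of z c] that by (auto simp: F_def)
  have F0': "F c' z = 0" if "z \<notin> K'" for z
    using \<psi>0'[OF param_in[OF c(2)], of z] coord_param[of z c'] that by (auto simp: F_def)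
  have F1: "F c z = 0" if "z \<notin> overlap c c'" for z
  proof (cases "z \<in> coord c ` cdom c")
    case True
    then have "param c z \<notin> cdom c'" using overlapI[OF True, of c'] that by argo
    then have "\<psi>' (param c z) = 0" using \<psi>0'[OF param_in[OF c(1) True]] by argo
    then show ?thesis by (simp add: F_def)
  qed (simp add: F_def)
  have F1': "F c' z = 0" if "z \<notin> overlap c' c" for z
  proof (cases "z \<in> coord c' ` cdom c'")
    case True
    then have "param c' z \<notin> cdom c" using overlapI[OF True, of c] that by argo
    then have "Lam c' \<psi> z = 0" using L0[OF c(2) True] by argo
    then show ?thesis by (simp add: F_def)
  qed (simp add: F_def)
  show AI: "(\<lambda>x. F c (r2c x)) absolutely_integrable_on UNIV"
    by (rule compact_support_integrable(1)[OF continuous_zero_extension[OF o[OF c(1)] K contF[OF c(1)] F0] K(1) F0])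
  show AI': "(\<lambda>x. F c' (r2c x)) absolutely_integrable_on UNIV"
    by (rule compact_support_integrable(1)[OF continuous_zero_extension[OF o[OF c(2)] K' contF[OF c(2)] F0'] K'(1) F0'])
  let ?\<phi> = "transition c c'"
  have oo: "open (overlap c c')" by (rule overlap_open[OF MX c])
  have im: "?\<phi> ` overlap c c' = overlap c' c" by (rule transition_image[OF MX c])
  have "(\<lambda>x. F c' (r2c x)) absolutely_integrable_on c2r ` overlap c' c"
    using set_integrable_subset[OF AI'] open_c2r[OF overlap_open[OF MX c(2,1)]] by auto
  then have "integral (c2r ` overlap c' c) (\<lambda>x. F c' (r2c x))
      = integral (c2r ` overlap c c') (\<lambda>x. (cmod (jac (J c c' (r2c x))))\<^sup>2 * F c' (?\<phi> (r2c x)))"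
    using holomorphic_change_of_variables(1)[OF oo transition_inj[OF MX c] transition_derivative[OF c], of "F c'"]
    by (simp add: im)
  also have "\<dots> = integral (c2r ` overlap c c') (\<lambda>x. F c (r2c x))"
  proof (rule integral_cong)
    fix x assume "x \<in> c2r ` overlap c c'"
    then have z: "r2c x \<in> overlap c c'" by auto
    have zU: "r2c x \<in> coord c ` cdom c" "?\<phi> (r2c x) \<in> coord c' ` cdom c'"
      using z transition_in[OF MX c z] by (auto simp: overlap_def)
    show "(cmod (jac (J c c' (r2c x))))\<^sup>2 * F c' (?\<phi> (r2c x)) = F c (r2c x)"
      using Lam_transition[OF c z \<psi>(1)] zU param_transition[OF MX c z] by (simp add: F_def mult_ac)
  qed
  finally have e: "integral (c2r ` overlap c' c) (\<lambda>x. F c' (r2c x)) = integral (c2r ` overlap c c') (\<lambda>x. F c (r2c x))" .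
  have r: "integral (c2r ` S) (\<lambda>x. H (r2c x)) = integral UNIV (\<lambda>x. H (r2c x))" if "\<And>z. z \<notin> S \<Longrightarrow> H z = 0" for S and H :: "complex^2 \<Rightarrow> real"
  proof -
    have "(\<lambda>x. if x \<in> c2r ` S then H (r2c x) else 0) = (\<lambda>x. H (r2c x))" using that by (auto simp: c2r_image fun_eq_iff)
    then show ?thesis using integral_restrict_UNIV[of "c2r ` S" "\<lambda>x. H (r2c x)"] by simp
  qed
  show "integral UNIV (\<lambda>x. F c (r2c x)) = integral UNIV (\<lambda>x. F c' (r2c x))"
    using e r[of "overlap c c'" "F c"] r[of "overlap c' c" "F c'"] F1 F1' by simp
qed

text \<open>The integral of \<open>\<psi> j\<close> times \<open>Lam\<close> of
  \<open>\<psi> i\<close> is the same in the charts of \<open>i\<close> and \<open>j\<close>. In the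
  double sum, summation over \<open>j\<close> gives the integrals of \<open>Lam\<close> of
  \<open>\<psi> i\<close>, which equal those of \<open>\<psi> i\<close> times \<open>Th\<close>,
  while summation over \<open>i\<close> gives zero by \<open>Lam_sum\<close>. The integrands with
  \<open>Th\<close> are nonnegative and hence vanish. The conclusion holds on an open set because it
  will be differentiated.\<close>

lemma pluriharmonic:
  assumes "p \<in> topspace X"
  obtains c d S where "c \<in> A" "d \<in> B" "p \<in> cdom c" "open S" "S \<subseteq> W c d" "coord c p \<in> S"
    "\<And>z \<alpha> \<beta>. z \<in> S \<Longrightarrow> hess c d \<alpha> \<beta> z = 0"
proof (rule partition_of_unity)
  fix I :: "'a set" and cc dd KK and \<psi> :: "'a \<Rightarrow> 'a \<Rightarrow> real"
  assume P: "finite I" "\<And>i. i \<in> I \<Longrightarrow> cc i \<in> A" "\<And>i. i \<in> I \<Longrightarrow> dd i \<in> B"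
    "\<And>i. i \<in> I \<Longrightarrow> compact (KK i)" "\<And>i. i \<in> I \<Longrightarrow> KK i \<subseteq> W (cc i) (dd i)"
    "\<And>i. i \<in> I \<Longrightarrow> C2X (\<psi> i)" "\<And>i p. i \<in> I \<Longrightarrow> p \<in> topspace X \<Longrightarrow> 0 \<le> \<psi> i p"
    "\<And>i p. i \<in> I \<Longrightarrow> p \<in> topspace X \<Longrightarrow> \<psi> i p \<noteq> 0 \<Longrightarrow> p \<in> cdom (cc i) \<and> coord (cc i) p \<in> KK i"
    "\<And>p. p \<in> topspace X \<Longrightarrow> (\<Sum>i\<in>I. \<psi> i p) = 1"
  let ?U = "\<lambda>i. coord (cc i) ` cdom (cc i)"
  have KU: "KK i \<subseteq> ?U i" if "i \<in> I" for i using P(5)[OF that] W_subset by blast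
  \<comment> \<open>\<open>F k j i\<close> is the density of the cut-off \<open>i\<close>, weighted
    by the cut-off \<open>j\<close> and written in the chart of \<open>k\<close>; the cases
    \<open>k = i\<close> and \<open>k = j\<close> are compared.\<close>
  define F where "F k j i z = (if z \<in> ?U k then \<psi> j (param (cc k) z) * Re (Lam (cc k) (\<psi> i) z) else 0)" for k j i z
  define M where "M i z = (if z \<in> ?U i then Re (Lam (cc i) (\<psi> i) z) else 0)" for i z
  define R where "R i z = (if z \<in> ?U i then \<psi> i (param (cc i) z) else 0)" for i z
  have ch: "(\<lambda>x. F i j i (r2c x)) absolutely_integrable_on UNIV" "(\<lambda>x. F j j i (r2c x)) absolutely_integrable_on UNIV"
      "integral UNIV (\<lambda>x. F i j i (r2c x)) = integral UNIV (\<lambda>x. F j j i (r2c x))" if "i \<in> I" "j \<in> I" for i j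
    using Lam_change_chart[OF P(2)[OF that(1)] P(2)[OF that(2)] P(4)[OF that(1)] KU[OF that(1)] P(4)[OF that(2)] KU[OF that(2)]
        P(6)[OF that(1)] P(6)[OF that(2)] P(8)[OF that(1)] P(8)[OF that(2)]]
    unfolding F_def by blast+
  have S1: "(\<Sum>j\<in>I. F i j i z) = M i z" if "i \<in> I" for i z
    using P(9)[OF param_in[OF P(2)[OF that]]] by (auto simp: F_def M_def sum_distrib_right[symmetric])
  have S2: "(\<Sum>i\<in>I. F j j i z) = 0" if "j \<in> I" for j z
  proof (cases "z \<in> ?U j")
    case True
    have "(\<Sum>i\<in>I. Re (Lam (cc j) (\<psi> i) z)) = 0"
      using Lam_sum[OF P(2)[OF that] True P(1) P(6) P(9)] by (simp flip: Re_sum)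
    then show ?thesis using True by (simp add: F_def sum_distrib_left[symmetric])
  qed (simp add: F_def)
  have ai: "(\<lambda>x. F i j i (r2c x)) integrable_on UNIV" "(\<lambda>x. F j j i (r2c x)) integrable_on UNIV" if "i \<in> I" "j \<in> I" for i j
    using ch(1,2)[OF that] set_lebesgue_integral_eq_integral(1) by blast+
  have iM: "((\<lambda>x. M i (r2c x)) has_integral (\<Sum>j\<in>I. integral UNIV (\<lambda>x. F i j i (r2c x)))) UNIV" if "i \<in> I" for i
    using has_integral_sum[OF P(1), of "\<lambda>j x. F i j i (r2c x)" "\<lambda>j. integral UNIV (\<lambda>x. F i j i (r2c x))" UNIV]
      integrable_integral[OF ai(1)[OF that]] by (simp add: S1[OF that])
  have "(\<Sum>i\<in>I. integral UNIV (\<lambda>x. M i (r2c x))) = (\<Sum>i\<in>I. \<Sum>j\<in>I. integral UNIV (\<lambda>x. F i j i (r2c x)))"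
    using integral_unique[OF iM] by simp
  also have "\<dots> = (\<Sum>i\<in>I. \<Sum>j\<in>I. integral UNIV (\<lambda>x. F j j i (r2c x)))"
    by (rule sum.cong[OF refl], rule sum.cong[OF refl], rule ch(3))
  also have "\<dots> = (\<Sum>j\<in>I. \<Sum>i\<in>I. integral UNIV (\<lambda>x. F j j i (r2c x)))" by (rule sum.swap)
  also have "\<dots> = (\<Sum>j\<in>I. integral UNIV (\<lambda>x. \<Sum>i\<in>I. F j j i (r2c x)))"
    using ai(2) by (intro sum.cong refl integral_sum[symmetric] P(1))
  also have "\<dots> = 0" by (simp add: S2)
  finally have total: "(\<Sum>i\<in>I. integral UNIV (\<lambda>x. M i (r2c x))) = 0" .
  define Q where "Q i z = R i z * Re (Th (cc i) (dd i) z)" for i z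
  have Q0: "Q i z = 0" if "i \<in> I" "z \<notin> KK i" for i z
    using P(8)[OF that(1) param_in[OF P(2)[OF that(1)]], of z] coord_param[of z "cc i"] that
    by (auto simp: Q_def R_def)
  have Qn: "0 \<le> Q i z" if "i \<in> I" for i z
  proof (cases "z \<in> KK i")
    case True
    then have z: "z \<in> W (cc i) (dd i)" "z \<in> ?U i" using P(5)[OF that] KU[OF that] by blast+
    show ?thesis
      using Th_nonneg(1)[OF P(2)[OF that] P(3)[OF that] z(1)] P(7)[OF that param_in[OF P(2)[OF that] z(2)]] z(2)
      by (simp add: Q_def R_def)
  qed (simp add: Q0 that)
  have Qc: "continuous_on UNIV (Q i)" if "i \<in> I" for i
  proof (rule continuous_zero_extension[OF open_W[OF P(2)[OF that] P(3)[OF that]] P(4)[OF that] P(5)[OF that] _ Q0[OF that]])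
    let ?W = "W (cc i) (dd i)"
    have "Ck_on 2 (?U i) (\<lambda>z. \<psi> i (param (cc i) z))" using P(6)[OF that] P(2)[OF that] by (simp add: C2X_def)
    then have "continuous_on ?W (\<lambda>z. \<psi> i (param (cc i) z))"
      using Ck_on_imp_continuous continuous_on_subset W_subset by blast
    moreover have "continuous_on ?W (Th (cc i) (dd i))"
      using Ck_Th[OF P(2)[OF that] P(3)[OF that]] Ck_on_imp_continuous by blast
    ultimately have "continuous_on ?W (\<lambda>z. \<psi> i (param (cc i) z) * Re (Th (cc i) (dd i) z))"
      by (intro continuous_intros)
    then show "continuous_on ?W (Q i)"
      by (rule continuous_on_eq) (use W_subset[of "cc i" "dd i"] in \<open>auto simp: Q_def R_def\<close>)
  qed
  have QM: "((\<lambda>x. Q i (r2c x) - M i (r2c x)) has_integral 0) UNIV" if "i \<in> I" for i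
  proof -
    have "\<psi> i p = 0" if "p \<in> cdom (cc i)" "coord (cc i) p \<notin> KK i" for p
      using P(8)[OF \<open>i \<in> I\<close>, of p] chart_subset[OF MX P(2)[OF \<open>i \<in> I\<close>]] that by blast
    note L = Lam_integral[OF P(2)[OF that] P(3)[OF that] P(4)[OF that] P(5)[OF that] P(6)[OF that] this]
    have e: "Re ((if z \<in> ?U i then of_real (\<psi> i (param (cc i) z)) else 0) * Th (cc i) (dd i) z)
      - (if z \<in> ?U i then Re (Lam (cc i) (\<psi> i) z) else 0) = Q i z - M i z" for z
      by (cases "z \<in> ?U i") (simp_all add: Q_def R_def M_def)
    show ?thesis using L unfolding e .
  qed
  have iQ: "((\<lambda>x. Q i (r2c x)) has_integral integral UNIV (\<lambda>x. M i (r2c x))) UNIV" if "i \<in> I" for i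
    using has_integral_add[OF QM[OF that] integrable_integral[OF has_integral_integrable[OF iM[OF that]]]] by simp
  have "0 \<le> integral UNIV (\<lambda>x. M i (r2c x))" if "i \<in> I" for i
    using has_integral_nonneg[OF iQ[OF that]] Qn[OF that] by blast
  then have "integral UNIV (\<lambda>x. M i (r2c x)) = 0" if "i \<in> I" for i
    using total that P(1) by (simp add: sum_nonneg_eq_0_iff)
  then have Qz: "Q i z = 0" if "i \<in> I" for i z
    using compact_support_integrable(2)[OF Qc[OF that] P(4)[OF that] Q0[OF that] Qn[OF that]] iQ[OF that] that by simp
  obtain i where i: "i \<in> I" "\<psi> i p \<noteq> 0"
    using P(9)[OF assms] by (metis sum.neutral zero_neq_one)
  have ci: "cc i \<in> A" and di: "dd i \<in> B" and pc: "p \<in> cdom (cc i)" using P(2,3) P(8)[OF i(1) assms i(2)] i(1) by auto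
  \<comment> \<open>Where the weight of \<open>i\<close> is nonzero, \<open>Qz\<close> leaves no
    room for a positive value of \<open>Th\<close>.\<close>
  define S where "S = W (cc i) (dd i) \<inter> {z. R i z \<noteq> 0}"
  have "continuous_on (?U i) (\<lambda>z. \<psi> i (param (cc i) z))"
    using P(6)[OF i(1)] ci Ck_on_imp_continuous unfolding C2X_def by blast
  then have "continuous_on (?U i) (R i)" by (rule continuous_on_eq) (simp add: R_def)
  then have cR: "continuous_on (W (cc i) (dd i)) (R i)" using continuous_on_subset W_subset by blast
  have S: "open S"
    using continuous_open_preimage[OF cR open_W[OF ci di], of "- {0}"] by (simp add: S_def vimage_def open_Compl)
  have "coord (cc i) p \<in> KK i" using P(8)[OF i(1) assms i(2)] by blast
  then have "coord (cc i) p \<in> S"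
    using P(5)[OF i(1)] i(2) pc param_coord[OF MX ci pc] by (auto simp: S_def R_def)
  moreover have "hess (cc i) (dd i) \<alpha> \<beta> z = 0" if z: "z \<in> S" for z \<alpha> \<beta>
  proof -
    have "Re (Th (cc i) (dd i) z) = 0" using Qz[OF i(1), of z] z by (simp add: Q_def S_def)
    then show ?thesis using Th_nonneg(2)[OF ci di, of z] z by (simp add: S_def)
  qed
  ultimately show thesis using that[OF ci di pc S] by (auto simp: S_def)
qed

end

section \<open>The maximum principle\<close>

text \<open>A negative \<open>D\<close> would make the first derivative negative just to the right
  of the minimum, and the mean value theorem would give a smaller value there.\<close>

lemma second_derivative_at_minimum:
  fixes \<phi> :: "real \<Rightarrow> real"
  assumes e: "e > 0" and d1: "\<And>t. \<bar>t\<bar> < e \<Longrightarrow> (\<phi> has_real_derivative \<phi>' t) (at t)"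
    and d2: "(\<phi>' has_real_derivative D) (at 0)" and min: "\<And>t. \<bar>t\<bar> < e \<Longrightarrow> \<phi> 0 \<le> \<phi> t"
  shows "0 \<le> D"
proof (rule ccontr)
  assume "\<not> 0 \<le> D"
  then have "D < 0" by simp
  have z: "\<phi>' 0 = 0"
    by (rule DERIV_local_min[OF d1 e]) (use e min in auto)
  obtain k where k: "k > 0" "\<And>t. 0 < t \<Longrightarrow> t < k \<Longrightarrow> \<phi>' (0 + t) < \<phi>' 0"
    using DERIV_neg_dec_right[OF d2 \<open>D < 0\<close>] by blast
  define t where "t = min k e / 2"
  have t: "0 < t" "t < k" "t < e" using k e by (auto simp: t_def)
  have "\<exists>s. 0 < s \<and> s < t \<and> \<phi> t - \<phi> 0 = (t - 0) * \<phi>' s"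
    using t by (intro MVT2 d1) auto
  then obtain s where s: "0 < s" "s < t" "\<phi> t - \<phi> 0 = t * \<phi>' s" by auto
  have "\<phi>' s < 0" using k(2)[of s] s t z by simp
  then have "t * \<phi>' s < 0" using t by (simp add: mult_pos_neg)
  then show False using min[of t] s t by simp
qed

lemma second_derivative_nonneg:
  fixes F :: "'e::real_normed_vector \<Rightarrow> complex"
  assumes S: "open S" "z \<in> S" and F: "Ck_on 2 S F"
    and nn: "\<And>w. w \<in> S \<Longrightarrow> 0 \<le> Re (F w)" and z0: "Re (F z) = 0"
  shows "0 \<le> Re (frechet_derivative (\<lambda>w. frechet_derivative F (at w) a) (at z) a)"
proof -
  obtain r where r: "r > 0" "ball z r \<subseteq> S" using S openE by blast
  define e where "e = r / (norm a + 1)"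
  have e: "e > 0" using r(1) by (simp add: e_def add_nonneg_pos)
  have inS: "z + t *\<^sub>R a \<in> S" if "\<bar>t\<bar> < e" for t
  proof -
    have "\<bar>t\<bar> * norm a \<le> \<bar>t\<bar> * (norm a + 1)" by (simp add: mult_left_mono)
    also have "\<dots> < r" using that by (simp add: e_def pos_less_divide_eq add_nonneg_pos)
    finally show ?thesis using r(2) by (auto simp: dist_norm)
  qed
  have F1: "F differentiable (at w)" "(\<lambda>w. frechet_derivative F (at w) a) differentiable (at w)" if "w \<in> S" for w
    using F that by (simp_all add: numeral_2_eq_2 Ck_on.simps(2))
  show ?thesis
  proof (rule second_derivative_at_minimum[OF e])
    show "((\<lambda>t. Re (F (z + t *\<^sub>R a))) has_real_derivative Re (frechet_derivative F (at (z + t *\<^sub>R a)) a)) (at t)"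
      if "\<bar>t\<bar> < e" for t
      using bounded_linear.has_vector_derivative[OF bounded_linear_Re frechet_derivative_along_line[OF F1(1)[OF inS[OF that]]]]
      by (simp add: has_real_derivative_iff_has_vector_derivative)
    have "(\<lambda>w. frechet_derivative F (at w) a) differentiable (at (z + 0 *\<^sub>R a))" using F1(2)[OF S(2)] by simp
    from bounded_linear.has_vector_derivative[OF bounded_linear_Re frechet_derivative_along_line[OF this]]
    show "((\<lambda>t. Re (frechet_derivative F (at (z + t *\<^sub>R a)) a)) has_real_derivative
        Re (frechet_derivative (\<lambda>w. frechet_derivative F (at w) a) (at z) a)) (at 0)"
      by (simp add: has_real_derivative_iff_has_vector_derivative)
    show "Re (F (z + 0 *\<^sub>R a)) \<le> Re (F (z + t *\<^sub>R a))" if "\<bar>t\<bar> < e" for t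
      using nn[OF inS[OF that]] z0 by simp
  qed
qed

text \<open>The form on \<open>a\<close> is the sum of the second derivatives along
  \<open>a / 2\<close> and along \<open>\<i>\<close> times \<open>a / 2\<close>; the mixed terms
  cancel by Schwarz.\<close>

lemma levi_nonneg_at_minimum:
  fixes F :: "complex^'m \<Rightarrow> complex"
  assumes S: "open S" "z \<in> S" and F: "Ck_on 2 S F"
    and nn: "\<And>w. w \<in> S \<Longrightarrow> 0 \<le> Re (F w)" and z0: "Re (F z) = 0"
  shows "0 \<le> Re (levi F z a a)"
proof -
  define x y where "x = (1/2) *\<^sub>R a" and "y = (1/2) *\<^sub>R (\<i> *s a)"
  let ?D = "\<lambda>v w. frechet_derivative F (at w) v"
  have d: "?D v differentiable (at z)" for v
    using F S(2) by (simp add: numeral_2_eq_2 Ck_on.simps(2))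
  have sy: "frechet_derivative (?D x) (at z) y = frechet_derivative (?D y) (at z) x"
    by (rule second_derivative_symmetric[OF S F])
  have b: "bar (wz a) = (x, y)" "wz a = (x, - y)" by (simp_all add: bar_def wz_def x_def y_def)
  have "((\<lambda>w. ?D x w + \<i> * ?D y w) has_derivative (\<lambda>v. frechet_derivative (?D x) (at z) v + \<i> * frechet_derivative (?D y) (at z) v)) (at z)"
    by (rule has_derivative_add[OF frechet_derivative_worksI[OF d] has_derivative_mult_right[OF frechet_derivative_worksI[OF d]]])
  from cderiv_eqI[OF this, of "wz a"]
  have "levi F z a a = (frechet_derivative (?D x) (at z) x + \<i> * frechet_derivative (?D y) (at z) x)
     + \<i> * (frechet_derivative (?D x) (at z) (- y) + \<i> * frechet_derivative (?D y) (at z) (- y))"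
    by (simp add: levi_def b bar_def cderiv_def[of "(x, y)", abs_def])
  also have "\<dots> = frechet_derivative (?D x) (at z) x + frechet_derivative (?D y) (at z) y"
    using sy linear_frechet_derivative[OF d] by (simp add: linear_neg algebra_simps)
  finally show ?thesis
    using second_derivative_nonneg[OF S F nn z0, of x] second_derivative_nonneg[OF S F nn z0, of y] by simp
qed

section \<open>The Chern curvature as a second derivative of the metric\<close>

definition herm :: "complex^2^2 \<Rightarrow> complex^2 \<Rightarrow> complex^2 \<Rightarrow> complex" where
  "herm H a b = (\<Sum>\<gamma>\<in>UNIV. \<Sum>\<delta>\<in>UNIV. H $ \<gamma> $ \<delta> * a $ \<gamma> * cnj (b $ \<delta>))"

text \<open>Contracts the two form indices with \<open>a\<close> at once, replacing coordinate
  derivatives by derivatives along \<open>wz a\<close> and its conjugate; only the two bundle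
  indices stay explicit.\<close>

lemma chern_form_eq:
  assumes S: "open S" "z \<in> S" and H: "\<And>\<gamma> \<delta>. Ck_on 2 S (\<lambda>w. H w $ \<gamma> $ \<delta> :: complex)"
  shows "chern_form H z (a::complex^2) v = (\<Sum>\<gamma>\<in>UNIV. \<Sum>\<delta>\<in>UNIV. (- levi (\<lambda>w. H w $ \<gamma> $ \<delta>) z a a
     + (\<Sum>\<mu>\<in>UNIV. \<Sum>\<nu>\<in>UNIV. hinv (H z) $ \<mu> $ \<nu> * cderiv (wz a) (\<lambda>w. H w $ \<gamma> $ \<nu>) z
          * cderiv (bar (wz a)) (\<lambda>w. H w $ \<mu> $ \<delta>) z)) * v $ \<gamma> * cnj (v $ \<delta>))"
proof -
  let ?h = "\<lambda>\<gamma> \<delta> w. H w $ \<gamma> $ \<delta>" and ?e = "\<lambda>\<alpha>. wz (axis \<alpha> (1::complex)) :: (complex^2) \<times> _"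
  have dH: "?h \<gamma> \<delta> differentiable (at w)" if "w \<in> S" for \<gamma> \<delta> w
    by (rule C1_differentiable[OF C2_cderiv(2)[OF S(1) H] that])
  have z1: "dz \<alpha> (?h \<gamma> \<delta>) w = cderiv (?e \<alpha>) (?h \<gamma> \<delta>) w" "dzbar \<alpha> (?h \<gamma> \<delta>) w = cderiv (bar (?e \<alpha>)) (?h \<gamma> \<delta>) w" if "w \<in> S" for \<alpha> \<gamma> \<delta> w
    using cderiv_wz_axis[OF dH[OF that]] by simp_all
  have z2: "dz \<alpha> (dzbar \<beta> (?h \<gamma> \<delta>)) z = levi (?h \<gamma> \<delta>) z (axis \<alpha> 1) (axis \<beta> 1)" for \<alpha> \<beta> \<gamma> \<delta>
  proof -
    have "cderiv (bar (?e \<beta>)) (?h \<gamma> \<delta>) differentiable (at z)"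
      by (rule C1_differentiable[OF C2_cderiv(1)[OF S(1) H] S(2)])
    then have "dzbar \<beta> (?h \<gamma> \<delta>) differentiable (at z)"
      using differentiable_cong_open[OF S, of "dzbar \<beta> (?h \<gamma> \<delta>)" "cderiv (bar (?e \<beta>)) (?h \<gamma> \<delta>)"] z1(2) by simp
    then have "dz \<alpha> (dzbar \<beta> (?h \<gamma> \<delta>)) z = cderiv (?e \<alpha>) (dzbar \<beta> (?h \<gamma> \<delta>)) z"
      by (simp add: cderiv_wz_axis)
    also have "\<dots> = cderiv (?e \<alpha>) (cderiv (bar (?e \<beta>)) (?h \<gamma> \<delta>)) z" by (rule cderiv_cong[OF S z1(2)])
    finally show ?thesis by (simp add: levi_def)
  qed
  have one: "(\<Sum>\<alpha>\<in>UNIV. \<Sum>\<beta>\<in>UNIV. chern H \<alpha> \<beta> \<gamma> \<delta> z * a $ \<alpha> * cnj (a $ \<beta>)) = - levi (?h \<gamma> \<delta>) z a a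
     + (\<Sum>\<mu>\<in>UNIV. \<Sum>\<nu>\<in>UNIV. hinv (H z) $ \<mu> $ \<nu> * cderiv (wz a) (?h \<gamma> \<nu>) z * cderiv (bar (wz a)) (?h \<mu> \<delta>) z)" for \<gamma> \<delta>
  proof -
    have l: "levi (?h \<gamma> \<delta>) z a a = (\<Sum>\<alpha>\<in>UNIV. \<Sum>\<beta>\<in>UNIV. a $ \<alpha> * cnj (a $ \<beta>) * levi (?h \<gamma> \<delta>) z (axis \<alpha> 1) (axis \<beta> 1))"
      using sesq_levi[OF S H] unfolding sesq_def by blast
    have q: "(\<Sum>\<alpha>\<in>UNIV. \<Sum>\<beta>\<in>UNIV. (\<Sum>\<mu>\<in>UNIV. \<Sum>\<nu>\<in>UNIV. k \<mu> \<nu> * X \<alpha> \<nu> * Y \<beta> \<mu>) * s \<alpha> * t \<beta>)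
      = (\<Sum>\<mu>\<in>UNIV. \<Sum>\<nu>\<in>UNIV. k \<mu> \<nu> * (\<Sum>\<alpha>\<in>UNIV. s \<alpha> * X \<alpha> \<nu>) * (\<Sum>\<beta>\<in>UNIV. t \<beta> * Y \<beta> \<mu>))"
      for k X Y :: "2 \<Rightarrow> 2 \<Rightarrow> complex" and s t :: "2 \<Rightarrow> complex"
      by (simp add: sum_2 algebra_simps)
    show ?thesis
      unfolding l cderiv_wz_sum(1)[OF dH[OF S(2)], of a] cderiv_wz_sum(2)[OF dH[OF S(2)], of a] q[symmetric]
      unfolding chern_def z1[OF S(2)] z2
      by (simp add: ring_distribs sum.distrib sum_subtractf sum_negf mult_ac)
  qed
  have "chern_form H z a v = (\<Sum>\<gamma>\<in>UNIV. \<Sum>\<delta>\<in>UNIV. (\<Sum>\<alpha>\<in>UNIV. \<Sum>\<beta>\<in>UNIV. chern H \<alpha> \<beta> \<gamma> \<delta> z * a $ \<alpha> * cnj (a $ \<beta>)) * v $ \<gamma> * cnj (v $ \<delta>))"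
    unfolding chern_form_def by (simp add: sum_2 algebra_simps)
  then show ?thesis unfolding one .
qed

text \<open>The vector field \<open>v\<close> extends \<open>v1\<close> holomorphically and is parallel at \<open>z1\<close> in direction \<open>a\<close>
  for the Chern connection, which determines \<open>w\<close>.\<close>

lemma chern_second_derivative:
  fixes H :: "complex^2 \<Rightarrow> complex^2^2" and a v1 z1 :: "complex^2"
  assumes S: "open S" "z1 \<in> S" and H: "\<And>\<gamma> \<delta>. Ck_on 2 S (\<lambda>w. H w $ \<gamma> $ \<delta>)"
    and inv: "invertible (H z1)" and k: "a $ k \<noteq> 0"
  shows "\<exists>w. levi (\<lambda>z. herm (H z) (v1 + ((z $ k - z1 $ k) / a $ k) *s w) (v1 + ((z $ k - z1 $ k) / a $ k) *s w)) z1 a a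
     = - chern_form H z1 a v1"
proof -
  let ?h = "\<lambda>\<gamma> \<delta> w. H w $ \<gamma> $ \<delta>"
  let ?K = "hinv (H z1)"
  define AA where "AA \<nu> = (\<Sum>\<gamma>\<in>UNIV. cderiv (wz a) (?h \<gamma> \<nu>) z1 * v1 $ \<gamma>)" for \<nu>
  define BB where "BB \<mu> = (\<Sum>\<delta>\<in>UNIV. cderiv (bar (wz a)) (?h \<mu> \<delta>) z1 * cnj (v1 $ \<delta>))" for \<mu>
  \<comment> \<open>Minus the Chern connection form in direction \<open>a\<close>, applied to
    \<open>v1\<close>: the derivative that a parallel field must have.\<close>
  define w :: "complex^2" where "w = (\<chi> \<mu>. - (\<Sum>\<nu>\<in>UNIV. ?K $ \<mu> $ \<nu> * AA \<nu>))"
  \<comment> \<open>An affine holomorphic function that vanishes at \<open>z1\<close> and has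
    derivative 1 along \<open>a\<close>; the index \<open>k\<close> only serves to have
    \<open>a $ k\<close> nonzero.\<close>
  define l where "l z = (z $ k - z1 $ k) / a $ k" for z :: "complex^2"
  define v where "v z = v1 + l z *s w" for z
  have dl: "(l has_derivative (\<lambda>x. x $ k / a $ k)) (at z)" for z
    unfolding l_def
    by (rule bounded_linear.has_derivative[OF bounded_linear_divide])
      (use bounded_linear_imp_has_derivative[OF bounded_linear_vec_nth[of k]] in \<open>auto intro!: derivative_eq_intros\<close>)
  have dv: "((\<lambda>z. v z $ \<gamma>) has_derivative (\<lambda>x. x $ k / a $ k * w $ \<gamma>)) (at z)" for \<gamma> z
    unfolding v_def using dl by (auto intro!: derivative_eq_intros)
  have vd: "(\<lambda>z. v z $ \<gamma>) differentiable (at z)" "(\<lambda>z. cnj (v z $ \<gamma>)) differentiable (at z)" for \<gamma> z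
    using dv has_derivative_cnj unfolding differentiable_def by blast+
  have cv: "cderiv (bar (wz a)) (\<lambda>z. v z $ \<gamma>) z = 0" "cderiv (wz a) (\<lambda>z. v z $ \<gamma>) z = w $ \<gamma>" for \<gamma> z
    using dzbar_holomorphic[OF dv] k by simp_all
  have cv': "cderiv (bar (wz a)) (\<lambda>z. cnj (v z $ \<gamma>)) z = cnj (w $ \<gamma>)" "cderiv (wz a) (\<lambda>z. cnj (v z $ \<gamma>)) z = 0" for \<gamma> z
    using cv by (simp_all add: cderiv_cnj_bar[OF vd(1)])
  have dH: "?h \<gamma> \<delta> differentiable (at z)" if "z \<in> S" for \<gamma> \<delta> z
    by (rule C1_differentiable[OF C2_cderiv(2)[OF S(1) H] that])
  have dH2: "cderiv p (?h \<gamma> \<delta>) differentiable (at z1)" for \<gamma> \<delta> p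
    by (rule C1_differentiable[OF C2_cderiv(1)[OF S(1) H] S(2)])
  have v1: "v z1 = v1" by (simp add: v_def l_def vec_eq_iff)
  have first: "cderiv (bar (wz a)) (\<lambda>z. herm (H z) (v z) (v z)) z = (\<Sum>\<gamma>\<in>UNIV. \<Sum>\<delta>\<in>UNIV.
      cderiv (bar (wz a)) (?h \<gamma> \<delta>) z * v z $ \<gamma> * cnj (v z $ \<delta>) + ?h \<gamma> \<delta> z * v z $ \<gamma> * cnj (w $ \<delta>))" if "z \<in> S" for z
    unfolding herm_def
    by (simp add: cderiv_sum cderiv_mult dH[OF that] vd cv cv' differentiable_mult differentiable_sum)
  have "levi (\<lambda>z. herm (H z) (v z) (v z)) z1 a a = cderiv (wz a) (\<lambda>z. \<Sum>\<gamma>\<in>UNIV. \<Sum>\<delta>\<in>UNIV.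
      cderiv (bar (wz a)) (?h \<gamma> \<delta>) z * v z $ \<gamma> * cnj (v z $ \<delta>) + ?h \<gamma> \<delta> z * v z $ \<gamma> * cnj (w $ \<delta>)) z1"
    unfolding levi_def by (rule cderiv_cong[OF S first])
  also have "\<dots> = (\<Sum>\<gamma>\<in>UNIV. \<Sum>\<delta>\<in>UNIV. levi (?h \<gamma> \<delta>) z1 a a * v1 $ \<gamma> * cnj (v1 $ \<delta>)
      + cderiv (bar (wz a)) (?h \<gamma> \<delta>) z1 * w $ \<gamma> * cnj (v1 $ \<delta>)
      + (cderiv (wz a) (?h \<gamma> \<delta>) z1 * v1 $ \<gamma> * cnj (w $ \<delta>) + ?h \<gamma> \<delta> z1 * w $ \<gamma> * cnj (w $ \<delta>)))"
    by (simp add: cderiv_sum cderiv_mult cderiv_add dH[OF S(2)] dH2 vd cv cv' differentiable_mult differentiable_sum differentiable_add v1 levi_def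
        distrib_right)
  also have "\<dots> = (\<Sum>\<gamma>\<in>UNIV. \<Sum>\<delta>\<in>UNIV. levi (?h \<gamma> \<delta>) z1 a a * v1 $ \<gamma> * cnj (v1 $ \<delta>))
      + (\<Sum>\<gamma>\<in>UNIV. w $ \<gamma> * BB \<gamma>) + (\<Sum>\<delta>\<in>UNIV. (AA \<delta> + (\<Sum>\<gamma>\<in>UNIV. ?h \<gamma> \<delta> z1 * w $ \<gamma>)) * cnj (w $ \<delta>))"
    by (simp add: AA_def BB_def sum_2 algebra_simps)
  finally have L: "levi (\<lambda>z. herm (H z) (v z) (v z)) z1 a a = (\<Sum>\<gamma>\<in>UNIV. \<Sum>\<delta>\<in>UNIV. levi (?h \<gamma> \<delta>) z1 a a * v1 $ \<gamma> * cnj (v1 $ \<delta>))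
      + (\<Sum>\<gamma>\<in>UNIV. w $ \<gamma> * BB \<gamma>) + (\<Sum>\<delta>\<in>UNIV. (AA \<delta> + (\<Sum>\<gamma>\<in>UNIV. ?h \<gamma> \<delta> z1 * w $ \<gamma>)) * cnj (w $ \<delta>))" .
  \<comment> \<open>Parallelism at \<open>z1\<close>: the derivatives of the metric and of the field
    cancel. This removes the last sum in \<open>L\<close>, and the sum with \<open>BB\<close>
    becomes the quadratic part of the Chern curvature.\<close>
  have Hw: "(\<Sum>\<gamma>\<in>UNIV. ?h \<gamma> \<delta> z1 * w $ \<gamma>) = - AA \<delta>" for \<delta>
  proof -
    have MH: "matrix_inv (H z1) ** H z1 = mat 1"
      using matrix_inv_right[OF inv] matrix_left_right_inverse by blast
    have e: "(\<Sum>\<gamma>\<in>UNIV. ?K $ \<gamma> $ \<nu> * ?h \<gamma> \<delta> z1) = (if \<nu> = \<delta> then 1 else 0)" for \<nu>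
      using arg_cong[OF MH, of "\<lambda>m. m $ \<nu> $ \<delta>"] by (simp add: hinv_def transpose_def matrix_matrix_mult_def mat_def)
    have "(\<Sum>\<gamma>\<in>UNIV. ?h \<gamma> \<delta> z1 * w $ \<gamma>) = - (\<Sum>\<nu>\<in>UNIV. (\<Sum>\<gamma>\<in>UNIV. ?K $ \<gamma> $ \<nu> * ?h \<gamma> \<delta> z1) * AA \<nu>)"
      by (simp add: w_def sum_2 algebra_simps)
    also have "\<dots> = - (\<Sum>\<nu>\<in>UNIV. if \<nu> = \<delta> then AA \<nu> else 0)"
      unfolding e by (intro arg_cong[of _ _ uminus] sum.cong) auto
    finally show ?thesis by simp
  qed
  have "(\<Sum>\<gamma>\<in>UNIV. \<Sum>\<delta>\<in>UNIV. levi (?h \<gamma> \<delta>) z1 a a * v1 $ \<gamma> * cnj (v1 $ \<delta>))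
      + (\<Sum>\<gamma>\<in>UNIV. w $ \<gamma> * BB \<gamma>) + (\<Sum>\<delta>\<in>UNIV. (AA \<delta> + - AA \<delta>) * cnj (w $ \<delta>)) = - chern_form H z1 a v1"
    unfolding chern_form_eq[OF S H]
    by (simp add: w_def AA_def BB_def sum_2 algebra_simps)
  then have "levi (\<lambda>z. herm (H z) (v z) (v z)) z1 a a = - chern_form H z1 a v1"
    unfolding L Hw .
  then show ?thesis unfolding v_def l_def by blast
qed

lemma (in riem) nab_scale:
  assumes "s differentiable (at z)" "\<xi> differentiable (at z)"
  shows "nab p u (\<lambda>w. s w *s \<xi> w) z = cderiv p s z *s \<xi> z + s z *s nab p u \<xi> z"
proof -
  have "vcderiv p (\<lambda>w. s w *s \<xi> w) z = cderiv p s z *s \<xi> z + s z *s vcderiv p \<xi> z"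
    using assms differentiable_vec_nth[OF assms(2)] by (simp add: vec_eq_iff cderiv_mult)
  then show ?thesis by (simp add: nab_def Gam_simps vector_add_ldistrib del: vcderiv_nth)
qed

lemma (in riem) nab_add:
  assumes "\<xi> differentiable (at z)" "\<zeta> differentiable (at z)"
  shows "nab p u (\<lambda>w. \<xi> w + \<zeta> w) z = nab p u \<xi> z + nab p u \<zeta> z"
  by (simp add: nab_def vcderiv_add[OF assms] Gam_simps del: vcderiv_nth)

lemma (in riem) Gam_sum: "Gam y (\<Sum>k\<in>I. s k *s X k) Y = (\<Sum>k\<in>I. s k *s Gam y (X k) Y)"
  by (induction I rule: infinite_finite_induct) (simp_all add: Gam_simps)

lemma (in riem) nab_wz:
  assumes "(\<lambda>w. cvec (u w)) differentiable (at z)" "\<xi> differentiable (at z)"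
  shows "nab (bar (wz b)) u \<xi> z = (\<Sum>k\<in>UNIV. cnj (b $ k) *s nab (bar (wz (axis k 1))) u \<xi> z)"
  unfolding nab_def vcderiv_wz_sum(2)[OF assms(1), of b] vcderiv_wz_sum(2)[OF assms(2), of b]
  by (simp only: Gam_sum vector_add_ldistrib sum.distrib)

section \<open>Comparing the pulled-back metric with the RC-positive metric\<close>

locale rc_setting = harmonic_setting +
  fixes h0 :: "('a, 2) hmetric"
  assumes h0: "hermitian_metric A h0" and rc: "uniformly_RC_positive A h0"
begin

definition Hm :: "('a, complex^2) chart \<Rightarrow> complex^2 \<Rightarrow> complex^2^2" where
  "Hm c = in_chart h0 c"

definition Hr :: "('a, complex^2) chart \<Rightarrow> complex^2 \<Rightarrow> complex^2 \<Rightarrow> real" where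
  "Hr c z v = Re (herm (Hm c z) v v)"

definition en :: "('a, complex^2) chart \<Rightarrow> complex^2 \<Rightarrow> complex^2 \<Rightarrow> real" where
  "en c z v = Re (eta c z v v)"

lemma Hr_pos:
  assumes "c \<in> A" "z \<in> coord c ` cdom c" "v \<noteq> 0" shows "0 < Hr c z v"
  using h0 assms(1,3) coord_param(2)[OF assms(2)]
  unfolding hermitian_metric_def Hr_def herm_def Hm_def in_chart_def by blast

lemma Ck_Hm: assumes "c \<in> A" shows "Ck_on k (coord c ` cdom c) (\<lambda>z. Hm c z $ \<gamma> $ \<delta>)"
proof -
  have o: "open (coord c ` cdom c)" by (rule chart_image_open[OF MX assms])
  have "smooth_on (coord c ` cdom c) (Hm c)" using h0 assms unfolding hermitian_metric_def Hm_def by blast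
  then have "Ck_on k (coord c ` cdom c) (Hm c)" by (simp add: smooth_on_def)
  then show ?thesis
    by (intro Ck_on_linear_comp[OF o bounded_linear_vec_nth, of _ "\<lambda>z. Hm c z $ \<gamma>"]
        Ck_on_linear_comp[OF o bounded_linear_vec_nth])
qed

lemma herm_transition:
  assumes c: "c \<in> A" "c' \<in> A" and z: "z \<in> overlap c c'"
  shows "herm (Hm c z) a b = herm (Hm c' (transition c c' z)) (J c c' z a) (J c c' z b)"
proof -
  note op = overlap_param[OF MX c(1) z]
  let ?J = "J c c' z"
  have dJ: "(transition c c' has_derivative ?J) (at z)" and lJ: "complex_linear ?J"
    by (rule transition_derivative[OF c z])+
  \<comment> \<open>For a holomorphic transition the Wirtinger derivatives in the transformation law
    are the values of the real derivative \<open>J\<close> on coordinate vectors.\<close>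
  have D: "dz \<alpha> (\<lambda>z. transition c c' z $ \<mu>) z = ?J (axis \<alpha> 1) $ \<mu>" for \<alpha> \<mu>
  proof -
    have d: "((\<lambda>z. transition c c' z $ \<mu>) has_derivative (\<lambda>v. ?J v $ \<mu>)) (at z)"
      using bounded_linear.has_derivative[OF bounded_linear_vec_nth dJ] .
    have "cderiv (wz (axis \<alpha> 1)) (\<lambda>z. transition c c' z $ \<mu>) z = ?J (axis \<alpha> 1) $ \<mu>"
      by (rule dzbar_holomorphic(2)[OF d]) (use lJ in \<open>simp add: complex_linear_def\<close>)
    moreover have "(\<lambda>z. transition c c' z $ \<mu>) differentiable (at z)" using d unfolding differentiable_def by blast
    ultimately show ?thesis using cderiv_wz_axis(1) by metis
  qed
  have "param c z \<in> cdom c \<inter> cdom c'" using op by blast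
  then have law: "Hm c z $ \<alpha> $ \<beta> = (\<Sum>\<mu>\<in>UNIV. \<Sum>\<nu>\<in>UNIV. Hm c' (transition c c' z) $ \<mu> $ \<nu>
      * ?J (axis \<alpha> 1) $ \<mu> * cnj (?J (axis \<beta> 1) $ \<nu>))" for \<alpha> \<beta>
    using h0[unfolded hermitian_metric_def, THEN conjunct2, rule_format, OF c, of "param c z" \<alpha> \<beta>]
    by (simp add: Hm_def in_chart_def op(4) D param_transition[OF MX c z])
  have lin: "linear ?J" using dJ has_derivative_linear by blast
  show ?thesis
    unfolding herm_def law complex_linear_2[OF lin lJ, of a] complex_linear_2[OF lin lJ, of b]
    by (simp add: sum_2 algebra_simps)
qed

lemma Hr_transition:
  "c \<in> A \<Longrightarrow> c' \<in> A \<Longrightarrow> z \<in> overlap c c' \<Longrightarrow> Hr c z v = Hr c' (transition c c' z) (J c c' z v)"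
  by (simp add: Hr_def herm_transition)

lemma en_transition:
  "c \<in> A \<Longrightarrow> c' \<in> A \<Longrightarrow> z \<in> overlap c c' \<Longrightarrow> en c z v = en c' (transition c c' z) (J c c' z v)"
  by (simp add: en_def eta_transition)

lemma vcderiv_cu_bar:
  assumes "c \<in> A" "d \<in> B" "z \<in> W c d"
  shows "vcderiv (bar p) (\<lambda>w. cvec (u c d w)) z = vcnj (vcderiv p (\<lambda>w. cvec (u c d w)) z)"
  using vcderiv_vcnj[OF differentiable_cu[OF assms], of "bar p"] by (simp del: vcderiv_nth)

lemma en_eq:
  assumes "c \<in> A" "d \<in> B" "z \<in> W c d"
  shows "en c z v = Re (riem.CG (in_chart g d) (u c d z) (vcderiv (wz v) (\<lambda>w. cvec (u c d w)) z)
      (vcnj (vcderiv (wz v) (\<lambda>w. cvec (u c d w)) z)))"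
  by (simp add: en_def eta_eq[OF assms] E_def vcderiv_cu_bar[OF assms] del: vcderiv_nth)

lemma en_eq_0:
  assumes "c \<in> A" "d \<in> B" "z \<in> W c d" "en c z v \<le> 0"
  shows "vcderiv (wz v) (\<lambda>w. cvec (u c d w)) z = 0"
proof -
  interpret riem "in_chart g d" "coord d ` cdom d" by (rule riem_chart[OF assms(2)])
  show ?thesis
    using CG_pos[OF u_in[OF assms(1,3)]] assms(4) unfolding en_eq[OF assms(1-3)] by (meson not_less)
qed

lemma en_scale: "sesq (eta c z) \<Longrightarrow> en c z (r *\<^sub>R v) = r\<^sup>2 * en c z v"
proof -
  assume s: "sesq (eta c z)"
  have "eta c z (r *\<^sub>R v) (r *\<^sub>R v) = of_real (r\<^sup>2) * eta c z v v"
    unfolding s[unfolded sesq_def, rule_format, of "r *\<^sub>R v" "r *\<^sub>R v"] s[unfolded sesq_def, rule_format, of v v]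
    by (simp add: sum_2 scaleR_conv_of_real[where 'a=complex] power2_eq_square algebra_simps)
  then show ?thesis by (simp add: en_def)
qed

lemma Hr_scale: "Hr c z (r *\<^sub>R v) = r\<^sup>2 * Hr c z v"
proof -
  have "herm (Hm c z) (r *\<^sub>R v) (r *\<^sub>R v) = of_real (r\<^sup>2) * herm (Hm c z) v v"
    by (simp add: herm_def sum_2 scaleR_conv_of_real[where 'a=complex] power2_eq_square algebra_simps)
  then show ?thesis by (simp add: Hr_def)
qed

text \<open>Smoothness of \<open>eta\<close> is known in the base point with the vectors fixed;
  expanding sesquilinearly in the vector makes the continuity joint.\<close>

lemma continuous_en_Hr:
  assumes c: "c \<in> A"
  shows "continuous_on (coord c ` cdom c \<times> UNIV) (\<lambda>p. en c (fst p) (snd p))"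
    "continuous_on (coord c ` cdom c \<times> UNIV) (\<lambda>p. Hr c (fst p) (snd p))"
proof -
  let ?U = "coord c ` cdom c"
  have ce: "continuous_on (?U \<times> UNIV) (\<lambda>p. eta c (fst p) a b)" for a b
    by (rule continuous_on_compose2[OF Ck_on_imp_continuous[OF Ck_eta[OF c]]]) (auto intro!: continuous_intros)
  have "continuous_on (?U \<times> UNIV) (\<lambda>p. Re (\<Sum>\<alpha>\<in>UNIV. \<Sum>\<beta>\<in>UNIV. snd p $ \<alpha> * cnj (snd p $ \<beta>) * eta c (fst p) (axis \<alpha> 1) (axis \<beta> 1)))"
    by (intro continuous_intros ce)
  then show "continuous_on (?U \<times> UNIV) (\<lambda>p. en c (fst p) (snd p))"
  proof (rule continuous_on_eq)
    fix p :: "(complex^2) \<times> (complex^2)" assume "p \<in> ?U \<times> UNIV"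
    then have "sesq (eta c (fst p))" using sesq_eta[OF c] by auto
    then show "Re (\<Sum>\<alpha>\<in>UNIV. \<Sum>\<beta>\<in>UNIV. snd p $ \<alpha> * cnj (snd p $ \<beta>) * eta c (fst p) (axis \<alpha> 1) (axis \<beta> 1)) = en c (fst p) (snd p)"
      unfolding sesq_def en_def by metis
  qed
  have ch: "continuous_on (?U \<times> UNIV) (\<lambda>p. Hm c (fst p) $ \<gamma> $ \<delta>)" for \<gamma> \<delta>
    by (rule continuous_on_compose2[OF Ck_on_imp_continuous[OF Ck_Hm[OF c]]]) (auto intro!: continuous_intros)
  show "continuous_on (?U \<times> UNIV) (\<lambda>p. Hr c (fst p) (snd p))"
    unfolding Hr_def herm_def by (intro continuous_intros ch)
qed

text \<open>The quotient of \<open>en\<close> by \<open>Hr\<close> is homogeneous of degree zero and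
  independent of the chart. Its values are therefore all attained on the products of the finitely
  many compact sets \<open>KK i\<close> with the unit sphere, which stand in for the compact sphere
  bundle.\<close>

lemma max_exists:
  assumes "topspace X \<noteq> {}"
  shows "\<exists>\<kappa>. (\<forall>c\<in>A. \<forall>z\<in>coord c ` cdom c. \<forall>v. en c z v \<le> \<kappa> * Hr c z v) \<and>
     (\<exists>c\<in>A. \<exists>z\<in>coord c ` cdom c. \<exists>v. v \<noteq> 0 \<and> en c z v = \<kappa> * Hr c z v)"
proof (rule partition_of_unity)
  fix I :: "'a set" and cc dd KK and \<psi> :: "'a \<Rightarrow> 'a \<Rightarrow> real"
  assume P: "finite I" "\<And>i. i \<in> I \<Longrightarrow> cc i \<in> A" "\<And>i. i \<in> I \<Longrightarrow> dd i \<in> B"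
    "\<And>i. i \<in> I \<Longrightarrow> compact (KK i)" "\<And>i. i \<in> I \<Longrightarrow> KK i \<subseteq> W (cc i) (dd i)"
    "\<And>i. i \<in> I \<Longrightarrow> C2X (\<psi> i)" "\<And>i p. i \<in> I \<Longrightarrow> p \<in> topspace X \<Longrightarrow> 0 \<le> \<psi> i p"
    "\<And>i p. i \<in> I \<Longrightarrow> p \<in> topspace X \<Longrightarrow> \<psi> i p \<noteq> 0 \<Longrightarrow> p \<in> cdom (cc i) \<and> coord (cc i) p \<in> KK i"
    "\<And>p. p \<in> topspace X \<Longrightarrow> (\<Sum>i\<in>I. \<psi> i p) = 1"
  have cover: "\<exists>i\<in>I. p \<in> cdom (cc i) \<and> coord (cc i) p \<in> KK i" if pX: "p \<in> topspace X" for p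
  proof -
    obtain i where "i \<in> I" "\<psi> i p \<noteq> 0" using P(9)[OF pX] by (metis sum.neutral zero_neq_one)
    then show ?thesis using P(8)[of i p] pX by blast
  qed
  have KU: "KK i \<subseteq> coord (cc i) ` cdom (cc i)" if "i \<in> I" for i using P(5)[OF that] W_subset by blast
  let ?S = "sphere (0::complex^2) 1"
  define q where "q i p = en (cc i) (fst p) (snd p) / Hr (cc i) (fst p) (snd p)" for i and p :: "(complex^2) \<times> (complex^2)"
  have Sn: "snd p \<noteq> 0" if "p \<in> KK i \<times> ?S" for p i using that by auto
  have cont: "continuous_on (KK i \<times> ?S) (q i)" if "i \<in> I" for i
  proof -
    have sub: "KK i \<times> ?S \<subseteq> coord (cc i) ` cdom (cc i) \<times> UNIV" using KU[OF that] by auto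
    have "Hr (cc i) (fst p) (snd p) \<noteq> 0" if "p \<in> KK i \<times> ?S" for p
      using Hr_pos[OF P(2)[OF \<open>i \<in> I\<close>], of "fst p" "snd p"] Sn[OF that] KU[OF \<open>i \<in> I\<close>] that by fastforce
    then show ?thesis
      unfolding q_def
      using continuous_on_subset[OF continuous_en_Hr(1)[OF P(2)[OF that]] sub]
        continuous_on_subset[OF continuous_en_Hr(2)[OF P(2)[OF that]] sub]
      by (intro continuous_on_divide) auto
  qed
  define Q where "Q = (\<Union>i\<in>I. q i ` (KK i \<times> ?S))"
  have "compact Q"
    unfolding Q_def using P(1,4) cont
    by (intro compact_UN compact_continuous_image compact_Times compact_sphere) auto
  moreover have "Q \<noteq> {}"
  proof -
    obtain p where "p \<in> topspace X" using assms by blast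
    then obtain i where "i \<in> I" "coord (cc i) p \<in> KK i" using cover by blast
    moreover have "axis 1 1 \<in> ?S" by simp
    ultimately show ?thesis unfolding Q_def by blast
  qed
  ultimately obtain \<kappa> where \<kappa>: "\<kappa> \<in> Q" "\<And>t. t \<in> Q \<Longrightarrow> t \<le> \<kappa>" using compact_attains_sup by metis
  have bound1: "en (cc i) z v \<le> \<kappa> * Hr (cc i) z v" if i: "i \<in> I" and z: "z \<in> KK i" for i z v
  proof (cases "v = 0")
    case True
    have "sesq (eta (cc i) z)" using sesq_eta[OF P(2)[OF i]] KU[OF i] z by blast
    then show ?thesis using True en_scale[of "cc i" z 0 v] Hr_scale[of "cc i" z 0 v] by simp
  next
    case False
    define s where "s = (1 / norm v) *\<^sub>R v"
    have "norm s = 1" using False by (simp add: s_def)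
    then have "q i (z, s) \<in> Q" unfolding Q_def using i z by force
    then have "q i (z, s) \<le> \<kappa>" by (rule \<kappa>(2))
    moreover have zU: "z \<in> coord (cc i) ` cdom (cc i)" using KU[OF i] z by blast
    moreover have "s \<noteq> 0" using \<open>norm s = 1\<close> by auto
    ultimately have "en (cc i) z s \<le> \<kappa> * Hr (cc i) z s"
      using Hr_pos[OF P(2)[OF i] zU, of s] by (simp add: q_def pos_divide_le_eq)
    then have "(norm v)\<^sup>2 * en (cc i) z s \<le> (norm v)\<^sup>2 * (\<kappa> * Hr (cc i) z s)" by (simp add: mult_left_mono)
    moreover have v: "v = norm v *\<^sub>R s" using False by (simp add: s_def)
    ultimately show ?thesis
      using en_scale[OF sesq_eta[OF P(2)[OF i] zU], of "norm v" s] Hr_scale[of "cc i" z "norm v" s]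
      by (simp add: v[symmetric] mult_ac)
  qed
  have "en c z v \<le> \<kappa> * Hr c z v" if c: "c \<in> A" and z: "z \<in> coord c ` cdom c" for c z v
  proof -
    obtain i where i: "i \<in> I" "param c z \<in> cdom (cc i)" "coord (cc i) (param c z) \<in> KK i"
      using cover[OF param_in[OF c z]] by blast
    have o: "z \<in> overlap c (cc i)" by (rule overlapI[OF z i(2)])
    have "transition c (cc i) z \<in> KK i" using i(3) by (simp add: transition_def)
    then show ?thesis
      using bound1[OF i(1)] en_transition[OF c P(2)[OF i(1)] o] Hr_transition[OF c P(2)[OF i(1)] o] by simp
  qed
  moreover have "\<exists>c\<in>A. \<exists>z\<in>coord c ` cdom c. \<exists>v. v \<noteq> 0 \<and> en c z v = \<kappa> * Hr c z v"
  proof -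
    obtain i p where i: "i \<in> I" "p \<in> KK i \<times> ?S" "\<kappa> = q i p" using \<kappa>(1) unfolding Q_def by blast
    have pU: "fst p \<in> coord (cc i) ` cdom (cc i)" using KU[OF i(1)] i(2) by auto
    have "en (cc i) (fst p) (snd p) = \<kappa> * Hr (cc i) (fst p) (snd p)"
      using Hr_pos[OF P(2)[OF i(1)] pU Sn[OF i(2)]] by (simp add: i(3) q_def)
    then show ?thesis using P(2)[OF i(1)] pU Sn[OF i(2)] by blast
  qed
  ultimately show ?thesis by blast
qed

lemma max_nonpos:
  assumes bound: "\<And>c z v. c \<in> A \<Longrightarrow> z \<in> coord c ` cdom c \<Longrightarrow> en c z v \<le> \<kappa> * Hr c z v"
    and c0: "c0 \<in> A" "z0 \<in> coord c0 ` cdom c0" "v0 \<noteq> 0" "en c0 z0 v0 = \<kappa> * Hr c0 z0 v0"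
  shows "\<kappa> \<le> 0"
proof (rule ccontr)
  assume "\<not> \<kappa> \<le> 0"
  then have \<kappa>: "0 < \<kappa>" by simp
  let ?p = "param c0 z0"
  show False
  proof (rule pluriharmonic[OF param_in[OF c0(1,2)]])
    fix c d S
    assume c: "c \<in> A" and d: "d \<in> B" and pc: "?p \<in> cdom c" and S: "open S" and SW: "S \<subseteq> W c d"
      and zS: "coord c ?p \<in> S" and flat: "\<And>z \<alpha> \<beta>. z \<in> S \<Longrightarrow> hess c d \<alpha> \<beta> z = 0"
    interpret riem "in_chart g d" "coord d ` cdom d" by (rule riem_chart[OF d])
    let ?U = "coord c ` cdom c" and ?u = "u c d" and ?c = "\<lambda>w. cvec (u c d w)"
    have SU: "S \<subseteq> ?U" using SW W_subset by blast
    have uS: "?u ` S \<subseteq> coord d ` cdom d" using u_image[OF c] SW by blast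
    have Cu: "Ck_on k S ?u" for k by (rule Ck_on_subset[OF Ck_u[OF c d] SW])
    have Cc: "Ck_on k S ?c" for k by (rule Ck_on_cvec[OF S Cu])
    have Cv: "Ck_on k S (vcderiv p ?c)" for k p by (rule Ck_on_vcderiv[OF S Cc])
    have dc: "?c differentiable (at z)" and du: "?u differentiable (at z)" and dv: "vcderiv p ?c differentiable (at z)" if "z \<in> S" for z p
      using C1_differentiable[OF Cc that] C1_differentiable[OF Cu that] C1_differentiable[OF Cv that] by blast+
    have barc: "vcderiv (bar p) ?c z = vcnj (vcderiv p ?c z)" if "z \<in> S" for p z
      using vcderiv_cu_bar[OF c d] SW that by blast
    \<comment> \<open>The maximum may be attained in a chart other than the one in which the Hessian
      is known to vanish; point and vector are carried over by the transition, under which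
      \<open>en\<close> and \<open>Hr\<close> are invariant.\<close>
    have o: "z0 \<in> overlap c0 c" by (rule overlapI[OF c0(2) pc])
    define z1 where "z1 = coord c ?p"
    have z1: "z1 = transition c0 c z0" by (simp add: z1_def transition_def)
    have z1S: "z1 \<in> S" using zS by (simp add: z1_def)
    have z1U: "z1 \<in> ?U" using z1S SU by blast
    have uz1: "?u z1 \<in> coord d ` cdom d" using uS z1S by blast
    define v1 where "v1 = J c0 c z0 v0"
    have H1: "Hr c z1 v1 = Hr c0 z0 v0" "en c z1 v1 = en c0 z0 v0"
      using Hr_transition[OF c0(1) c o] en_transition[OF c0(1) c o] by (simp_all add: z1 v1_def)
    have Hp: "0 < Hr c z1 v1" using Hr_pos[OF c0(1-3)] H1 by simp
    have v1n: "v1 \<noteq> 0" using Hp by (auto simp: Hr_def herm_def)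
    obtain a where a: "\<And>v. v \<noteq> 0 \<Longrightarrow> 0 < Re (chern_form (Hm c) z1 a v)"
      using rc c pc unfolding uniformly_RC_positive_def Hm_def z1_def by blast
    have "a \<noteq> 0" using a[OF v1n] by (auto simp: chern_form_def)
    then obtain k where k: "a $ k \<noteq> 0" by (auto simp: vec_eq_iff)
    have CH: "Ck_on 2 S (\<lambda>z. Hm c z $ \<gamma> $ \<delta>)" for \<gamma> \<delta> by (rule Ck_on_subset[OF Ck_Hm[OF c] SU])
    have inv: "invertible (Hm c z1)"
    proof -
      have "x = 0" if "Hm c z1 *v x = 0" for x
      proof (rule ccontr)
        assume "x \<noteq> 0"
        \<comment> \<open>The second index of a Hermitian matrix is the conjugated one, so a kernel
          vector \<open>x\<close> is tested on its conjugate.\<close>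
        then have n: "vcnj x \<noteq> 0" by (auto simp: vec_eq_iff)
        have "herm (Hm c z1) (vcnj x) (vcnj x) = (\<Sum>\<gamma>\<in>UNIV. cnj (x $ \<gamma>) * (Hm c z1 *v x) $ \<gamma>)"
          by (simp add: herm_def matrix_vector_mult_def sum_2 algebra_simps)
        then show False using Hr_pos[OF c z1U n] that by (simp add: Hr_def)
      qed
      then show ?thesis
        using matrix_left_invertible_ker invertible_left_inverse by blast
    qed
    obtain w where w: "levi (\<lambda>z. herm (Hm c z) (v1 + ((z $ k - z1 $ k) / a $ k) *s w)
        (v1 + ((z $ k - z1 $ k) / a $ k) *s w)) z1 a a = - chern_form (Hm c) z1 a v1"
      using chern_second_derivative[OF S z1S CH inv k] by blast
    define v where "v z = v1 + ((z $ k - z1 $ k) / a $ k) *s w" for z :: "complex^2"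
    have vz1: "v z1 = v1" by (simp add: v_def)
    have Cvk: "Ck_on m S (\<lambda>z. v z $ \<gamma>)" for m \<gamma>
      unfolding v_def vector_add_component vector_smult_component divide_inverse
      by (intro Ck_on_add Ck_on_mult Ck_on_diff Ck_on_const S Ck_on_linear[OF bounded_linear_vec_nth])
    have dvk: "(\<lambda>z. v z $ \<gamma>) differentiable (at z)" if "z \<in> S" for \<gamma> z by (rule C1_differentiable[OF Cvk that])
    have vhol: "cderiv (bar (wz a)) (\<lambda>z. v z $ \<gamma>) z = 0" for \<gamma> z
    proof (rule dzbar_holomorphic(1))
      have "((\<lambda>z. z $ k) has_derivative (\<lambda>x. x $ k)) (at z)"
        by (rule bounded_linear_imp_has_derivative[OF bounded_linear_vec_nth])
      then show "((\<lambda>z. v z $ \<gamma>) has_derivative (\<lambda>x. x $ k * (w $ \<gamma> / a $ k))) (at z)"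
        unfolding v_def using k by (auto intro!: derivative_eq_intros)
    qed simp
    \<comment> \<open>The field \<partial>f(v), written through coordinate derivatives so that the
      product rule \<open>nab_scale\<close> separates the coefficients of \<open>v\<close> from the
      map.\<close>
    define \<xi> where "\<xi> z = v z $ 1 *s vcderiv (ez 1) ?c z + v z $ 2 *s vcderiv (ez 2) ?c z" for z
    have C\<xi>: "Ck_on m S \<xi>" for m
    proof -
      have "Ck_on m S (\<lambda>z. \<xi> z $ i)" for i
      proof -
        have "Ck_on m S (\<lambda>z. vcderiv p ?c z $ i)" for p
          by (rule Ck_on_linear_comp[OF S bounded_linear_vec_nth Cv])
        then show ?thesis
          unfolding \<xi>_def vector_add_component vector_smult_component
          by (intro Ck_on_add Ck_on_mult Cvk S)
      qed
      then show ?thesis using Ck_on_componentwise[OF S] by blast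
    qed
    have \<xi>v: "\<xi> z = vcderiv (wz (v z)) ?c z" if "z \<in> S" for z
      unfolding \<xi>_def vcderiv_wz_sum(1)[OF dc[OF that], of "v z"] by (simp add: sum_2 del: vcderiv_nth)
    have nabv: "nab (bar (wz b)) ?u (vcderiv (ez \<alpha>) ?c) z = 0" if "z \<in> S" for b \<alpha> z
      unfolding nab_wz[OF dc[OF that] dv[OF that], of b] using flat[OF that, of \<alpha>] by (simp add: hess_def sum_2)
    \<comment> \<open>The coefficients of \<open>v\<close> are holomorphic, and the coordinate
      derivatives of the map are parallel in antiholomorphic directions because the Hessian vanishes
      on all of \<open>S\<close>.\<close>
    have nab\<xi>: "nab (bar (wz a)) ?u \<xi> z = 0" if "z \<in> S" for z
    proof -
      have d: "(\<lambda>z. v z $ i *s vcderiv (ez i) ?c z) differentiable (at z)" for i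
      proof -
        have "Ck_on 1 S (\<lambda>z. (v z $ i *s vcderiv (ez i) ?c z) $ j)" for j
          unfolding vector_smult_component
          by (intro Ck_on_mult Cvk S Ck_on_linear_comp[OF S bounded_linear_vec_nth Cv])
        then have "Ck_on 1 S (\<lambda>z. v z $ i *s vcderiv (ez i) ?c z)" using Ck_on_componentwise[OF S] by blast
        then show ?thesis by (rule C1_differentiable[OF _ that])
      qed
      show ?thesis
        unfolding \<xi>_def[abs_def] nab_add[OF d d]
        using nab_scale[OF dvk[OF that, of 1] dv[OF that, of "ez 1"], of "bar (wz a)" ?u]
          nab_scale[OF dvk[OF that, of 2] dv[OF that, of "ez 2"], of "bar (wz a)" ?u]
        by (simp add: vhol nabv[OF that])
    qed
    have d\<xi>: "\<xi> differentiable (at z)" if "z \<in> S" for z by (rule C1_differentiable[OF C\<xi> that])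
    define \<zeta> where "\<zeta> z = vcnj (\<xi> z)" for z
    have C\<zeta>: "Ck_on m S \<zeta>" for m unfolding \<zeta>_def by (rule Ck_on_vcnj[OF S C\<xi>])
    have nab\<zeta>: "nab p ?u \<zeta> z = vcnj (nab (bar p) ?u \<xi> z)" if "z \<in> S" for p z
      unfolding \<zeta>_def by (rule nab_vcnj[OF du[OF that] d\<xi>[OF that]])
    have hessE: "levi (\<lambda>z. CG (?u z) (\<xi> z) (\<zeta> z)) z1 a a = CG (?u z1) (nab (wz a) ?u \<xi> z1) (vcnj (nab (wz a) ?u \<xi> z1))
       + CG (?u z1) (\<xi> z1) (Rm (?u z1) (vcderiv (wz a) ?c z1) (vcnj (vcderiv (wz a) ?c z1)) (vcnj (\<xi> z1)))"
      unfolding levi_def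
      using energy_hessian[OF S z1S uS Cu C\<xi> C\<zeta>, of "bar (wz a)" "wz a"] nab\<xi> nab\<zeta> z1S barc[OF z1S, of "wz a"]
      by (simp add: \<zeta>_def del: vcderiv_nth)
    have flat2: "nab (bar (wz a)) ?u (vcderiv (wz b) ?c) z = 0" if "z \<in> S" for b z
    proof -
      have "nab (bar (wz a)) ?u (vcderiv (wz b) ?c) z = nab (bar (wz a)) ?u (\<lambda>z. b $ 1 *s vcderiv (ez 1) ?c z + b $ 2 *s vcderiv (ez 2) ?c z) z"
        by (rule nab_cong[OF S that]) (simp add: vcderiv_wz_sum(1)[OF dc, where u=b] sum_2 del: vcderiv_nth)
      moreover have d: "(\<lambda>z. b $ i *s vcderiv (ez i) ?c z) differentiable (at z)" for i
      proof -
        have "Ck_on 1 S (\<lambda>z. (b $ i *s vcderiv (ez i) ?c z) $ j)" for j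
          unfolding vector_smult_component
          by (intro Ck_on_mult Ck_on_const S Ck_on_linear_comp[OF S bounded_linear_vec_nth Cv])
        then have "Ck_on 1 S (\<lambda>z. b $ i *s vcderiv (ez i) ?c z)" using Ck_on_componentwise[OF S] by blast
        then show ?thesis by (rule C1_differentiable[OF _ that])
      qed
      ultimately show ?thesis
        unfolding nab_add[OF d d]
        using nab_scale[OF differentiable_const dv[OF that, of "ez 1"], of "bar (wz a)" ?u "b $ 1"]
          nab_scale[OF differentiable_const dv[OF that, of "ez 2"], of "bar (wz a)" ?u "b $ 2"]
        by (simp add: nabv[OF that])
    qed
    \<comment> \<open>The derivative of the map along \<open>bar (wz a)\<close> is parallel in all
      (1,0) directions near \<open>z1\<close>. Its commutator for the directions \<open>a\<close>
      and \<open>v1\<close> is this curvature and vanishes.\<close>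
    have Rz: "Rm (?u z1) (vcderiv (wz a) ?c z1) (\<xi> z1) (vcnj (vcderiv (wz a) ?c z1)) = 0"
    proof -
      have fl: "nab (wz b) ?u (vcderiv (bar (wz a)) ?c) z = 0" if "z \<in> S" for b z
        using nab_sym[OF S that uS Cu, of "wz b" "bar (wz a)"] flat2[OF that] by simp
      have z0: "nab p ?u (nab (wz b) ?u (vcderiv (bar (wz a)) ?c)) z1 = 0" for p b
        using nab_cong[OF S z1S, of "nab (wz b) ?u (vcderiv (bar (wz a)) ?c)" "\<lambda>_. 0" p ?u] fl
        by (simp add: nab_def Gam_simps vec_eq_iff)
      show ?thesis
        using nab_curvature[OF S z1S uS Cu Cv, of "wz a" "wz v1" "bar (wz a)"] z0
        by (simp add: \<xi>v[OF z1S] vz1 barc[OF z1S] del: vcderiv_nth)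
    qed
    \<comment> \<open>The two terms of \<open>hessE\<close> are the squared length of the covariant
      derivative of \<xi> and the curvature term handled by
      \<open>pluriharmonic_curvature_sign\<close>.\<close>
    have energy: "0 \<le> Re (levi (\<lambda>z. CG (?u z) (\<xi> z) (\<zeta> z)) z1 a a)"
      unfolding hessE
      using CG_nonneg[OF uz1, of "nab (wz a) ?u \<xi> z1"]
        pluriharmonic_curvature_sign[OF uz1 nonpos_at_chart[OF d uz1] Rz] by simp
    define F where "F z = of_real \<kappa> * herm (Hm c z) (v z) (v z) - CG (?u z) (\<xi> z) (\<zeta> z)" for z
    have Ch: "Ck_on 2 S (\<lambda>z. herm (Hm c z) (v z) (v z))"
      unfolding herm_def by (intro Ck_on_sum Ck_on_mult Ck_on_cnj S CH Cvk)
    have Ce: "Ck_on 2 S (\<lambda>z. CG (?u z) (\<xi> z) (\<zeta> z))"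
      by (rule Ck_CG[OF S uS Cu C\<xi> C\<zeta>])
    have CF: "Ck_on 2 S F" unfolding F_def by (intro Ck_on_diff Ck_on_mult Ck_on_const S Ch Ce)
    have Fre: "Re (F z) = \<kappa> * Hr c z (v z) - en c z (v z)" if "z \<in> S" for z
      using en_eq[OF c d, of z "v z"] SW that
      by (auto simp: F_def Hr_def \<zeta>_def \<xi>v[OF that] simp del: vcderiv_nth)
    have Fn: "0 \<le> Re (F z)" if "z \<in> S" for z
      using Fre[OF that] bound[OF c, of z "v z"] SU that by auto
    have F0: "Re (F z1) = 0" using Fre[OF z1S] H1 c0(4) by (simp add: vz1)
    have "0 \<le> Re (levi F z1 a a)" by (rule levi_nonneg_at_minimum[OF S z1S CF Fn F0])
    moreover have "levi F z1 a a = of_real \<kappa> * levi (\<lambda>z. herm (Hm c z) (v z) (v z)) z1 a a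
        - levi (\<lambda>z. CG (?u z) (\<xi> z) (\<zeta> z)) z1 a a"
    proof -
      have 1: "(\<lambda>z. herm (Hm c z) (v z) (v z)) differentiable (at z)" "(\<lambda>z. CG (?u z) (\<xi> z) (\<zeta> z)) differentiable (at z)" if "z \<in> S" for z
        using C1_differentiable[OF C2_cderiv(2)[OF S Ch] that] C1_differentiable[OF C2_cderiv(2)[OF S Ce] that] by blast+
      have 2: "cderiv p (\<lambda>z. herm (Hm c z) (v z) (v z)) differentiable (at z1)" "cderiv p (\<lambda>z. CG (?u z) (\<xi> z) (\<zeta> z)) differentiable (at z1)" for p
        using C1_differentiable[OF C2_cderiv(1)[OF S Ch] z1S] C1_differentiable[OF C2_cderiv(1)[OF S Ce] z1S] by blast+
      have "levi F z1 a a = cderiv (wz a) (\<lambda>z. of_real \<kappa> * cderiv (bar (wz a)) (\<lambda>z. herm (Hm c z) (v z) (v z)) z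
          - cderiv (bar (wz a)) (\<lambda>z. CG (?u z) (\<xi> z) (\<zeta> z)) z) z1"
        unfolding levi_def F_def[abs_def]
        by (rule cderiv_cong[OF S z1S]) (simp add: cderiv_diff cderiv_cmult 1 differentiable_mult)
      then show ?thesis by (simp add: cderiv_diff cderiv_cmult 2 differentiable_mult levi_def)
    qed
    moreover have "levi (\<lambda>z. herm (Hm c z) (v z) (v z)) z1 a a = - chern_form (Hm c) z1 a v1"
      using w unfolding v_def .
    ultimately have "\<kappa> * Re (chern_form (Hm c) z1 a v1) \<le> 0" using energy by simp
    then show False using a[OF v1n] \<kappa> by (simp add: mult_le_0_iff)
  qed
qed

text \<open>A nonpositive \<kappa> together with positivity of \<open>h0\<close> leaves no positive
  value of \<open>en\<close>, so all (1,0) derivatives of the map vanish. The map is real, hence its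
  differential is zero and it is locally constant; connectedness makes the set where it takes a
  given value everything.\<close>

lemma f_constant: "f constant_on topspace X"
proof (cases "topspace X = {}")
  case True
  then show ?thesis by (simp add: constant_on_def)
next
  case False
  then obtain \<kappa> where \<kappa>: "\<And>c z v. c \<in> A \<Longrightarrow> z \<in> coord c ` cdom c \<Longrightarrow> en c z v \<le> \<kappa> * Hr c z v"
    "\<exists>c\<in>A. \<exists>z\<in>coord c ` cdom c. \<exists>v. v \<noteq> 0 \<and> en c z v = \<kappa> * Hr c z v"
    using max_exists by metis
  then have "\<kappa> \<le> 0" using max_nonpos[OF \<kappa>(1)] by blast
  have en0: "en c z v \<le> 0" if "c \<in> A" "z \<in> coord c ` cdom c" for c z v
  proof (cases "v = 0")
    case True
    then show ?thesis using \<kappa>(1)[OF that, of v] by (simp add: Hr_def herm_def)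
  next
    case False
    then show ?thesis using \<kappa>(1)[OF that, of v] Hr_pos[OF that False] \<open>\<kappa> \<le> 0\<close>
      by (meson mult_nonpos_nonneg less_imp_le order_trans)
  qed
  have loc: "\<exists>T. openin X T \<and> p \<in> T \<and> (\<forall>q\<in>T. f q = f p)" if p: "p \<in> topspace X" for p
  proof -
    obtain c d where chs: "c \<in> A" "p \<in> cdom c" "d \<in> B" "f p \<in> cdom d"
      using ex_source_chart[OF p] ex_target_chart[OF p] by blast
    have z: "coord c p \<in> W c d" using chs by (auto simp: W_def)
    obtain r where r: "r > 0" "ball (coord c p) r \<subseteq> W c d"
      using open_W[OF chs(1,3)] z openE by blast
    have der: "(u c d has_derivative (\<lambda>v. 0)) (at w)" if w: "w \<in> ball (coord c p) r" for w
    proof -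
      have wW: "w \<in> W c d" using r(2) w by blast
      then have wU: "w \<in> coord c ` cdom c" using W_subset by blast
      note du = differentiable_u[OF chs(1,3) wW]
      have "frechet_derivative (u c d) (at w) v = 0" for v
      proof -
        \<comment> \<open>The factor 2 undoes the half in \<open>wz\<close>, so the real part of
          this derivative is the ordinary derivative along \<open>v\<close>.\<close>
        have "vcderiv (wz (2 *\<^sub>R v)) (\<lambda>w. cvec (u c d w)) w = 0"
          by (rule en_eq_0[OF chs(1,3) wW en0[OF chs(1) wU]])
        then have "cderiv (wz (2 *\<^sub>R v)) (\<lambda>w. of_real (u c d w $ i)) w = 0" for i
          by (simp add: vec_eq_iff)
        then have "Re (cderiv (wz (2 *\<^sub>R v)) (\<lambda>w. of_real (u c d w $ i)) w) = 0" for i by simp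
        then show ?thesis
          by (simp add: cderiv_of_real[OF differentiable_vec_nth[OF du]] wz_def frechet_derivative_vec_nth[OF du] vec_eq_iff)
      qed
      then have "frechet_derivative (u c d) (at w) = (\<lambda>v. 0)" by (rule ext)
      then show ?thesis using frechet_derivative_worksI[OF du] by simp
    qed
    have const: "u c d w = u c d (coord c p)" if "w \<in> ball (coord c p) r" for w
      by (rule has_derivative_zero_unique[of "ball (coord c p) r" "u c d" _ "coord c p"])
        (use der that r(1) in \<open>auto intro: has_derivative_at_withinI\<close>)
    let ?T = "{q \<in> cdom c. coord c q \<in> ball (coord c p) r}"
    have "openin X ?T" by (rule chart_openin_vimage[OF MX chs(1)]) simp
    moreover have "p \<in> ?T" using chs r(1) by simp
    moreover have "f q = f p" if "q \<in> ?T" for q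
    proof -
      have q: "q \<in> cdom c" "coord c q \<in> ball (coord c p) r" using that by auto
      have "coord c q \<in> W c d" using r(2) q(2) by blast
      from W_param(2)[OF chs(1) this] have "f q \<in> cdom d" by (simp add: param_coord[OF MX chs(1) q(1)])
      moreover have "coord d (f q) = coord d (f p)"
        using const[OF q(2)] param_coord[OF MX chs(1)] q(1) chs(2) by (simp add: u_def local_rep_def)
      ultimately show ?thesis using chart_inj[OF MY chs(3)] chs(4) by (simp add: inj_on_eq_iff)
    qed
    ultimately show ?thesis by blast
  qed
  obtain p0 where p0: "p0 \<in> topspace X" using False by blast
  define T1 where "T1 = {p \<in> topspace X. f p = f p0}"
  define T2 where "T2 = {p \<in> topspace X. f p \<noteq> f p0}"
  have sub: "\<exists>T. openin X T \<and> p \<in> T \<and> T \<subseteq> {q \<in> topspace X. f q = f p}" if "p \<in> topspace X" for p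
    using loc[OF that] openin_subset by blast
  have "openin X T1"
  proof (subst openin_subopen, intro ballI)
    fix p assume "p \<in> T1"
    then have "p \<in> topspace X" "f p = f p0" by (simp_all add: T1_def)
    then show "\<exists>T. openin X T \<and> p \<in> T \<and> T \<subseteq> T1" using sub[of p] by (simp add: T1_def)
  qed
  moreover have "openin X T2"
  proof (subst openin_subopen, intro ballI)
    fix p assume "p \<in> T2"
    then have "p \<in> topspace X" and n: "f p \<noteq> f p0" by (simp_all add: T2_def)
    then obtain T where "openin X T" "p \<in> T" "T \<subseteq> {q \<in> topspace X. f q = f p}" using sub by blast
    moreover have "{q \<in> topspace X. f q = f p} \<subseteq> T2" using n by (auto simp: T2_def)
    ultimately show "\<exists>T. openin X T \<and> p \<in> T \<and> T \<subseteq> T2" by blast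
  qed
  moreover have "connected_space X" using MX unfolding connected_topological_manifold_def by blast
  moreover have "topspace X \<subseteq> T1 \<union> T2" "T1 \<inter> T2 = {}" "T1 \<noteq> {}" using p0 by (auto simp: T1_def T2_def)
  ultimately have "T2 = {}" unfolding connected_space_def by metis
  then have "\<forall>p\<in>topspace X. f p = f p0" by (auto simp: T2_def)
  then show ?thesis unfolding constant_on_def by blast
qed

end

theorem corollary1p10:
  fixes X :: "'a topology" and A :: "('a, complex^2) chart set"
    and h h0 :: "('a, 2) hmetric"
    and Y :: "'b topology" and B :: "('b, real^'n) chart set"
    and g :: "('b, 'n) rmetric"
    and f :: "'a \<Rightarrow> 'b"
  assumes "complex_surface X A" and "compact_space X"
    and "hermitian_metric A h"
    and "smooth_manifold Y B" and "riemannian_metric B g"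
    and "nonpositive_complex_sectional_curvature B g"
    and "hermitian_harmonic X A h Y B g f"
    and "hermitian_metric A h0" and "uniformly_RC_positive A h0"
  shows "f constant_on topspace X"
proof -
  interpret rc_setting X A h Y B g f h0
    by unfold_locales (fact assms)+
  show ?thesis by (rule f_constant)
qed

end
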